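(* Let $m,n,k,l$ be positive integers and let $X_{k,l}$ be a divisor of bidegree $(k,l)$ in $\mathbb{P}^m\times\mathbb{P}^n$. Then $X_{k,l}$ is semistable (respectively stable) if and only if $\mathcal{O}_{k,l}\in\operatorname{Conv}(X_{k,l})$ (respectively $\mathcal{O}_{k,l}\in\operatorname{Int}(\operatorname{Conv}(X_{k,l}))$).
   Context: We work over $\mathbb{C}$. Let $G=\operatorname{SL}(m+1)\times\operatorname{SL}(n+1)$; fix a maximal torus $T\subset G$ and coordinates $x_0,\dots,x_m$ on $\mathbb{P}^m$, $y_0,\dots,y_n$ on $\mathbb{P}^n$ in which $T$ is diagonal. A divisor $X_{k,l}$ of bidegree $(k,l)$ is given by a nonzero bihomogeneous polynomial $F=\sum_I c_Ix^I$, where $x^I=x_0^{k_0}\cdots x_m^{k_m}y_0^{l_0}\cdots y_n^{l_n}$, $I=(k_0,\dots,k_m,l_0,\dots,l_n)$, $\sum k_i=k$, $\sum l_j=l$; $\operatorname{Supp}(X_{k,l})=\{x^I:c_I\ne0\}$. Stability is GIT stability for the natural linearised action of $G$ on the projective space of such polynomials. Define $\xi(x^I)=(k_0,\dots,k_{m-1},l_0,\dots,l_{n-1})\in\mathbb{Z}^{m+n}$, let $\operatorname{Conv}(X_{k,l})\subset\mathbb{R}^{m+n}$ be the convex hull of $\xi(\operatorname{Supp}(X_{k,l}))$ and $\operatorname{Int}(\operatorname{Conv}(X_{k,l}))$ its interior. The centroid is $$\mathcal{O}_{k,l}=\Big(\underbrace{\tfrac{k}{m+1},\dots,\tfrac{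k}{m+1}}_{m},\underbrace{\tfrac{l}{n+1},\dots,\tfrac{l}{n+1}}_{n}\Big)\in\mathbb{Q}^{m+n}.$$
   Formalization: In one fixed coordinate system the "if" part fails: (x_0-x_1)^k(y_0-y_1)^l on P^1 x P^1 is unstable though the centroid is interior to its polytope. The condition is therefore required of Conv(g.X) for every g in G, i.e. in all coordinate systems. *)

theory Defs
  imports "HOL-Analysis.Analysis" "HOL-Library.Poly_Mapping"
begin

section \<open>Multivariate complex polynomials\<close>

text \<open>
  A polynomial is a finitely supported map from exponent vectors to coefficients; the ring structure
  is the one that \<^theory>\<open>HOL-Library.Poly_Mapping\<close> provides.
\<close>

type_synonym 'v monom = "'v \<Rightarrow>\<^sub>0 nat"
type_synonym 'v mpol = "'v monom \<Rightarrow>\<^sub>0 complex"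

definition Var :: "'v \<Rightarrow> 'v mpol" where
  "Var v = Poly_Mapping.single (Poly_Mapping.single v 1) 1"

definition Const :: "complex \<Rightarrow> 'v mpol" where
  "Const c = Poly_Mapping.single 0 c"

definition mpol_eval :: "('v \<Rightarrow> complex) \<Rightarrow> 'v mpol \<Rightarrow> complex" where
  "mpol_eval a P = (\<Sum>I\<in>Poly_Mapping.keys P. Poly_Mapping.lookup P I *
     (\<Prod>v\<in>Poly_Mapping.keys I. a v ^ Poly_Mapping.lookup I v))"

definition mpol_subst :: "('v \<Rightarrow> 'w mpol) \<Rightarrow> 'v mpol \<Rightarrow> 'w mpol" where
  "mpol_subst \<sigma> P = (\<Sum>I\<in>Poly_Mapping.keys P. Const (Poly_Mapping.lookup P I) *
     (\<Prod>v\<in>Poly_Mapping.keys I. \<sigma> v ^ Poly_Mapping.lookup I v))"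

definition homogeneous :: "nat \<Rightarrow> 'v mpol \<Rightarrow> bool" where
  "homogeneous d P \<longleftrightarrow>
     (\<forall>I\<in>Poly_Mapping.keys P. (\<Sum>v\<in>Poly_Mapping.keys I. Poly_Mapping.lookup I v) = d)"


section \<open>Bihomogeneous polynomials and the action of the group\<close>

text \<open>
  The positive integers \<open>m\<close> and \<open>n\<close> are the cardinalities of the finite index types \<open>'m\<close> and \<open>'n\<close>.
  The coordinates on \<open>P\<^sup>m\<close> are indexed by \<open>'m option\<close>: \<open>Some i\<close> stands for one of
  \<open>x_0, \<dots>, x_(m-1)\<close> and \<open>None\<close> for the last coordinate \<open>x_m\<close>. The same holds for \<open>P\<^sup>n\<close> and
  \<open>'n option\<close>; \<open>Inl\<close> marks the \<open>x\<close> variables and \<open>Inr\<close> the \<open>y\<close> variables.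
\<close>

type_synonym ('m, 'n) var = "'m option + 'n option"

definition bihom_space :: "nat \<Rightarrow> nat \<Rightarrow> ('m::finite, 'n::finite) var mpol set" where
  "bihom_space k l = {F. \<forall>I\<in>Poly_Mapping.keys F.
     (\<Sum>i\<in>UNIV. Poly_Mapping.lookup I (Inl i)) = k \<and>
     (\<Sum>j\<in>UNIV. Poly_Mapping.lookup I (Inr j)) = l}"

type_synonym ('m, 'n) mat_pair = "(complex^'m option^'m option) \<times> (complex^'n option^'n option)"

definition SL_SL :: "('m::finite, 'n::finite) mat_pair set" where
  "SL_SL = {(A, B). det A = 1 \<and> det B = 1}"

text \<open>The left action \<open>(g \<cdot> F)(x, y) = F(g\<inverse>(x, y))\<close>.\<close>

definition act :: "('m::finite, 'n::finite) mat_pair \<Rightarrow> ('m, 'n) var mpol \<Rightarrow> ('m, 'n) var mpol" where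
  "act g F = mpol_subst (\<lambda>v. case v of
       Inl i \<Rightarrow> (\<Sum>j\<in>UNIV. Const (matrix_inv (fst g) $ i $ j) * Var (Inl j))
     | Inr i \<Rightarrow> (\<Sum>j\<in>UNIV. Const (matrix_inv (snd g) $ i $ j) * Var (Inr j))) F"


section \<open>GIT stability\<close>

text \<open>
  The coordinates on \<open>bihom_space k l\<close> are the coefficients \<open>c_I\<close>, so a polynomial function on this
  space is a polynomial whose variables are themselves the monomials \<open>I\<close>, evaluated at the
  coefficient family of \<open>F\<close>. (Variables \<open>c_I\<close> with \<open>I\<close> not of bidegree \<open>(k, l)\<close> evaluate to \<open>0\<close>.)
\<close>

definition coeff_eval :: "'v monom mpol \<Rightarrow> 'v mpol \<Rightarrow> complex" where
  "coeff_eval P F = mpol_eval (Poly_Mapping.lookup F) P"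

text \<open>
  The invariant global sections of \<open>O(d)\<close> on the projective space of \<open>bihom_space k l\<close>.
\<close>

definition invariant_form ::
    "nat \<Rightarrow> nat \<Rightarrow> nat \<Rightarrow> ('m::finite, 'n::finite) var monom mpol \<Rightarrow> bool" where
  "invariant_form k l d P \<longleftrightarrow> homogeneous d P \<and>
     (\<forall>g\<in>SL_SL. \<forall>F\<in>bihom_space k l. coeff_eval P (act g F) = coeff_eval P F)"

definition git_semistable :: "nat \<Rightarrow> nat \<Rightarrow> ('m::finite, 'n::finite) var mpol \<Rightarrow> bool" where
  "git_semistable k l F \<longleftrightarrow> F \<in> bihom_space k l \<and> F \<noteq> 0 \<and>
     (\<exists>d>0. \<exists>P. invariant_form k l d P \<and> coeff_eval P F \<noteq> 0)"

text \<open>A point of projective space, as the set of its nonzero representatives.\<close>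

definition proj_pt :: "'v mpol \<Rightarrow> 'v mpol set" where
  "proj_pt F = {Const c * F | c. c \<noteq> 0}"

definition semistable_locus :: "nat \<Rightarrow> nat \<Rightarrow> ('m::finite, 'n::finite) var mpol set set" where
  "semistable_locus k l = {proj_pt F | F. git_semistable k l F}"

definition orbit :: "('m::finite, 'n::finite) var mpol \<Rightarrow> ('m, 'n) var mpol set set" where
  "orbit F = {proj_pt (act g F) | g. g \<in> SL_SL}"

definition stabilizer :: "('m::finite, 'n::finite) var mpol \<Rightarrow> ('m, 'n) mat_pair set" where
  "stabilizer F = {g \<in> SL_SL. proj_pt (act g F) = proj_pt F}"

text \<open>\<open>Z\<close> is closed in \<open>Y\<close> for the Zariski topology induced from projective space.\<close>

definition zariski_closed_in :: "'v mpol set set \<Rightarrow> 'v mpol set set \<Rightarrow> bool" where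
  "zariski_closed_in Y Z \<longleftrightarrow> (\<exists>S. (\<forall>Q\<in>S. \<exists>d. homogeneous d Q) \<and>
     Z = {p \<in> Y. \<forall>F\<in>p. \<forall>Q\<in>S. coeff_eval Q F = 0})"

text \<open>
  Stable means what Mumford calls properly stable: the stabilizer is finite and the orbit is closed
  in the semistable locus.
\<close>

definition git_stable :: "nat \<Rightarrow> nat \<Rightarrow> ('m::finite, 'n::finite) var mpol \<Rightarrow> bool" where
  "git_stable k l F \<longleftrightarrow> git_semistable k l F \<and> finite (stabilizer F) \<and>
     zariski_closed_in (semistable_locus k l) (orbit F)"


section \<open>The polytope and the centroid\<close>

definition xi :: "('m::finite, 'n::finite) var monom \<Rightarrow> real^('m + 'n)" where
  "xi I = (\<chi> v. case v of
       Inl i \<Rightarrow> real (Poly_Mapping.lookup I (Inl (Some i)))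
     | Inr j \<Rightarrow> real (Poly_Mapping.lookup I (Inr (Some j))))"

text \<open>
  The polytope depends on the coordinates, whereas stability under the whole group does not:
  \<open>(x_0 - x_1)^k (y_0 - y_1)^l\<close> is unstable although its polytope in these coordinates contains the
  centroid in its interior. The polytope of \<open>F\<close> in an arbitrary coordinate system is
  \<open>Conv (act g F)\<close>, with \<open>g\<close> in the group, since all maximal tori are conjugate.
\<close>

definition Conv :: "('m::finite, 'n::finite) var mpol \<Rightarrow> (real^('m + 'n)) set" where
  "Conv F = convex hull (xi ` Poly_Mapping.keys F)"

definition centroid :: "nat \<Rightarrow> nat \<Rightarrow> real^('m::finite + 'n::finite)" where
  "centroid k l = (\<chi> v. case v of
       Inl _ \<Rightarrow> real k / real (CARD('m) + 1)
     | Inr _ \<Rightarrow> real l / real (CARD('n) + 1))"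

end

theory Submission
  imports Defs "HOL-Computational_Algebra.Fundamental_Theorem_Algebra"
    "HOL-Combinatorics.Transposition" "HOL-Real_Asymp.Real_Asymp"
begin

text \<open>
  If the centroid lies outside the polytope of \<open>g \<cdot> F\<close>, a separating hyperplane gives a real
  one-parameter subgroup of the torus contracting \<open>g \<cdot> F\<close> to \<open>0\<close>, so all invariants of positive degree
  vanish at \<open>F\<close>. If the centroid lies on the boundary, a supporting hyperplane contracts \<open>g \<cdot> F\<close> to a
  point of the closed orbit which is fixed by an infinite group.

  The converse is a valuative argument. By Cayley's \<open>\<Omega>\<close>-process, if all invariants vanish at \<open>F\<close> then
  \<open>0\<close> lies in the Zariski closure of the orbit of \<open>F\<close>. By Chevalley's extension theorem for places, a
  point of the Zariski closure of a family is the specialisation of the family at a place with residue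
  field \<open>\<complex>\<close> and a valuation ring. Over that ring the group element has a Smith normal form \<open>H D K\<close> with \<open>H\<close>
  and \<open>K\<close> integral and invertible; with \<open>h\<close> the reduction of \<open>H\<close>, the coefficient of a monomial in the
  support of \<open>h \<cdot> F\<close> is multiplied by the corresponding character of \<open>D\<close>. Writing the centroid (or a
  rational point near it) as a rational convex combination of exponents turns the polytope condition into a
  multiplicative relation between the entries of \<open>D\<close>: they cannot contract \<open>F\<close> to \<open>0\<close>, and in the interior case
  the group element is integral as soon as its product with \<open>F\<close> is. The latter yields both the finiteness of
  the stabilizer and the closedness of the orbit.
\<close>

\<comment> \<open>A place needs neither a curve in the group nor dimension theory, only Zorn's
  lemma, but there is a price: the value group may be any ordered abelian group, so the entries of
  \<open>D\<close> have no numerical orders that could be paired with exponent vectors. Everything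
  is therefore said multiplicatively, with natural exponents, and real convex weights must be traded
  for integral ones. Roots can still be taken, because a valuation ring is integrally closed. The
  reduction \<open>h\<close> depends on the place and cannot be controlled, which is why the
  polytopes of all translates of \<open>F\<close> enter. Moreover \<open>h\<close> is merely
  invertible; dividing by roots of its determinants changes the polynomial by a scalar and no
  polytope at all. On the side of invariants a single separation is enough, that of the origin from
  one orbit.\<close>
alias lookup = Poly_Mapping.lookup
alias keys = Poly_Mapping.keys
alias single = Poly_Mapping.single

section \<open>Multivariate polynomials\<close>

definition mono_eval :: "('v \<Rightarrow> 'a::comm_semiring_1) \<Rightarrow> 'v monom \<Rightarrow> 'a" where
  "mono_eval a I = (\<Prod>v\<in>keys I. a v ^ lookup I v)"

lemma mono_eval_superset:
  assumes "finite S" "keys I \<subseteq> S"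
  shows "mono_eval a I = (\<Prod>v\<in>S. a v ^ lookup I v)"
  unfolding mono_eval_def
  by (rule prod.mono_neutral_left) (use assms in \<open>auto simp: in_keys_iff\<close>)

lemma mono_eval_UNIV:
  "mono_eval a (I :: ('v::finite) monom) = (\<Prod>v\<in>UNIV. a v ^ lookup I v)"
  by (rule mono_eval_superset) auto

lemma mono_eval_0 [simp]: "mono_eval a 0 = 1"
  by (simp add: mono_eval_def)

lemma mono_eval_single [simp]: "mono_eval a (single v n) = a v ^ n"
  by (cases "n = 0") (simp_all add: mono_eval_def)

lemma mono_eval_add: "mono_eval a (I + J) = mono_eval a I * mono_eval a J"
proof -
  let ?S = "keys I \<union> keys J"
  have "mono_eval a (I + J) = (\<Prod>v\<in>?S. a v ^ lookup (I + J) v)"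
    by (rule mono_eval_superset) (auto dest: subsetD[OF Poly_Mapping.keys_add])
  also have "\<dots> = (\<Prod>v\<in>?S. a v ^ lookup I v) * (\<Prod>v\<in>?S. a v ^ lookup J v)"
    by (simp add: lookup_add power_add prod.distrib)
  also have "\<dots> = mono_eval a I * mono_eval a J"
    by (simp add: mono_eval_superset[of ?S])
  finally show ?thesis .
qed

lemma mono_eval_one [simp]: "mono_eval (\<lambda>_. 1) I = 1"
  by (simp add: mono_eval_def)

lemma mono_eval_mult: "mono_eval (\<lambda>v. a v * b v) I = mono_eval a I * mono_eval b I"
  by (simp add: mono_eval_def power_mult_distrib prod.distrib)

lemma mpol_sum_single:
  assumes "finite S" "keys P \<subseteq> S"
  shows "P = (\<Sum>I\<in>S. single I (lookup P I))"
proof (rule poly_mapping_eqI)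
  fix J
  show "lookup P J =
      lookup (\<Sum>I\<in>S. single I (lookup P I)) J"
  proof (cases "J \<in> S")
    case True
    then show ?thesis using assms by (simp add: lookup_sum lookup_single when_def)
  next
    case False
    then have "lookup P J = 0" using assms by (auto simp: in_keys_iff)
    moreover have "(\<Sum>I\<in>S. lookup (single I (lookup P I)) J) = 0"
      by (rule sum.neutral) (use False in \<open>auto simp: lookup_single when_def\<close>)
    ultimately show ?thesis by (simp add: lookup_sum)
  qed
qed

text \<open>The codomain is any additive monoid, so that one rule serves both polynomials and
  exponent vectors.\<close>

lemma mpol_induct [case_names single add]:
  fixes P :: "'a \<Rightarrow>\<^sub>0 'b::comm_monoid_add"
  assumes "\<And>I c. R (single I c)" "\<And>P Q. R P \<Longrightarrow> R Q \<Longrightarrow> R (P + Q)"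
  shows "R P"
proof -
  have "R (\<Sum>I\<in>S. single I (lookup P I))" if "finite S" for S
    using that
  proof induction
    case empty
    have "R (single undefined 0)" by (rule assms)
    then show ?case by simp
  next
    case (insert x S)
    then show ?case by (simp add: assms)
  qed
  from this[of "keys P"] show ?thesis
    using mpol_sum_single[of "keys P" P] by simp
qed

text \<open>Evaluation and substitution differ only in where the coefficients go: into \<complex>
  itself or, through \<open>Const\<close>, into a polynomial ring. The homomorphism laws are proved
  once for both.\<close>

locale coeff_hom =
  fixes \<phi> :: "complex \<Rightarrow> 'a::comm_ring_1"
  assumes \<phi>_add: "\<phi> (x + y) = \<phi> x + \<phi> y" and \<phi>_mult: "\<phi> (x * y) = \<phi> x * \<phi> y" and \<phi>_1: "\<phi> 1 = 1"
begin

lemma \<phi>_0: "\<phi> 0 = 0"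
  using \<phi>_add[of 0 0] by simp

definition peval :: "('v \<Rightarrow> 'a) \<Rightarrow> 'v mpol \<Rightarrow> 'a" where
  "peval a P = (\<Sum>I\<in>keys P. \<phi> (lookup P I) * mono_eval a I)"

lemma peval_superset:
  assumes "finite S" "keys P \<subseteq> S"
  shows "peval a P = (\<Sum>I\<in>S. \<phi> (lookup P I) * mono_eval a I)"
  unfolding peval_def
  by (rule sum.mono_neutral_left) (use assms in \<open>auto simp: in_keys_iff \<phi>_0\<close>)

lemma peval_0: "peval a 0 = 0"
  by (simp add: peval_def)

lemma peval_single: "peval a (single I c) = \<phi> c * mono_eval a I"
  by (cases "c = 0") (simp_all add: peval_def \<phi>_0)

lemma peval_add: "peval a (P + Q) = peval a P + peval a Q"
proof -
  let ?S = "keys P \<union> keys Q"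
  have "peval a (P + Q) = (\<Sum>I\<in>?S. \<phi> (lookup (P + Q) I) * mono_eval a I)"
    by (rule peval_superset) (auto dest: subsetD[OF Poly_Mapping.keys_add])
  also have "\<dots> = (\<Sum>I\<in>?S. \<phi> (lookup P I) * mono_eval a I) +
      (\<Sum>I\<in>?S. \<phi> (lookup Q I) * mono_eval a I)"
    by (simp add: lookup_add \<phi>_add ring_distribs sum.distrib)
  also have "\<dots> = peval a P + peval a Q"
    by (simp add: peval_superset[of ?S])
  finally show ?thesis .
qed

lemma peval_sum: "peval a (sum P S) = (\<Sum>i\<in>S. peval a (P i))"
  by (induction S rule: infinite_finite_induct) (simp_all add: peval_0 peval_add)

lemma peval_mult: "peval a (P * Q) = peval a P * peval a Q"
proof (induction P rule: mpol_induct)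
  case (single I c)
  show ?case
  proof (induction Q rule: mpol_induct)
    case (single J d)
    then show ?case by (simp add: mult_single peval_single \<phi>_mult mono_eval_add mult_ac)
  qed (simp add: ring_distribs peval_add)
qed (simp add: ring_distribs peval_add)

lemma peval_1: "peval a 1 = 1"
  using peval_single[of a 0 1] by (simp add: \<phi>_1)

lemma peval_prod: "peval a (prod P S) = (\<Prod>i\<in>S. peval a (P i))"
  by (induction S rule: infinite_finite_induct) (simp_all add: peval_1 peval_mult)

lemma peval_power: "peval a (P ^ n) = peval a P ^ n"
  by (induction n) (simp_all add: peval_1 peval_mult)

lemma peval_Const: "peval a (Const c) = \<phi> c"
  by (simp add: Const_def peval_single)

lemma peval_Var: "peval a (Var v) = a v"
  by (simp add: Var_def peval_single \<phi>_1)

lemmas peval_simps = peval_0 peval_1 peval_add peval_sum peval_mult peval_prod peval_power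
  peval_Const peval_Var peval_single

end

interpretation ev: coeff_hom "\<lambda>c::complex. c"
  by unfold_locales auto

interpretation sb: coeff_hom "Const :: complex \<Rightarrow> 'v mpol"
  by unfold_locales (auto simp: Const_def single_add mult_single)

lemma mpol_eval_eq: "mpol_eval = ev.peval"
  by (intro ext) (simp add: mpol_eval_def ev.peval_def mono_eval_def)

lemma mpol_subst_eq: "mpol_subst = sb.peval"
  by (intro ext) (simp add: mpol_subst_def sb.peval_def mono_eval_def)

lemmas mpol_eval_simps = ev.peval_simps[folded mpol_eval_eq]
lemmas mpol_subst_simps = sb.peval_simps[folded mpol_subst_eq]

lemma Const_0 [simp]: "Const 0 = 0"
  and Const_1 [simp]: "Const 1 = 1"
  by (simp_all add: Const_def)

lemma Const_add: "Const (x + y) = Const x + Const y"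
  and Const_mult: "Const (x * y) = Const x * Const y"
  by (simp_all add: Const_def single_add mult_single)

lemma Const_sum: "Const (sum f S) = (\<Sum>i\<in>S. Const (f i))"
  by (induction S rule: infinite_finite_induct) (simp_all add: Const_add)

lemma mpol_eval_mono: "mono_eval (\<lambda>v. mpol_eval a (\<sigma> v)) I = mpol_eval a (mono_eval \<sigma> I)"
  by (simp add: mono_eval_def mpol_eval_simps)

lemma mpol_subst_mono: "mono_eval (\<lambda>v. mpol_subst a (\<sigma> v)) I = mpol_subst a (mono_eval \<sigma> I)"
  by (simp add: mono_eval_def mpol_subst_simps)

lemma mpol_subst_subst: "mpol_subst \<tau> (mpol_subst \<sigma> P) = mpol_subst (\<lambda>v. mpol_subst \<tau> (\<sigma> v)) P"
  by (induction P rule: mpol_induct) (simp_all add: mpol_subst_simps mpol_subst_mono)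

lemma mpol_eval_subst: "mpol_eval a (mpol_subst \<sigma> P) = mpol_eval (\<lambda>v. mpol_eval a (\<sigma> v)) P"
  by (induction P rule: mpol_induct) (simp_all add: mpol_subst_simps mpol_eval_simps mpol_eval_mono)

lemma mono_eval_Var: "mono_eval Var I = single I 1"
proof (induction I rule: mpol_induct)
  case (single v n)
  have "single (single v (1::nat)) (1::complex) ^ n = single (single v n) 1"
    by (induction n) (simp_all add: mult_single flip: single_add)
  then show ?case by (simp add: Var_def)
next
  case (add I J)
  then show ?case by (simp add: mono_eval_add mult_single)
qed

lemma lookup_Const_mult: "lookup (Const c * P) I = c * lookup P I"
  by (induction P rule: mpol_induct)
     (auto simp: Const_def mult_single lookup_single when_def lookup_add ring_distribs)

lemma keys_Const_mult: "c \<noteq> 0 \<Longrightarrow> keys (Const c * P) = keys P"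
  by (auto simp: in_keys_iff lookup_Const_mult)

text \<open>Both summands are bounded by \<open>I\<close> in every variable. Finiteness makes each
  coefficient of a product a finite sum of products of coefficients, so that algebras of functions
  are closed under multiplication of families of polynomials.\<close>

lemma finite_monom_decompositions:
  "finite {(A, B). A + B = (I :: 'v monom)}"
proof -
  let ?K = "keys I"
  let ?T = "{f. (\<forall>v\<in>?K. f v \<in> {..lookup I v}) \<and> (\<forall>v. v \<notin> ?K \<longrightarrow> f v = (0::nat))}"
  have fin: "finite ?T"
    using finite_set_of_finite_funs[of ?K "\<Union>v\<in>?K. {..lookup I v}" "0::nat"]
    by (rule finite_subset[rotated]) auto
  have "(\<lambda>(A, B). (lookup A, lookup B)) ` {(A, B). A + B = I} \<subseteq> ?T \<times> ?T"
  proof -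
    have "lookup A \<in> ?T \<and> lookup B \<in> ?T" if "A + B = I" for A B
      using that by (auto simp: lookup_add in_keys_iff)
    then show ?thesis by auto
  qed
  then have "finite ((\<lambda>(A, B). (lookup A, lookup B)) ` {(A, B). A + B = I})"
    by (rule finite_subset) (rule finite_cartesian_product[OF fin fin])
  then show ?thesis
  proof (rule finite_imageD)
    show "inj_on (\<lambda>(A, B). (lookup A, lookup B)) {(A, B). A + B = I}"
      unfolding inj_on_def case_prod_unfold prod.inject lookup_inject by (simp add: prod_eq_iff)
  qed
qed

lemma lookup_mult_mpol:
  fixes P Q :: "'v monom \<Rightarrow>\<^sub>0 complex"
  shows "lookup (P * Q) I =
    (\<Sum>(A, B)\<in>{(A, B). A + B = I}. lookup P A * lookup Q B)"
proof (induction P rule: mpol_induct)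
  case (single I' c)
  show ?case
  proof (induction Q rule: mpol_induct)
    case (single J d)
    have "lookup (single I' c) A * lookup (single J d) B =
        (if (A, B) = (I', J) then c * d else 0)" for A B
      by (simp add: lookup_single when_def)
    then have "(\<Sum>(A, B)\<in>{(A, B). A + B = I}.
        lookup (single I' c) A * lookup (single J d) B) =
      (\<Sum>p\<in>{(A, B). A + B = I}. if p = (I', J) then c * d else 0)"
      by (intro sum.cong refl) (simp add: case_prod_unfold prod_eq_iff)
    also have "\<dots> = (if I' + J = I then c * d else 0)"
      using finite_monom_decompositions[of I] by (simp add: sum.delta)
    finally show ?case by (simp add: mult_single lookup_single when_def)
  qed (simp add: ring_distribs lookup_add sum.distrib case_prod_unfold)
qed (simp add: ring_distribs lookup_add sum.distrib case_prod_unfold)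

section \<open>Places of function algebras\<close>

text \<open>
  A homomorphism to \<open>\<complex>\<close> from a ring of functions on \<open>J\<close> is encoded by extending the functions to one
  further point \<open>z\<close> and evaluating there; the last condition makes the value at \<open>z\<close> depend on the
  restriction to \<open>J\<close> only.
\<close>

definition partial_place :: "'x set \<Rightarrow> 'x \<Rightarrow> ('x \<Rightarrow> complex) set \<Rightarrow> bool" where
  "partial_place J z B \<longleftrightarrow> (\<forall>c. (\<lambda>_. c) \<in> B) \<and>
     (\<forall>a\<in>B. \<forall>b\<in>B. (\<lambda>p. a p + b p) \<in> B \<and> (\<lambda>p. a p * b p) \<in> B) \<and>
     (\<forall>b\<in>B. (\<forall>p\<in>J. b p = 0) \<longrightarrow> b z = 0)"

text \<open>Each condition involves at most two functions at a time, so it passes to unions of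
  chains and Zorn's lemma applies.\<close>

lemma partial_place_extend:
  assumes "partial_place J z B0"
  obtains B where "B0 \<subseteq> B" "partial_place J z B"
    "\<And>B'. partial_place J z B' \<Longrightarrow> B \<subseteq> B' \<Longrightarrow> B' = B"
proof -
  let ?A = "{B. B0 \<subseteq> B \<and> partial_place J z B}"
  have "\<exists>M\<in>?A. \<forall>X\<in>?A. M \<subseteq> X \<longrightarrow> X = M"
  proof (rule subset_Zorn_nonempty)
    show "?A \<noteq> {}" using assms by auto
  next
    fix C assume "C \<noteq> {}" and chain: "subset.chain ?A C"
    then obtain X0 where X0: "X0 \<in> C" by auto
    have mem: "X \<in> C \<Longrightarrow> B0 \<subseteq> X \<and> partial_place J z X" for X
      using chain by (auto simp: subset_chain_def)
    have "partial_place J z (\<Union>C)"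
      unfolding partial_place_def
    proof (intro conjI allI ballI)
      fix c show "(\<lambda>_. c) \<in> \<Union>C" using mem[OF X0] X0 by (auto simp: partial_place_def)
    next
      fix a b assume "a \<in> \<Union>C" "b \<in> \<Union>C"
      then obtain X Y where XY: "X \<in> C" "Y \<in> C" "a \<in> X" "b \<in> Y" by auto
      then have "X \<subseteq> Y \<or> Y \<subseteq> X" using chain by (auto simp: subset_chain_def)
      then obtain Z where Z: "Z \<in> C" "a \<in> Z" "b \<in> Z" using XY by auto
      have "(\<lambda>p. a p + b p) \<in> Z \<and> (\<lambda>p. a p * b p) \<in> Z"
        using mem[OF Z(1)] Z by (auto simp: partial_place_def)
      with Z show "(\<lambda>p. a p + b p) \<in> \<Union>C" "(\<lambda>p. a p * b p) \<in> \<Union>C" by auto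
    next
      fix b assume "b \<in> \<Union>C"
      then obtain X where "X \<in> C" "b \<in> X" by auto
      with mem[of X] show "(\<forall>p\<in>J. b p = 0) \<longrightarrow> b z = 0" by (auto simp: partial_place_def)
    qed
    then show "\<Union>C \<in> ?A" using mem[OF X0] X0 by auto
  qed
  then obtain M where "M \<in> ?A" "\<forall>X\<in>?A. M \<subseteq> X \<longrightarrow> X = M" by blast
  then show thesis by (intro that[of M]) auto
qed

text \<open>Kept apart from places because the closure properties are needed a second time, for the
  algebra of polynomial functions of matrix entries.\<close>

locale function_algebra =
  fixes B :: "('x \<Rightarrow> complex) set"
  assumes B_const [simp]: "(\<lambda>_. c) \<in> B"
    and B_add: "a \<in> B \<Longrightarrow> b \<in> B \<Longrightarrow> (\<lambda>p. a p + b p) \<in> B"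
    and B_mult: "a \<in> B \<Longrightarrow> b \<in> B \<Longrightarrow> (\<lambda>p. a p * b p) \<in> B"
begin

lemma B_uminus: "a \<in> B \<Longrightarrow> (\<lambda>p. - a p) \<in> B"
  using B_mult[of "\<lambda>_. -1" a] by simp

lemma B_diff: "a \<in> B \<Longrightarrow> b \<in> B \<Longrightarrow> (\<lambda>p. a p - b p) \<in> B"
  using B_add[OF _ B_uminus, of a b] by simp

lemma B_sum: "(\<And>i. i \<in> S \<Longrightarrow> f i \<in> B) \<Longrightarrow> (\<lambda>p. \<Sum>i\<in>S. f i p) \<in> B"
  by (induction S rule: infinite_finite_induct) (simp_all add: B_add)

lemma B_prod: "(\<And>i. i \<in> S \<Longrightarrow> f i \<in> B) \<Longrightarrow> (\<lambda>p. \<Prod>i\<in>S. f i p) \<in> B"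
  by (induction S rule: infinite_finite_induct) (simp_all add: B_mult)

lemma B_power: "a \<in> B \<Longrightarrow> (\<lambda>p. a p ^ n) \<in> B"
  by (induction n) (simp_all add: B_mult)

end

locale place =
  fixes J :: "'x set" and z :: 'x and B :: "('x \<Rightarrow> complex) set"
  assumes B_place: "partial_place J z B"
    and B_max: "partial_place J z B' \<Longrightarrow> B \<subseteq> B' \<Longrightarrow> B' = B"
    and z_notin: "z \<notin> J"
begin

sublocale function_algebra B
  by unfold_locales (use B_place in \<open>simp_all add: partial_place_def\<close>)

lemma B_vanish: "b \<in> B \<Longrightarrow> (\<And>p. p \<in> J \<Longrightarrow> b p = 0) \<Longrightarrow> b z = 0"
  using B_place by (auto simp: partial_place_def)

text \<open>
  The sets \<open>{p \<in> J. e p \<noteq> 0}\<close> with \<open>e z \<noteq> 0\<close> form a base. Since \<open>B\<close> is maximal the filter is an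
  ultrafilter, and functions modulo it play the role of the field that contains the valuation ring.
\<close>

definition near :: "'x filter" where
  "near = Abs_filter (\<lambda>P. \<exists>e\<in>B. e z \<noteq> 0 \<and> (\<forall>p\<in>J. e p \<noteq> 0 \<longrightarrow> P p))"

lemma eventually_near:
  "eventually P near \<longleftrightarrow> (\<exists>e\<in>B. e z \<noteq> 0 \<and> (\<forall>p\<in>J. e p \<noteq> 0 \<longrightarrow> P p))"
  unfolding near_def
proof (rule eventually_Abs_filter, rule is_filter.intro)
  show "\<exists>e\<in>B. e z \<noteq> 0 \<and> (\<forall>p\<in>J. e p \<noteq> 0 \<longrightarrow> True)" by (rule bexI[of _ "\<lambda>_. 1"]) auto
next
  fix P Q :: "'x \<Rightarrow> bool"
  assume "\<exists>e\<in>B. e z \<noteq> 0 \<and> (\<forall>p\<in>J. e p \<noteq> 0 \<longrightarrow> P p)" "\<exists>e\<in>B. e z \<noteq> 0 \<and> (\<forall>p\<in>J. e p \<noteq> 0 \<longrightarrow> Q p)"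
  then obtain d e where "d \<in> B" "d z \<noteq> 0" "\<forall>p\<in>J. d p \<noteq> 0 \<longrightarrow> P p" "e \<in> B" "e z \<noteq> 0" "\<forall>p\<in>J. e p \<noteq> 0 \<longrightarrow> Q p"
    by blast
  then show "\<exists>e\<in>B. e z \<noteq> 0 \<and> (\<forall>p\<in>J. e p \<noteq> 0 \<longrightarrow> P p \<and> Q p)"
    by (intro bexI[of _ "\<lambda>p. d p * e p"] B_mult) auto
next
  fix P Q :: "'x \<Rightarrow> bool"
  assume "\<forall>p. P p \<longrightarrow> Q p" "\<exists>e\<in>B. e z \<noteq> 0 \<and> (\<forall>p\<in>J. e p \<noteq> 0 \<longrightarrow> P p)"
  then show "\<exists>e\<in>B. e z \<noteq> 0 \<and> (\<forall>p\<in>J. e p \<noteq> 0 \<longrightarrow> Q p)" by blast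
qed

lemma near_J: "(\<And>p. p \<in> J \<Longrightarrow> P p) \<Longrightarrow> eventually P near"
  unfolding eventually_near by (rule bexI[of _ "\<lambda>_. 1"]) auto

lemma near_nonzero: "e \<in> B \<Longrightarrow> e z \<noteq> 0 \<Longrightarrow> eventually (\<lambda>p. e p \<noteq> 0) near"
  unfolding eventually_near by blast

text \<open>Multiplying \<open>b\<close> by the function \<open>e\<close> that witnesses the
  neighbourhood gives a function vanishing on all of \<open>J\<close>. So the value at
  \<open>z\<close> depends on the germ alone.\<close>

lemma B_near_zero:
  assumes "b \<in> B" "eventually (\<lambda>p. b p = 0) near"
  shows "b z = 0"
proof -
  obtain e where e: "e \<in> B" "e z \<noteq> 0" "\<And>p. p \<in> J \<Longrightarrow> e p \<noteq> 0 \<Longrightarrow> b p = 0"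
    using assms(2) by (auto simp: eventually_near)
  have "e z * b z = 0" by (rule B_vanish[OF B_mult[OF e(1) assms(1)]]) (use e(3) in auto)
  with e(2) show ?thesis by simp
qed

lemma B_near_eq:
  assumes "a \<in> B" "b \<in> B" "eventually (\<lambda>p. a p = b p) near"
  shows "a z = b z"
  using B_near_zero[OF B_diff[OF assms(1,2)]] assms(3) by simp

section \<open>Polynomials over the ring \<open>B\<close> and Chevalley's extension argument\<close>

lemma poly_eq_sum_atMost:
  fixes q :: "complex poly"
  assumes "degree q \<le> n"
  shows "poly q x = (\<Sum>i\<le>n. coeff q i * x ^ i)"
  unfolding poly_altdef
  by (intro sum.mono_neutral_left) (use assms in \<open>auto simp: coeff_eq_0\<close>)

text \<open>The uniform degree bound makes such a family one polynomial with coefficients in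
  \<open>B\<close>, not an unrelated polynomial at each point.\<close>

definition B_poly :: "('x \<Rightarrow> complex poly) \<Rightarrow> bool" where
  "B_poly q \<longleftrightarrow> (\<forall>i. (\<lambda>p. coeff (q p) i) \<in> B) \<and> (\<exists>n. \<forall>p. degree (q p) \<le> n)"

lemma B_poly_coeff: "B_poly q \<Longrightarrow> (\<lambda>p. coeff (q p) i) \<in> B"
  by (simp add: B_poly_def)

lemma B_poly_add: 
  assumes "B_poly q" "B_poly r" shows "B_poly (\<lambda>p. q p + r p)"
proof -
  obtain m n where "\<And>p. degree (q p) \<le> m" "\<And>p. degree (r p) \<le> n"
    using assms by (auto simp: B_poly_def)
  then have "degree (q p + r p) \<le> max m n" for p
    by (meson degree_add_le max.cobounded1 max.cobounded2 order_trans)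
  moreover have "(\<lambda>p. coeff (q p + r p) i) \<in> B" for i
    unfolding coeff_add by (intro B_add B_poly_coeff assms)
  ultimately show ?thesis by (auto simp: B_poly_def)
qed

lemma B_poly_mult:
  assumes "B_poly q" "B_poly r" shows "B_poly (\<lambda>p. q p * r p)"
proof -
  obtain m n where "\<And>p. degree (q p) \<le> m" "\<And>p. degree (r p) \<le> n"
    using assms by (auto simp: B_poly_def)
  then have "degree (q p * r p) \<le> m + n" for p
    by (meson degree_mult_le add_mono order_trans)
  moreover have "(\<lambda>p. coeff (q p * r p) i) \<in> B" for i
    unfolding coeff_mult by (intro B_sum B_mult B_poly_coeff assms)
  ultimately show ?thesis by (auto simp: B_poly_def)
qed

lemma B_poly_monom:
  assumes "b \<in> B" shows "B_poly (\<lambda>p. monom (b p) n)"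
proof -
  have "(\<lambda>p. coeff (monom (b p) n) i) \<in> B" for i
    by (cases "n = i") (simp_all add: assms)
  moreover have "\<exists>k. \<forall>p. degree (monom (b p) n) \<le> k" using degree_monom_le by blast
  ultimately show ?thesis by (simp add: B_poly_def)
qed

lemma B_poly_const: "b \<in> B \<Longrightarrow> B_poly (\<lambda>p. [:b p:])"
  using B_poly_monom[of b 0] by (simp add: monom_0)

lemma B_poly_constant: "B_poly (\<lambda>_. q)"
  by (auto simp: B_poly_def)

lemma B_poly_smult: "b \<in> B \<Longrightarrow> B_poly q \<Longrightarrow> B_poly (\<lambda>p. smult (b p) (q p))"
  using B_poly_mult[OF B_poly_const, of b q] by simp

lemma B_poly_diff: "B_poly q \<Longrightarrow> B_poly r \<Longrightarrow> B_poly (\<lambda>p. q p - r p)"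
  using B_poly_add[OF _ B_poly_smult[OF B_const[of "-1"]], of q r] by simp

lemma B_poly_sum: "(\<And>i. i \<in> S \<Longrightarrow> B_poly (f i)) \<Longrightarrow> B_poly (\<lambda>p. \<Sum>i\<in>S. f i p)"
  by (induction S rule: infinite_finite_induct) (simp_all add: B_poly_add B_poly_constant)

text \<open>The relation says that the maximal ideal of \<open>B\<close> generates the unit ideal in \<open>B[x]\<close>.\<close>

definition unit_relation :: "('x \<Rightarrow> complex) \<Rightarrow> nat \<Rightarrow> bool" where
  "unit_relation x n \<longleftrightarrow> (\<exists>q. B_poly q \<and> q z = 0 \<and> (\<forall>p. degree (q p) \<le> n) \<and>
     eventually (\<lambda>p. poly (q p) (x p) = 1) near)"

lemma unit_relation_0: "\<not> unit_relation x 0"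
proof
  assume "unit_relation x 0"
  then obtain q where q: "B_poly q" "q z = 0" "\<And>p. degree (q p) = 0"
    "eventually (\<lambda>p. poly (q p) (x p) = 1) near"
    by (auto simp: unit_relation_def)
  have "poly (q p) (x p) = coeff (q p) 0" for p
    using q(3)[of p] by (metis degree_0_id poly_const_conv poly_0_coeff_0)
  then have "coeff (q z) 0 = 1"
    using q(4) by (intro B_near_eq[OF B_poly_coeff[OF q(1)] B_const]) simp
  with q(2) show False by simp
qed

text \<open>Let \<open>a\<close> be the constant term of the relation \<open>s\<close> for y = 1/x.
  Multiplying s(y) = 1 by x^(n+1) gives (1 - a) x^(n+1) = t(x) with \<open>t\<close> of degree at
  most \<open>n\<close>, and this eliminates the leading term of the relation for
  \<open>x\<close>.\<close>

lemma unit_relation_reduce: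
  assumes x: "unit_relation x (Suc n)" and y: "unit_relation y r" and "r \<le> Suc n"
    and xy: "eventually (\<lambda>p. x p * y p = 1) near"
  shows "unit_relation x n"
proof -
  obtain q where q: "B_poly q" "q z = 0" "\<And>p. degree (q p) \<le> Suc n"
    "eventually (\<lambda>p. poly (q p) (x p) = 1) near"
    using x by (auto simp: unit_relation_def)
  obtain s where s: "B_poly s" "s z = 0" "\<And>p. degree (s p) \<le> r"
    "eventually (\<lambda>p. poly (s p) (y p) = 1) near"
    using y by (auto simp: unit_relation_def)
  define a where "a = (\<lambda>p. coeff (s p) 0)"
  define c where "c = (\<lambda>p. coeff (q p) (Suc n))"
  define t where "t = (\<lambda>p. \<Sum>i=1..r. monom (coeff (s p) i) (Suc n - i))"
  \<comment> \<open>This is (1 - a) q, with (1 - a) x^(n+1) in its leading term replaced by t(x);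
    adding \<open>a\<close> restores the value 1. As \<open>a\<close>, \<open>c\<close> and
    \<open>q\<close> vanish at \<open>z\<close>, so does \<open>u\<close>.\<close>
  define u where "u = (\<lambda>p. smult (1 - a p) (q p - monom (c p) (Suc n)) + smult (c p) (t p) + [:a p:])"
  have aB: "a \<in> B" and cB: "c \<in> B" unfolding a_def c_def by (intro B_poly_coeff q s)+
  have tB: "B_poly t" unfolding t_def by (intro B_poly_sum B_poly_monom B_poly_coeff s)
  have uB: "B_poly u" unfolding u_def
    by (intro B_poly_add B_poly_smult B_poly_diff B_poly_monom B_poly_const tB q aB cB B_diff B_const)
  have uz: "u z = 0" using q(2) s(2) by (simp add: u_def a_def c_def)
  have deg: "degree (u p) \<le> n" for p
  proof (rule degree_le, intro allI impI)
    fix i assume i: "n < i"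
    have "coeff (q p) i = 0" if "i \<noteq> Suc n"
      using that i q(3)[of p] by (intro coeff_eq_0) auto
    moreover have "coeff (t p) i = 0"
      using i by (auto simp: t_def coeff_sum coeff_monom intro!: sum.neutral)
    ultimately show "coeff (u p) i = 0"
      using i by (auto simp: u_def c_def coeff_monom coeff_pCons split: nat.splits)
  qed
  have "eventually (\<lambda>p. poly (u p) (x p) = 1) near"
    using q(4) s(4) xy
  proof eventually_elim
    case (elim p)
    have "poly (t p) (x p) = (\<Sum>i=1..r. coeff (s p) i * x p ^ (Suc n - i))"
      by (simp add: t_def poly_sum poly_monom)
    also have "\<dots> = (\<Sum>i=1..r. coeff (s p) i * y p ^ i) * x p ^ Suc n"
      unfolding sum_distrib_right
    proof (rule sum.cong[OF refl])
      fix i assume "i \<in> {1..r}"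
      then have "i + (Suc n - i) = Suc n" using \<open>r \<le> Suc n\<close> by simp
      then have "x p ^ Suc n = x p ^ i * x p ^ (Suc n - i)" by (metis power_add)
      moreover have "y p ^ i * x p ^ i = 1"
        using elim(3) by (simp only: power_mult_distrib[symmetric] mult.commute[of "y p"] power_one)
      ultimately have "y p ^ i * x p ^ Suc n = x p ^ (Suc n - i)"
        by (simp only: mult.assoc[symmetric] mult_1)
      then show "coeff (s p) i * x p ^ (Suc n - i) = coeff (s p) i * y p ^ i * x p ^ Suc n"
        by (simp only: mult.assoc)
    qed
    also have "(\<Sum>i=1..r. coeff (s p) i * y p ^ i) = 1 - a p"
    proof -
      have "poly (s p) (y p) = (\<Sum>i\<le>r. coeff (s p) i * y p ^ i)"
        by (rule poly_eq_sum_atMost) (rule s(3))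
      also have "\<dots> = a p + (\<Sum>i=1..r. coeff (s p) i * y p ^ i)"
        by (simp add: a_def atMost_atLeast0 sum.atLeast_Suc_atMost)
      finally show ?thesis using elim(2) by (simp add: algebra_simps)
    qed
    finally have "poly (t p) (x p) = (1 - a p) * x p ^ Suc n" .
    then have "poly (u p) (x p) =
        (1 - a p) * (poly (q p) (x p) - c p * x p ^ Suc n) + c p * ((1 - a p) * x p ^ Suc n) + a p"
      by (simp add: u_def poly_monom)
    also have "\<dots> = 1" using elim(1) by (simp add: algebra_simps)
    finally show ?case .
  qed
  with uB uz deg show ?thesis by (auto simp: unit_relation_def)
qed

text \<open>Descent on the sum of the degrees: the relation of larger degree is lowered with the
  help of the other one, and degree 0 is impossible.\<close>

lemma unit_relation_contradiction:
  assumes "unit_relation x n" "unit_relation y r" "eventually (\<lambda>p. x p * y p = 1) near"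
  shows False
  using assms(1,2)
proof (induction "n + r" arbitrary: n r rule: less_induct)
  case less
  obtain n' where n': "n = Suc n'" using less.prems(1) unit_relation_0 by (cases n) auto
  obtain r' where r': "r = Suc r'" using less.prems(2) unit_relation_0 by (cases r) auto
  have yx: "eventually (\<lambda>p. y p * x p = 1) near"
    using assms(3) by eventually_elim (simp only: mult.commute)
  show False
  proof (cases "r \<le> n")
    case True
    then have "unit_relation x n'"
      using unit_relation_reduce[OF less.prems(1)[unfolded n'] less.prems(2) _ assms(3)] n' by blast
    then show False using less.hyps[OF _ _ less.prems(2)] n' by (metis add_Suc lessI)
  next
    case False
    then have "n \<le> Suc r'" using r' by simp
    then have "unit_relation y r'"
      by (rule unit_relation_reduce[OF less.prems(2)[unfolded r'] less.prems(1) _ yx])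
    then show False using less.hyps[OF _ less.prems(1)] r' by (metis add_Suc_right lessI)
  qed
qed

text \<open>The reductions at \<open>z\<close> of the polynomials over \<open>B\<close> that kill
  \<open>x\<close> form an ideal of the polynomial ring over \<complex>. It is proper, since 1 in it
  would yield a unit relation, so it has a common root \<open>c\<close>; as \<complex> is
  algebraically closed, the residue field does not grow. Sending \<open>x\<close> to
  \<open>c\<close> extends the place, and by maximality the extended \<open>x\<close> is already in
  \<open>B\<close>.\<close>

lemma adjoin:
  assumes "\<And>n. \<not> unit_relation x n"
  obtains c where "x(z := c) \<in> B"
proof -
  define A where "A = {q z |q. B_poly q \<and> (\<forall>p\<in>J. poly (q p) (x p) = 0)}"
  have A_add: "f + g \<in> A" if "f \<in> A" "g \<in> A" for f g
  proof -
    obtain q r where "f = q z" "g = r z" "B_poly q" "B_poly r"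
      "\<forall>p\<in>J. poly (q p) (x p) = 0" "\<forall>p\<in>J. poly (r p) (x p) = 0"
      using \<open>f \<in> A\<close> \<open>g \<in> A\<close> by (auto simp: A_def)
    then show ?thesis unfolding A_def mem_Collect_eq
      by (intro exI[of _ "\<lambda>p. q p + r p"]) (auto intro: B_poly_add)
  qed
  have A_mult: "g * f \<in> A" if "f \<in> A" for f g
  proof -
    obtain q where "f = q z" "B_poly q" "\<forall>p\<in>J. poly (q p) (x p) = 0"
      using \<open>f \<in> A\<close> by (auto simp: A_def)
    then show ?thesis unfolding A_def mem_Collect_eq
      by (intro exI[of _ "\<lambda>p. g * q p"]) (auto intro: B_poly_mult B_poly_constant)
  qed
  have A_proper: "1 \<notin> A"
  proof
    assume "1 \<in> A"
    then obtain q where q: "B_poly q" "q z = 1" "\<And>p. p \<in> J \<Longrightarrow> poly (q p) (x p) = 0"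
      by (auto simp: A_def)
    have B1: "B_poly (\<lambda>p. 1 - q p)" by (intro B_poly_diff B_poly_constant q(1))
    obtain n where "\<And>p. degree (1 - q p) \<le> n" using B1 by (auto simp: B_poly_def)
    then have "unit_relation x n"
      unfolding unit_relation_def
      by (intro exI[of _ "\<lambda>p. 1 - q p"] conjI B1 near_J) (auto simp: q)
    with assms show False by blast
  qed
  have "\<exists>c. \<forall>f\<in>A. poly f c = 0"
  proof (cases "A \<subseteq> {0}")
    case True
    then show ?thesis by (intro exI[of _ 0]) auto
  next
    case False
    then obtain f where f: "f \<in> A" "f \<noteq> 0"
      "\<And>g. g \<in> A \<Longrightarrow> g \<noteq> 0 \<Longrightarrow> degree f \<le> degree g"
      using ex_has_least_nat[of "\<lambda>f. f \<in> A \<and> f \<noteq> 0" _ degree] by blast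
    have "degree f \<noteq> 0"
    proof
      assume "degree f = 0"
      then obtain a where "f = [:a:]" by (rule degree_eq_zeroE)
      then have "[:inverse a:] * f = 1" using f(2) by simp
      with A_mult[OF f(1)] A_proper show False by metis
    qed
    then obtain c where c: "poly f c = 0"
      using fundamental_theorem_of_algebra[of f] by (auto simp: constant_degree)
    have "poly g c = 0" if "g \<in> A" for g
    proof -
      have "g mod f = g + (- (g div f)) * f" by (simp add: minus_div_mult_eq_mod[symmetric])
      then have "g mod f \<in> A" using A_add[OF that A_mult[OF f(1)]] by metis
      then have "g mod f = 0" using f(2,3) degree_mod_less by (metis leD)
      then have "f dvd g" by auto
      then show ?thesis using c by (auto elim!: dvdE)
    qed
    then show ?thesis by blast
  qed
  then obtain c where c: "\<And>f. f \<in> A \<Longrightarrow> poly f c = 0" by blast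
  define y where "y = x(z := c)"
  define B' where "B' = {\<lambda>p. poly (q p) (y p) |q. B_poly q}"
  have "partial_place J z B'"
    unfolding partial_place_def
  proof (intro conjI allI ballI impI)
    fix d show "(\<lambda>_. d) \<in> B'"
      unfolding B'_def mem_Collect_eq by (rule exI[of _ "\<lambda>_. [:d:]"]) (simp add: B_poly_constant)
  next
    fix a b assume "a \<in> B'" "b \<in> B'"
    then obtain q r where qr: "a = (\<lambda>p. poly (q p) (y p))" "b = (\<lambda>p. poly (r p) (y p))" "B_poly q" "B_poly r"
      by (auto simp: B'_def)
    show "(\<lambda>p. a p + b p) \<in> B'" unfolding B'_def mem_Collect_eq
      by (rule exI[of _ "\<lambda>p. q p + r p"]) (simp add: qr B_poly_add)
    show "(\<lambda>p. a p * b p) \<in> B'" unfolding B'_def mem_Collect_eq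
      by (rule exI[of _ "\<lambda>p. q p * r p"]) (simp add: qr B_poly_mult)
  next
    fix b assume "b \<in> B'" and b0: "\<forall>p\<in>J. b p = 0"
    then obtain q where q: "b = (\<lambda>p. poly (q p) (y p))" "B_poly q" by (auto simp: B'_def)
    have "poly (q p) (x p) = 0" if "p \<in> J" for p
      using b0 that z_notin by (auto simp: q y_def fun_upd_def split: if_splits)
    then have "q z \<in> A" using q(2) by (auto simp: A_def)
    from c[OF this] show "b z = 0" by (simp add: q y_def)
  qed
  moreover have "B \<subseteq> B'"
  proof
    fix b assume "b \<in> B"
    then show "b \<in> B'" unfolding B'_def mem_Collect_eq
      by (intro exI[of _ "\<lambda>p. [:b p:]"]) (simp add: B_poly_const)
  qed
  ultimately have "B' = B" by (rule B_max)
  moreover have "y \<in> B'" unfolding B'_def mem_Collect_eq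
    by (intro exI[of _ "\<lambda>p. [:0, 1:]"]) (simp add: B_poly_constant)
  ultimately show thesis using that by (simp add: y_def)
qed

lemma near_upd: "eventually (\<lambda>p. (x(z := c)) p = x p) near"
  using z_notin by (intro near_J) auto

text \<open>Without a unit relation \<open>x\<close> can be adjoined. With one, its inverse has none
  and can be adjoined instead.\<close>

theorem valuation:
  obtains b where "b \<in> B" "eventually (\<lambda>p. x p = b p) near"
  | b where "b \<in> B" "b z = 0" "eventually (\<lambda>p. b p * x p = 1) near"
proof (cases "\<exists>n. unit_relation x n")
  case False
  then obtain c where "x(z := c) \<in> B" using adjoin by blast
  moreover have "eventually (\<lambda>p. x p = (x(z := c)) p) near"
    using near_upd[of x c] by eventually_elim simp
  ultimately show thesis by (rule that(1))
next
  case True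
  then obtain n where n: "unit_relation x n" by blast
  then obtain q where q: "B_poly q" "q z = 0" "\<And>p. degree (q p) \<le> n"
    "eventually (\<lambda>p. poly (q p) (x p) = 1) near"
    by (auto simp: unit_relation_def)
  define y where "y = (\<lambda>p. inverse (x p))"
  \<comment> \<open>At a point where \<open>x\<close> is 0 the relation would say that the constant
    coefficient is 1. That coefficient is 0 at \<open>z\<close>, so such points are excluded near
    \<open>z\<close>.\<close>
  have "eventually (\<lambda>p. 1 - coeff (q p) 0 \<noteq> 0) near"
    using q(2) by (intro near_nonzero B_diff B_const B_poly_coeff q(1)) auto
  with q(4) have xy: "eventually (\<lambda>p. x p * y p = 1) near"
  proof eventually_elim
    case (elim p)
    then have "x p \<noteq> 0" by (auto simp: poly_0_coeff_0)
    then show ?case by (simp add: y_def)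
  qed
  then obtain c where c: "y(z := c) \<in> B"
    using adjoin[of y] unit_relation_contradiction[OF n] by blast
  let ?y = "y(z := c)"
  \<comment> \<open>This is the relation divided by x^n. At \<open>z\<close>, where all coefficients
    of \<open>q\<close> vanish, it leaves y^n = 0, so the inverse of \<open>x\<close> is
    infinitesimal.\<close>
  have "eventually (\<lambda>p. (\<Sum>i\<le>n. coeff (q p) i * ?y p ^ (n - i)) = ?y p ^ n) near"
    using q(4) xy near_upd[of y c]
  proof eventually_elim
    case (elim p)
    have "(\<Sum>i\<le>n. coeff (q p) i * y p ^ (n - i)) = (\<Sum>i\<le>n. coeff (q p) i * x p ^ i) * y p ^ n"
      unfolding sum_distrib_right
    proof (rule sum.cong[OF refl])
      fix i assume "i \<in> {..n}"
      then have "i + (n - i) = n" by simp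
      then have "y p ^ n = y p ^ i * y p ^ (n - i)" by (metis power_add)
      moreover have "x p ^ i * y p ^ i = 1"
        using elim(2) by (simp only: power_mult_distrib[symmetric] power_one)
      ultimately have "x p ^ i * y p ^ n = y p ^ (n - i)"
        by (simp only: mult.assoc[symmetric] mult_1)
      then show "coeff (q p) i * y p ^ (n - i) = coeff (q p) i * x p ^ i * y p ^ n"
        by (simp only: mult.assoc)
    qed
    also have "(\<Sum>i\<le>n. coeff (q p) i * x p ^ i) = 1"
      using elim(1) poly_eq_sum_atMost[OF q(3), of p "x p"] by simp
    finally show ?case using elim(3) by simp
  qed
  then have "(\<Sum>i\<le>n. coeff (q z) i * ?y z ^ (n - i)) = ?y z ^ n"
    by (intro B_near_eq[of "\<lambda>p. \<Sum>i\<le>n. coeff (q p) i * ?y p ^ (n - i)" "\<lambda>p. ?y p ^ n"]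
        B_sum B_mult B_power c B_poly_coeff q(1))
  then have "?y z ^ n = 0" using q(2) by (simp del: fun_upd_apply)
  then have "?y z = 0" by (simp del: fun_upd_apply)
  moreover have "eventually (\<lambda>p. ?y p * x p = 1) near"
    using xy near_upd[of y c] by eventually_elim (simp add: mult.commute)
  ultimately show thesis using that(2) c by blast
qed

section \<open>The valuation ring of germs and its maximal ideal\<close>

definition integral :: "('x \<Rightarrow> complex) \<Rightarrow> bool" where
  "integral x \<longleftrightarrow> (\<exists>b\<in>B. eventually (\<lambda>p. x p = b p) near)"

definition infinitesimal :: "('x \<Rightarrow> complex) \<Rightarrow> bool" where
  "infinitesimal x \<longleftrightarrow> (\<exists>b\<in>B. b z = 0 \<and> eventually (\<lambda>p. x p = b p) near)"

lemma infinitesimal_integral: "infinitesimal x \<Longrightarrow> integral x"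
  by (auto simp: integral_def infinitesimal_def)

lemma B_integral: "b \<in> B \<Longrightarrow> integral b"
  by (auto simp: integral_def intro!: bexI[of _ b])

lemma integral_cong:
  assumes "integral x" "eventually (\<lambda>p. x p = y p) near"
  shows "integral y"
proof -
  obtain b where b: "b \<in> B" "eventually (\<lambda>p. x p = b p) near" using assms(1) by (auto simp: integral_def)
  from b(2) assms(2) have "eventually (\<lambda>p. y p = b p) near" by eventually_elim simp
  with b(1) show ?thesis by (auto simp: integral_def)
qed

lemma infinitesimal_cong:
  assumes "infinitesimal x" "eventually (\<lambda>p. x p = y p) near"
  shows "infinitesimal y"
proof -
  obtain b where b: "b \<in> B" "b z = 0" "eventually (\<lambda>p. x p = b p) near"
    using assms(1) by (auto simp: infinitesimal_def)
  from b(3) assms(2) have "eventually (\<lambda>p. y p = b p) near" by eventually_elim simp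
  with b(1,2) show ?thesis by (auto simp: infinitesimal_def)
qed

lemma integral_const: "integral (\<lambda>_. c)"
  by (rule B_integral[OF B_const])

lemma integral_add:
  assumes "integral x" "integral y" shows "integral (\<lambda>p. x p + y p)"
proof -
  obtain a b where "a \<in> B" "b \<in> B" "eventually (\<lambda>p. x p = a p) near" "eventually (\<lambda>p. y p = b p) near"
    using assms by (auto simp: integral_def)
  note ab = this
  have "eventually (\<lambda>p. x p + y p = a p + b p) near"
    using ab(3,4) by eventually_elim simp
  with ab show ?thesis unfolding integral_def by (intro bexI[of _ "\<lambda>p. a p + b p"] B_add) auto
qed

lemma integral_mult:
  assumes "integral x" "integral y" shows "integral (\<lambda>p. x p * y p)"
proof -
  obtain a b where "a \<in> B" "b \<in> B" "eventually (\<lambda>p. x p = a p) near" "eventually (\<lambda>p. y p = b p) near"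
    using assms by (auto simp: integral_def)
  note ab = this
  have "eventually (\<lambda>p. x p * y p = a p * b p) near"
    using ab(3,4) by eventually_elim simp
  with ab show ?thesis unfolding integral_def by (intro bexI[of _ "\<lambda>p. a p * b p"] B_mult) auto
qed

lemma infinitesimal_mult:
  assumes "infinitesimal x" "integral y" shows "infinitesimal (\<lambda>p. x p * y p)"
proof -
  obtain a b where "a \<in> B" "b \<in> B" "a z = 0" "eventually (\<lambda>p. x p = a p) near" "eventually (\<lambda>p. y p = b p) near"
    using assms by (auto simp: integral_def infinitesimal_def)
  note ab = this
  have "eventually (\<lambda>p. x p * y p = a p * b p) near"
    using ab(4,5) by eventually_elim simp
  with ab show ?thesis unfolding infinitesimal_def by (intro bexI[of _ "\<lambda>p. a p * b p"] B_mult) auto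
qed

lemma integral_sum: "(\<And>i. i \<in> S \<Longrightarrow> integral (f i)) \<Longrightarrow> integral (\<lambda>p. \<Sum>i\<in>S. f i p)"
  by (induction S rule: infinite_finite_induct) (simp_all add: integral_const integral_add)

lemma integral_prod: "(\<And>i. i \<in> S \<Longrightarrow> integral (f i)) \<Longrightarrow> integral (\<lambda>p. \<Prod>i\<in>S. f i p)"
  by (induction S rule: infinite_finite_induct) (simp_all add: integral_const integral_mult)

lemma integral_power: "integral x \<Longrightarrow> integral (\<lambda>p. x p ^ n)"
  by (induction n) (simp_all add: integral_const integral_mult)

lemma not_infinitesimal_1: "\<not> infinitesimal (\<lambda>_. 1)"
  unfolding infinitesimal_def using B_near_eq[of "\<lambda>_. 1"] by fastforce

lemma unit_not_infinitesimal:
  assumes "integral y" "eventually (\<lambda>p. x p * y p = 1) near"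
  shows "\<not> infinitesimal x"
  using infinitesimal_cong[OF infinitesimal_mult[OF _ assms(1)] assms(2)] not_infinitesimal_1 by blast

text \<open>If \<open>x\<close> were not integral, its inverse would be infinitesimal, and so would
  be the n-th power of that inverse; but this power is the inverse of an integral function.\<close>

lemma integral_of_power:
  assumes "integral (\<lambda>p. x p ^ n)" "n > 0"
  shows "integral x"
proof (rule valuation[of x])
  fix b assume "b \<in> B" "eventually (\<lambda>p. x p = b p) near"
  then show ?thesis by (auto simp: integral_def)
next
  fix b assume b: "b \<in> B" "b z = 0" "eventually (\<lambda>p. b p * x p = 1) near"
  have "infinitesimal (\<lambda>p. b p ^ n)"
    using b assms(2) unfolding infinitesimal_def by (intro bexI[of _ "\<lambda>p. b p ^ n"] B_power) auto
  moreover have "eventually (\<lambda>p. b p ^ n * x p ^ n = 1) near"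
    using b(3) by eventually_elim (simp flip: power_mult_distrib)
  ultimately show ?thesis using unit_not_infinitesimal[OF assms(1), of "\<lambda>p. b p ^ n"] by simp
qed

lemma B_inverse:
  assumes "b \<in> B" "b z \<noteq> 0"
  shows "integral (\<lambda>p. inverse (b p))"
proof (rule valuation[of "\<lambda>p. inverse (b p)"])
  fix c assume "c \<in> B" "eventually (\<lambda>p. inverse (b p) = c p) near"
  then show ?thesis by (auto simp: integral_def)
next
  fix c assume c: "c \<in> B" "c z = 0" "eventually (\<lambda>p. c p * inverse (b p) = 1) near"
  have "eventually (\<lambda>p. c p = b p) near"
    using c(3) by eventually_elim (auto simp: field_simps split: if_splits)
  then have "c z = b z" by (intro B_near_eq c assms)
  with c assms show ?thesis by simp
qed

text \<open>The dichotomy is applied to the indicator function of \<open>P\<close>. If it is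
  integral, its value at \<open>z\<close> decides between \<open>P\<close> and its negation; if its
  inverse is integral, it vanishes nowhere near \<open>z\<close>.\<close>

lemma near_ultra: "eventually P near \<or> eventually (\<lambda>p. \<not> P p) near"
proof (rule valuation[of "\<lambda>p. if P p then 1 else 0"])
  fix b assume b: "b \<in> B" "eventually (\<lambda>p. (if P p then 1 else 0) = b p) near"
  show ?thesis
  proof (cases "b z = 0")
    case True
    then have "eventually (\<lambda>p. 1 - b p \<noteq> 0) near" by (intro near_nonzero B_diff B_const) (use b in auto)
    with b(2) have "eventually (\<lambda>p. \<not> P p) near" by eventually_elim (auto split: if_splits)
    then show ?thesis ..
  next
    case False
    then have "eventually (\<lambda>p. b p \<noteq> 0) near" by (intro near_nonzero B_diff B_const) (use b in auto)
    with b(2) have "eventually P near" by eventually_elim (auto split: if_splits)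
    then show ?thesis ..
  qed
next
  fix b assume b: "b \<in> B" "eventually (\<lambda>p. b p * (if P p then 1 else 0) = 1) near"
  from b(2) have "eventually P near" by (rule eventually_mono) (auto split: if_splits)
  then show ?thesis ..
qed

definition divides :: "('x \<Rightarrow> complex) \<Rightarrow> ('x \<Rightarrow> complex) \<Rightarrow> bool" where
  "divides x y \<longleftrightarrow> (\<exists>b\<in>B. eventually (\<lambda>p. y p = b p * x p) near)"

lemma divides_refl: "divides x x"
  unfolding divides_def by (intro bexI[of _ "\<lambda>_. 1"]) auto

lemma divides_trans: 
  assumes "divides x y" "divides y w" shows "divides x w"
proof -
  obtain a b where "a \<in> B" "b \<in> B" "eventually (\<lambda>p. y p = a p * x p) near" "eventually (\<lambda>p. w p = b p * y p) near"
    using assms by (auto simp: divides_def)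
  note ab = this
  have "eventually (\<lambda>p. w p = b p * a p * x p) near"
    using ab(3,4) by eventually_elim simp
  with ab show ?thesis unfolding divides_def by (intro bexI[of _ "\<lambda>p. b p * a p"] B_mult) auto
qed

text \<open>Germs behave like a field here: a function that is not zero near \<open>z\<close> is
  nonzero throughout some neighbourhood, so the quotient makes sense and the valuation dichotomy
  applies to it.\<close>

lemma divides_total: "divides x y \<or> divides y x"
proof (cases "eventually (\<lambda>p. x p = 0) near")
  case True
  then have "divides y x" unfolding divides_def by (intro bexI[of _ "\<lambda>_. 0"]) auto
  then show ?thesis ..
next
  case False
  then have x: "eventually (\<lambda>p. x p \<noteq> 0) near" using near_ultra[of "\<lambda>p. x p = 0"] by simp
  show ?thesis
  proof (rule valuation[of "\<lambda>p. y p / x p"])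
    fix b assume b: "b \<in> B" "eventually (\<lambda>p. y p / x p = b p) near"
    from b(2) x have "eventually (\<lambda>p. y p = b p * x p) near" by eventually_elim (auto simp: field_simps)
    with b(1) show ?thesis by (auto simp: divides_def)
  next
    fix b assume b: "b \<in> B" "eventually (\<lambda>p. b p * (y p / x p) = 1) near"
    from b(2) x have "eventually (\<lambda>p. x p = b p * y p) near" by eventually_elim (auto simp: field_simps)
    with b(1) show ?thesis by (auto simp: divides_def)
  qed
qed

end

section \<open>Smith normal form over a place\<close>

definition swap_mat :: "'n::finite \<Rightarrow> 'n \<Rightarrow> complex^'n^'n" where
  "swap_mat a b = (\<chi> i j. if j = Transposition.transpose a b i then 1 else 0)"

lemma swap_mat_mult: "(swap_mat a b ** M) $ i $ j = M $ Transposition.transpose a b i $ j"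
  by (simp add: matrix_matrix_mult_def swap_mat_def if_distrib[of "\<lambda>x. x * _"] cong: if_cong)

lemma mult_swap_mat: "(M ** swap_mat a b) $ i $ j = M $ i $ Transposition.transpose a b j"
proof -
  have "M $ i $ k * swap_mat a b $ k $ j = (if k = Transposition.transpose a b j then M $ i $ k else 0)" for k
    by (auto simp: swap_mat_def)
  then show ?thesis by (simp add: matrix_matrix_mult_def)
qed

lemma swap_mat_swap_mat: "swap_mat a b ** swap_mat a b = mat 1"
  unfolding vec_eq_iff swap_mat_mult by (simp add: swap_mat_def mat_def eq_commute)

definition shear :: "'n \<Rightarrow> ('n \<Rightarrow> complex) \<Rightarrow> complex^'n^'n" where
  "shear s c = (\<chi> i j. (if i = j then 1 else 0) - (if j = s then c i else 0))"

lemma shear_mult: "(shear s c ** M) $ i $ j = M $ i $ j - c i * M $ s $ j"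
proof -
  have "shear s c $ i $ k * M $ k $ j =
      (if k = i then M $ k $ j else 0) - (if k = s then c i * M $ k $ j else 0)" for k
    by (simp add: shear_def algebra_simps)
  then show ?thesis by (simp add: matrix_matrix_mult_def sum_subtractf)
qed

lemma shear_shear: "c s = 0 \<Longrightarrow> shear s c ** shear s (\<lambda>i. - c i) = mat 1"
  unfolding vec_eq_iff shear_mult by (auto simp: shear_def mat_def)

lemma mult_transpose_shear:
  "(M ** Finite_Cartesian_Product.transpose (shear s c)) $ i $ j = M $ i $ j - c j * M $ i $ s"
proof -
  have "M $ i $ k * Finite_Cartesian_Product.transpose (shear s c) $ k $ j =
      (if k = j then M $ i $ k else 0) - (if k = s then c j * M $ i $ k else 0)" for k
    by (auto simp: shear_def transpose_def algebra_simps)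
  then show ?thesis by (simp add: matrix_matrix_mult_def sum_subtractf)
qed

definition diag_mat :: "('n \<Rightarrow> complex) \<Rightarrow> complex^'n^'n" where
  "diag_mat d = (\<chi> i j. if i = j then d i else 0)"

context function_algebra
begin

definition B_mat :: "('x \<Rightarrow> complex^'n^'m) \<Rightarrow> bool" where
  "B_mat M \<longleftrightarrow> (\<forall>i j. (\<lambda>p. M p $ i $ j) \<in> B)"

lemma B_mat_mult:
  fixes M :: "'x \<Rightarrow> complex^'n^'m" and N :: "'x \<Rightarrow> complex^'k^'n"
  assumes "B_mat M" "B_mat N"
  shows "B_mat (\<lambda>p. M p ** N p)"
  using assms unfolding B_mat_def matrix_matrix_mult_def
  by (simp add: B_sum[of UNIV "\<lambda>k p. M p $ _ $ k * N p $ k $ _"] B_mult)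

lemma B_mat_const: "B_mat (\<lambda>_. M)"
  by (simp add: B_mat_def)

end

context place
begin

lemma B_mat_near_eq:
  assumes "B_mat M" "B_mat N" "eventually (\<lambda>p. M p = N p) near"
  shows "M z = N z"
proof -
  have "M z $ i $ j = N z $ i $ j" for i j
    by (rule B_near_eq[of "\<lambda>p. M p $ i $ j" "\<lambda>p. N p $ i $ j"])
       (use assms in \<open>auto simp: B_mat_def elim!: eventually_mono\<close>)
  then show ?thesis by (simp add: vec_eq_iff)
qed

text \<open>The general linear group over the valuation ring. The inverse relation is asked for only
  along \<open>near\<close>; at \<open>z\<close> it follows, because both families have entries in
  \<open>B\<close>.\<close>

definition B_GL :: "('x \<Rightarrow> complex^'n^'n) \<Rightarrow> bool" where
  "B_GL h \<longleftrightarrow> B_mat h \<and> (\<exists>h'. B_mat h' \<and> eventually (\<lambda>p. h p ** h' p = mat 1) near)"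

lemma B_GL_mult:
  assumes "B_GL h" "B_GL k"
  shows "B_GL (\<lambda>p. h p ** k p)"
proof -
  obtain h' k' where *: "B_mat h'" "eventually (\<lambda>p. h p ** h' p = mat 1) near"
    "B_mat k'" "eventually (\<lambda>p. k p ** k' p = mat 1) near"
    using assms by (auto simp: B_GL_def)
  have "eventually (\<lambda>p. (h p ** k p) ** (k' p ** h' p) = mat 1) near"
    using *(2,4)
  proof eventually_elim
    case (elim p)
    have "(h p ** k p) ** (k' p ** h' p) = h p ** (k p ** k' p) ** h' p"
      by (simp add: matrix_mul_assoc)
    with elim show ?case by simp
  qed
  moreover have "B_mat (\<lambda>p. h p ** k p)" using assms by (auto simp: B_GL_def intro: B_mat_mult)
  ultimately show ?thesis unfolding B_GL_def using B_mat_mult[OF *(3,1)] by blast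
qed

lemma B_GL_swap: "B_GL (\<lambda>_. swap_mat a b)"
  unfolding B_GL_def
  by (intro conjI B_mat_const exI[of _ "\<lambda>_. swap_mat a b"]) (simp add: swap_mat_swap_mat)

lemma B_mat_shear:
  assumes "\<And>i. c i \<in> B"
  shows "B_mat (\<lambda>p. shear s (\<lambda>i. c i p))"
  unfolding B_mat_def shear_def vec_lambda_beta
proof (intro allI B_diff)
  fix i j show "(\<lambda>p. if j = s then c i p else 0) \<in> B" by (cases "j = s") (simp_all add: assms)
qed simp

lemma B_GL_shear:
  assumes "\<And>i. c i \<in> B" "\<And>p. c s p = 0"
  shows "B_GL (\<lambda>p. shear s (\<lambda>i. c i p))"
proof -
  have "B_mat (\<lambda>p. shear s (\<lambda>i. - c i p))"
    by (rule B_mat_shear[of "\<lambda>i p. - c i p"]) (intro B_uminus assms)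
  moreover have "B_mat (\<lambda>p. shear s (\<lambda>i. c i p))" by (rule B_mat_shear) (rule assms)
  ultimately show ?thesis unfolding B_GL_def
    by (intro conjI exI[of _ "\<lambda>p. shear s (\<lambda>i. - c i p)"]) (simp_all add: shear_shear assms)
qed

lemma B_mat_transpose: "B_mat M \<Longrightarrow> B_mat (\<lambda>p. transpose (M p))"
  by (simp add: B_mat_def transpose_def)

lemma B_GL_transpose:
  assumes "B_GL h" shows "B_GL (\<lambda>p. transpose (h p))"
proof -
  obtain h' where *: "B_mat h'" "eventually (\<lambda>p. h p ** h' p = mat 1) near"
    using assms by (auto simp: B_GL_def)
  have "eventually (\<lambda>p. transpose (h p) ** transpose (h' p) = mat 1) near"
    using *(2)
  proof eventually_elim
    case (elim p)
    then have "h' p ** h p = mat 1" using matrix_left_right_inverse by blast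
    then show ?case by (metis matrix_transpose_mul transpose_mat)
  qed
  then show ?thesis unfolding B_GL_def
    using B_mat_transpose[OF *(1)] B_mat_transpose[of h] assms by (auto simp: B_GL_def)
qed

lemma divides_least:
  assumes "finite T" "T \<noteq> {}"
  shows "\<exists>m\<in>T. \<forall>t\<in>T. divides (f m) (f t)"
  using assms
proof (induction rule: finite_ne_induct)
  case (singleton t)
  then show ?case using divides_refl by auto
next
  case (insert t T)
  then obtain m where m: "m \<in> T" "\<And>u. u \<in> T \<Longrightarrow> divides (f m) (f u)" by blast
  show ?case
  proof (cases "divides (f m) (f t)")
    case True
    with m show ?thesis by auto
  next
    case False
    then have "divides (f t) (f m)" using divides_total by blast
    then have "divides (f t) (f u)" if "u \<in> insert t T" for u
      using that m(2) divides_refl divides_trans by blast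
    then show ?thesis by blast
  qed
qed

definition cleared :: "'n set \<Rightarrow> ('x \<Rightarrow> complex^'n^'n) \<Rightarrow> bool" where
  "cleared S M \<longleftrightarrow> (\<forall>i j. i \<noteq> j \<longrightarrow> i \<in> S \<or> j \<in> S \<longrightarrow> eventually (\<lambda>p. M p $ i $ j = 0) near)"

text \<open>The pivot is an entry outside the cleared rows and columns that divides all others
  there, that is, one of least valuation. Once it stands at position (s, s), all multipliers that
  clear row and column \<open>s\<close> lie in \<open>B\<close>.\<close>

lemma clear_step:
  assumes "cleared S M" "s \<notin> S"
  obtains h k where "B_GL h" "B_GL k" "cleared (insert s S) (\<lambda>p. h p ** M p ** k p)"
proof -
  have "\<exists>m\<in>(- S) \<times> (- S). \<forall>t\<in>(- S) \<times> (- S).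
      divides ((\<lambda>(i, j) p. M p $ i $ j) m) ((\<lambda>(i, j) p. M p $ i $ j) t)"
    by (rule divides_least) (use assms(2) in auto)
  then obtain a b where ab: "a \<notin> S" "b \<notin> S"
    and piv: "\<And>i j. i \<notin> S \<Longrightarrow> j \<notin> S \<Longrightarrow> divides (\<lambda>p. M p $ a $ b) (\<lambda>p. M p $ i $ j)"
    by auto
  define N where "N = (\<lambda>p. swap_mat a s ** M p ** swap_mat b s)"
  have N: "N p $ i $ j = M p $ Transposition.transpose a s i $ Transposition.transpose b s j" for p i j
    by (simp add: N_def mult_swap_mat swap_mat_mult)
  \<comment> \<open>\<open>a\<close>, \<open>b\<close> and \<open>s\<close> lie outside
    \<open>S\<close>, so the swaps only permute indices that are not yet cleared.\<close>
  have Ncl: "eventually (\<lambda>p. N p $ i $ j = 0) near" if "i \<noteq> j" "i \<in> S \<or> j \<in> S" for i j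
  proof -
    let ?i = "Transposition.transpose a s i" and ?j = "Transposition.transpose b s j"
    have "?i \<noteq> ?j" "?i \<in> S \<or> ?j \<in> S" using that ab assms(2) by (auto simp: Transposition.transpose_def)
    then show ?thesis using assms(1) unfolding N cleared_def by blast
  qed
  have Npiv: "divides (\<lambda>p. N p $ s $ s) (\<lambda>p. N p $ i $ j)" if "i \<notin> S" "j \<notin> S" for i j
  proof -
    have "(\<lambda>p. N p $ s $ s) = (\<lambda>p. M p $ a $ b)" by (auto simp: N)
    moreover have "Transposition.transpose a s i \<notin> S" "Transposition.transpose b s j \<notin> S"
      using that ab assms(2) by (auto simp: Transposition.transpose_def)
    ultimately show ?thesis unfolding N using piv by simp
  qed
  \<comment> \<open>The multiplier is 0 at \<open>s\<close>, which makes the shear invertible, and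
    on \<open>S\<close>, so that the finished rows stay as they are.\<close>
  have ex_c: "\<exists>c. c \<in> B \<and> (i = s \<or> i \<in> S \<longrightarrow> c = (\<lambda>_. 0)) \<and>
      (i \<noteq> s \<longrightarrow> i \<notin> S \<longrightarrow> eventually (\<lambda>p. N p $ i $ s = c p * N p $ s $ s) near)" for i
  proof (cases "i = s \<or> i \<in> S")
    case True
    then show ?thesis using B_const[of 0] by blast
  next
    case False
    then have "divides (\<lambda>p. N p $ s $ s) (\<lambda>p. N p $ i $ s)" by (intro Npiv assms(2)) blast
    with False show ?thesis unfolding divides_def by blast
  qed
  have "\<exists>c. \<forall>i. c i \<in> B \<and> (i = s \<or> i \<in> S \<longrightarrow> c i = (\<lambda>_. 0)) \<and>
      (i \<noteq> s \<longrightarrow> i \<notin> S \<longrightarrow> eventually (\<lambda>p. N p $ i $ s = c i p * N p $ s $ s) near)"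
    by (rule choice) (rule allI, rule ex_c)
  then obtain c where c0: "\<forall>i. c i \<in> B \<and> (i = s \<or> i \<in> S \<longrightarrow> c i = (\<lambda>_. 0)) \<and>
      (i \<noteq> s \<longrightarrow> i \<notin> S \<longrightarrow> eventually (\<lambda>p. N p $ i $ s = c i p * N p $ s $ s) near)" ..
  have c: "c i \<in> B" "i = s \<or> i \<in> S \<Longrightarrow> c i = (\<lambda>_. 0)" for i
    using spec[OF c0, of i] by blast+
  have c3: "eventually (\<lambda>p. N p $ i $ s = c i p * N p $ s $ s) near" if "i \<noteq> s" "i \<notin> S" for i
    using spec[OF c0, of i] that by blast
  have ex_d: "\<exists>d. d \<in> B \<and> (j = s \<or> j \<in> S \<longrightarrow> d = (\<lambda>_. 0)) \<and>
      (j \<noteq> s \<longrightarrow> j \<notin> S \<longrightarrow> eventually (\<lambda>p. N p $ s $ j = d p * N p $ s $ s) near)" for j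
  proof (cases "j = s \<or> j \<in> S")
    case True
    then show ?thesis using B_const[of 0] by blast
  next
    case False
    then have "divides (\<lambda>p. N p $ s $ s) (\<lambda>p. N p $ s $ j)" by (intro Npiv assms(2)) blast
    with False show ?thesis unfolding divides_def by blast
  qed
  have "\<exists>d. \<forall>j. d j \<in> B \<and> (j = s \<or> j \<in> S \<longrightarrow> d j = (\<lambda>_. 0)) \<and>
      (j \<noteq> s \<longrightarrow> j \<notin> S \<longrightarrow> eventually (\<lambda>p. N p $ s $ j = d j p * N p $ s $ s) near)"
    by (rule choice) (rule allI, rule ex_d)
  then obtain d where d0: "\<forall>j. d j \<in> B \<and> (j = s \<or> j \<in> S \<longrightarrow> d j = (\<lambda>_. 0)) \<and>
      (j \<noteq> s \<longrightarrow> j \<notin> S \<longrightarrow> eventually (\<lambda>p. N p $ s $ j = d j p * N p $ s $ s) near)" ..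
  have d: "d i \<in> B" "i = s \<or> i \<in> S \<Longrightarrow> d i = (\<lambda>_. 0)" for i
    using spec[OF d0, of i] by blast+
  have d3: "eventually (\<lambda>p. N p $ s $ j = d j p * N p $ s $ s) near" if "j \<noteq> s" "j \<notin> S" for j
    using spec[OF d0, of j] that by blast
  let ?h = "\<lambda>p. shear s (\<lambda>i. c i p)" and ?k = "\<lambda>p. transpose (shear s (\<lambda>i. d i p))"
  have R: "(?h p ** N p ** ?k p) $ i $ j =
      N p $ i $ j - c i p * N p $ s $ j - d j p * (N p $ i $ s - c i p * N p $ s $ s)" for p i j
    by (simp add: mult_transpose_shear shear_mult)
  have "cleared (insert s S) (\<lambda>p. ?h p ** N p ** ?k p)"
    unfolding cleared_def R
  proof (intro allI impI)
    fix i j assume ij: "i \<noteq> j" "i \<in> insert s S \<or> j \<in> insert s S"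
    consider "i \<in> S" | "j \<in> S" "i \<notin> S" | "j = s" "i \<notin> S" | "i = s" "j \<notin> S" using ij by blast
    then show "eventually (\<lambda>p. N p $ i $ j - c i p * N p $ s $ j -
        d j p * (N p $ i $ s - c i p * N p $ s $ s) = 0) near"
    proof cases
      case 1
      then have [simp]: "c i = (\<lambda>_. 0)" using c(2) by blast
      have "eventually (\<lambda>p. N p $ i $ s = 0) near" using 1 assms(2) by (intro Ncl) auto
      moreover have "eventually (\<lambda>p. N p $ i $ j = 0) near" using 1 ij by (intro Ncl) auto
      ultimately show ?thesis by eventually_elim simp
    next
      case 2
      then have [simp]: "d j = (\<lambda>_. 0)" using d(2) by blast
      have "eventually (\<lambda>p. N p $ s $ j = 0) near" using 2 assms(2) by (intro Ncl) auto
      moreover have "eventually (\<lambda>p. N p $ i $ j = 0) near" using 2 ij by (intro Ncl) auto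
      ultimately show ?thesis by eventually_elim simp
    next
      case 3
      then have [simp]: "d j = (\<lambda>_. 0)" using d(2) by blast
      have "eventually (\<lambda>p. N p $ i $ s = c i p * N p $ s $ s) near" using 3 ij by (intro c3) auto
      then show ?thesis by eventually_elim (simp add: 3 algebra_simps)
    next
      case 4
      then have [simp]: "c i = (\<lambda>_. 0)" using c(2) by blast
      have "eventually (\<lambda>p. N p $ s $ j = d j p * N p $ s $ s) near" using 4 ij by (intro d3) auto
      then show ?thesis by eventually_elim (simp add: 4 algebra_simps)
    qed
  qed
  moreover have "(\<lambda>p. ?h p ** N p ** ?k p) =
      (\<lambda>p. (?h p ** swap_mat a s) ** M p ** (swap_mat b s ** ?k p))"
    by (simp add: N_def matrix_mul_assoc)
  ultimately have cl: "cleared (insert s S) (\<lambda>p. (?h p ** swap_mat a s) ** M p ** (swap_mat b s ** ?k p))"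
    by simp
  have h: "B_GL (\<lambda>p. ?h p ** swap_mat a s)"
    by (intro B_GL_mult B_GL_shear B_GL_swap c(1)) (simp add: c(2))
  have k: "B_GL (\<lambda>p. swap_mat b s ** ?k p)"
    by (intro B_GL_mult B_GL_transpose B_GL_shear B_GL_swap d(1)) (simp add: d(2))
  show thesis by (rule that[OF h k cl])
qed

text \<open>Clearing the indices one after another leaves a diagonal matrix, whose entries are
  arbitrary germs and in no particular order of divisibility.\<close>

theorem smith_form:
  fixes g :: "'x \<Rightarrow> complex^'n^'n"
  obtains h k d where "B_GL h" "B_GL k" "eventually (\<lambda>p. h p ** g p ** k p = diag_mat (d p)) near"
proof -
  have "\<exists>h k. B_GL h \<and> B_GL k \<and> cleared S (\<lambda>p. h p ** g p ** k p)" if "finite S" for S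
    using that
  proof induction
    case empty
    have "B_GL (\<lambda>_. mat 1 :: complex^'n^'n)" unfolding B_GL_def
      by (intro conjI B_mat_const exI[of _ "\<lambda>_. mat 1"]) simp
    then show ?case
      by (intro exI[of _ "\<lambda>_. mat 1 :: complex^'n^'n"] conjI) (simp_all add: cleared_def)
  next
    case (insert s S)
    from insert.IH obtain h k where hk: "B_GL h" "B_GL k" "cleared S (\<lambda>p. h p ** g p ** k p)"
      by (elim exE conjE)
    obtain h' k' where hk': "B_GL h'" "B_GL k'"
      "cleared (Set.insert s S) (\<lambda>p. h' p ** (h p ** g p ** k p) ** k' p)"
      by (rule clear_step[OF hk(3) insert.hyps(2)])
    moreover have "(\<lambda>p. h' p ** (h p ** g p ** k p) ** k' p) =
      (\<lambda>p. (h' p ** h p) ** g p ** (k p ** k' p))"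
      by (simp add: matrix_mul_assoc)
    ultimately have "cleared (Set.insert s S) (\<lambda>p. (h' p ** h p) ** g p ** (k p ** k' p))" by simp
    with B_GL_mult[OF hk'(1) hk(1)] B_GL_mult[OF hk(2) hk'(2)] show ?case
      by (intro exI[of _ "\<lambda>p. h' p ** h p"] exI[of _ "\<lambda>p. k p ** k' p"] conjI)
  qed
  from this[OF finite_class.finite_UNIV] obtain h k
    where hk: "B_GL h" "B_GL k" "cleared UNIV (\<lambda>p. h p ** g p ** k p)"
    by (elim exE conjE)
  have "eventually (\<lambda>p. i \<noteq> j \<longrightarrow> (h p ** g p ** k p) $ i $ j = 0) near" for i j
    using hk(3) by (cases "i = j") (simp_all add: cleared_def)
  then have "eventually (\<lambda>p. \<forall>i j. i \<noteq> j \<longrightarrow> (h p ** g p ** k p) $ i $ j = 0) near"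
    by (simp add: eventually_all_finite)
  then have "eventually (\<lambda>p. h p ** g p ** k p = diag_mat (\<lambda>i. (h p ** g p ** k p) $ i $ i)) near"
    by eventually_elim (simp add: diag_mat_def vec_eq_iff)
  then show thesis by (rule that[OF hk(1,2)])
qed

end

section \<open>Graded pieces of polynomials\<close>

lemma prod_UNIV_sum:
  "(\<Prod>v\<in>(UNIV :: ('a::finite + 'b::finite) set). f v) = (\<Prod>i\<in>UNIV. f (Inl i)) * (\<Prod>j\<in>UNIV. f (Inr j))"
  using prod.Plus[of "UNIV :: 'a set" "UNIV :: 'b set" f] by (simp add: UNIV_Plus_UNIV)

lemma sum_UNIV_sum:
  "(\<Sum>v\<in>(UNIV :: ('a::finite + 'b::finite) set). f v) = (\<Sum>i\<in>UNIV. f (Inl i)) + (\<Sum>j\<in>UNIV. f (Inr j))"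
  using sum.Plus[of "UNIV :: 'a set" "UNIV :: 'b set" f] by (simp add: UNIV_Plus_UNIV)

definition restrict_keys :: "('a \<Rightarrow> bool) \<Rightarrow> ('a \<Rightarrow>\<^sub>0 complex) \<Rightarrow> ('a \<Rightarrow>\<^sub>0 complex)" where
  "restrict_keys R P = (\<Sum>I\<in>keys P \<inter> Collect R. single I (lookup P I))"

lemma lookup_restrict_keys:
  "lookup (restrict_keys R P) I = (if R I then lookup P I else 0)"
proof -
  have "lookup (restrict_keys R P) I =
      (\<Sum>J\<in>keys P \<inter> Collect R. if J = I then lookup P J else 0)"
    by (simp add: restrict_keys_def lookup_sum lookup_single when_def)
  also have "\<dots> = (if I \<in> keys P \<inter> Collect R then lookup P I else 0)"
    by (simp add: sum.delta)
  also have "\<dots> = (if R I then lookup P I else 0)" by (auto simp: in_keys_iff)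
  finally show ?thesis .
qed

lemma keys_restrict_keys: "keys (restrict_keys R P) = keys P \<inter> Collect R"
  by (auto simp: in_keys_iff lookup_restrict_keys split: if_splits)

lemma mpol_eval_alt: "mpol_eval a P = (\<Sum>I\<in>keys P. lookup P I * mono_eval a I)"
  by (simp add: mpol_eval_def mono_eval_def)

lemma mpol_eval_restrict_keys:
  "mpol_eval a (restrict_keys R P) =
     (\<Sum>I\<in>keys P \<inter> Collect R. lookup P I * mono_eval a I)"
  by (simp add: mpol_eval_alt keys_restrict_keys lookup_restrict_keys)

text \<open>General in the weight \<open>w\<close>, because it is applied both to the exponent of
  one variable and to the total degree.\<close>

lemma mpol_eval_graded:
  assumes "\<And>I. mono_eval b I = c ^ w I * mono_eval a I"
  shows "mpol_eval b P =
    (\<Sum>n\<in>w ` keys P. c ^ n * mpol_eval a (restrict_keys (\<lambda>I. w I = n) P))"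
proof -
  have "mpol_eval b P = (\<Sum>I\<in>keys P. c ^ w I * (lookup P I * mono_eval a I))"
    by (simp add: mpol_eval_alt assms mult_ac)
  also have "\<dots> = (\<Sum>n\<in>w ` keys P. \<Sum>I\<in>{I\<in>keys P. w I = n}.
      c ^ w I * (lookup P I * mono_eval a I))"
    by (rule sum.group[symmetric]) auto
  also have "\<dots> = (\<Sum>n\<in>w ` keys P. c ^ n * mpol_eval a (restrict_keys (\<lambda>I. w I = n) P))"
  proof (intro sum.cong refl)
    fix n
    have "keys P \<inter> {I. w I = n} = {I \<in> keys P. w I = n}" by blast
    then show "(\<Sum>I\<in>{I\<in>keys P. w I = n}. c ^ w I * (lookup P I * mono_eval a I)) =
        c ^ n * mpol_eval a (restrict_keys (\<lambda>I. w I = n) P)"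
      by (simp add: mpol_eval_restrict_keys sum_distrib_left)
  qed
  finally show ?thesis .
qed

lemma power_sum_eq_0:
  fixes x :: "nat \<Rightarrow> complex"
  assumes "finite N" "\<And>c. c \<noteq> 0 \<Longrightarrow> (\<Sum>n\<in>N. c ^ n * x n) = 0" "n \<in> N"
  shows "x n = 0"
proof -
  define p where "p = (\<Sum>n\<in>N. monom (x n) n)"
  have "poly p c = 0" if "c \<noteq> 0" for c
    using assms(2)[OF that] by (simp add: p_def poly_sum poly_monom mult.commute)
  then have "UNIV - {0} \<subseteq> {c. poly p c = 0}" by auto
  moreover have "infinite (UNIV - {0 :: complex})" by (simp add: infinite_UNIV_char_0)
  ultimately have "p = 0" using poly_roots_finite finite_subset by blast
  then have "coeff p n = 0" by simp
  then show ?thesis using assms(1,3) by (simp add: p_def coeff_sum coeff_monom sum.delta)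
qed

lemma mpol_eval_graded_eq_0:
  assumes "\<And>c I. c \<noteq> 0 \<Longrightarrow> mono_eval (b c) I = c ^ w I * mono_eval a I"
    and "\<And>c. c \<noteq> 0 \<Longrightarrow> mpol_eval (b c) P = 0"
  shows "mpol_eval a (restrict_keys (\<lambda>I. w I = n) P) = 0"
proof (cases "n \<in> w ` keys P")
  case True
  have "(\<Sum>n\<in>w ` keys P. c ^ n * mpol_eval a (restrict_keys (\<lambda>I. w I = n) P)) = 0"
    if "c \<noteq> 0" for c
    using mpol_eval_graded[of "b c" c w a P] assms that by simp
  from power_sum_eq_0[OF _ this True] show ?thesis by simp
next
  case False
  then have "keys P \<inter> {I. w I = n} = {}" by auto
  then show ?thesis by (simp add: mpol_eval_restrict_keys)
qed

text \<open>Rescaling one variable separates a polynomial by its exponent there, and each part still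
  vanishes identically. After all variables have been treated a single monomial is left, and
  evaluation at the all-ones point reads off its coefficient.\<close>

theorem mpol_eq_0:
  fixes P :: "('v::finite) mpol"
  assumes "\<And>a. mpol_eval a P = 0"
  shows "P = 0"
proof (rule poly_mapping_eqI)
  fix J
  have "\<forall>a. mpol_eval a (restrict_keys (\<lambda>I. \<forall>v\<in>S. lookup I v = lookup J v) P) = 0"
    if "finite S" for S
    using that
  proof induction
    case empty
    have "restrict_keys (\<lambda>I. True) P = P" by (rule poly_mapping_eqI) (simp add: lookup_restrict_keys)
    then show ?case using assms by simp
  next
    case (insert v S)
    let ?Q = "restrict_keys (\<lambda>I. \<forall>v\<in>S. lookup I v = lookup J v) P"
    show ?case
    proof
      fix a :: "'v \<Rightarrow> complex"
      have "mono_eval (a(v := c * a v)) I = c ^ lookup I v * mono_eval a I" for c I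
      proof -
        have "mono_eval (a(v := c * a v)) I =
            mono_eval (\<lambda>u. (if u = v then c else 1) * a u) I"
          by (rule arg_cong[where f = "\<lambda>f. mono_eval f I"]) auto
        also have "\<dots> = mono_eval (\<lambda>u. if u = v then c else 1) I * mono_eval a I"
          by (rule mono_eval_mult)
        also have "mono_eval (\<lambda>u. if u = v then c else 1) I =
            (\<Prod>u\<in>UNIV. if u = v then c ^ lookup I u else 1)"
          by (simp add: mono_eval_UNIV if_distrib[of "\<lambda>x. x ^ _"] cong: if_cong)
        finally show ?thesis by (simp add: prod.delta del: fun_upd_apply)
      qed
      from mpol_eval_graded_eq_0[where b = "\<lambda>c. a(v := c * a v)" and w = "\<lambda>I. lookup I v",
          OF this spec[OF insert.IH]]
      have "mpol_eval a (restrict_keys (\<lambda>I. lookup I v = lookup J v) ?Q) = 0" .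
      moreover have "restrict_keys (\<lambda>I. lookup I v = lookup J v) ?Q =
          restrict_keys (\<lambda>I. \<forall>v\<in>Set.insert v S. lookup I v = lookup J v) P"
        by (rule poly_mapping_eqI) (auto simp: lookup_restrict_keys)
      ultimately show "mpol_eval a (restrict_keys
          (\<lambda>I. \<forall>v\<in>Set.insert v S. lookup I v = lookup J v) P) = 0"
        by simp
    qed
  qed
  then have "mpol_eval (\<lambda>_. 1)
      (restrict_keys (\<lambda>I. \<forall>v\<in>UNIV. lookup I v = lookup J v) P) = 0"
    using finite_class.finite_UNIV by blast
  moreover have "restrict_keys (\<lambda>I. \<forall>v\<in>UNIV. lookup I v = lookup J v) P =
      single J (lookup P J)"
  proof (rule poly_mapping_eqI)
    fix I
    have "(\<forall>v\<in>UNIV. lookup I v = lookup J v) \<longleftrightarrow> I = J"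
      by (auto intro: poly_mapping_eqI)
    then show "lookup (restrict_keys
        (\<lambda>I. \<forall>v\<in>UNIV. lookup I v = lookup J v) P) I =
      lookup (single J (lookup P J)) I"
      by (simp only: lookup_restrict_keys lookup_single when_def) auto
  qed
  ultimately show "lookup P J = lookup 0 J"
    by (simp add: mpol_eval_simps)
qed

corollary mpol_eqI:
  fixes P Q :: "('v::finite) mpol"
  assumes "\<And>a. mpol_eval a P = mpol_eval a Q"
  shows "P = Q"
proof -
  have "mpol_eval a (P - Q) = 0" for a
    using assms[of a] mpol_eval_simps(3)[of a "P - Q" Q] by simp
  then show ?thesis using mpol_eq_0[of "P - Q"] by simp
qed

section \<open>Homogeneous components\<close>

definition total_degree :: "'v monom \<Rightarrow> nat" where
  "total_degree I = (\<Sum>v\<in>keys I. lookup I v)"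

lemma mono_eval_scale: "mono_eval (\<lambda>v. c * a v) I = c ^ total_degree I * mono_eval a I"
  by (simp add: mono_eval_mult) (simp add: mono_eval_def total_degree_def power_sum)

definition homogeneous_part :: "nat \<Rightarrow> 'v mpol \<Rightarrow> 'v mpol" where
  "homogeneous_part d P = restrict_keys (\<lambda>I. total_degree I = d) P"

lemma homogeneous_homogeneous_part: "homogeneous d (homogeneous_part d P)"
  by (simp add: homogeneous_def homogeneous_part_def keys_restrict_keys total_degree_def)

lemma mpol_eval_homogeneous:
  assumes "homogeneous d P"
  shows "mpol_eval (\<lambda>v. c * a v) P = c ^ d * mpol_eval a P"
proof -
  have "mono_eval (\<lambda>v. c * a v) I = c ^ d * mono_eval a I" if "I \<in> keys P" for I
    using assms that by (simp add: mono_eval_scale homogeneous_def total_degree_def)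
  then show ?thesis by (simp add: mpol_eval_alt sum_distrib_left mult_ac)
qed

lemma mpol_eval_homogeneous_part_sum:
  "mpol_eval a P = (\<Sum>d\<in>total_degree ` keys P. mpol_eval a (homogeneous_part d P))"
  using mpol_eval_graded[of a 1 total_degree a P] by (simp add: homogeneous_part_def)

lemma lookup_Const_mult_fun:
  "lookup (Const c * F) = (\<lambda>I. c * lookup F I)"
  by (rule ext) (rule lookup_Const_mult)

lemma coeff_eval_scale:
  assumes "homogeneous d P"
  shows "coeff_eval P (Const c * F) = c ^ d * coeff_eval P F"
  using mpol_eval_homogeneous[OF assms, of c "lookup F"]
  by (simp add: coeff_eval_def lookup_Const_mult_fun)

text \<open>Along the punctured line through \<open>F\<close> the value of \<open>P\<close> is a
  polynomial in \<open>c\<close> whose coefficients are the values of the homogeneous parts at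
  \<open>F\<close>.\<close>

lemma coeff_eval_homogeneous_part_eq_0:
  assumes "\<And>c. c \<noteq> 0 \<Longrightarrow> coeff_eval P (Const c * F) = 0"
  shows "coeff_eval (homogeneous_part d P) F = 0"
  unfolding coeff_eval_def homogeneous_part_def
  by (rule mpol_eval_graded_eq_0[where b = "\<lambda>c v. c * lookup F v"])
     (use assms in \<open>auto simp: mono_eval_scale coeff_eval_def lookup_Const_mult_fun\<close>)

section \<open>Linear substitutions\<close>

type_synonym ('a, 'b) mats = "(complex^'a^'a) \<times> (complex^'b^'b)"

definition linear_forms :: "('a::finite, 'b::finite) mats \<Rightarrow> 'a + 'b \<Rightarrow> ('a + 'b) mpol" where
  "linear_forms M v = (case v of
       Inl i \<Rightarrow> (\<Sum>j\<in>UNIV. Const (fst M $ i $ j) * Var (Inl j))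
     | Inr i \<Rightarrow> (\<Sum>j\<in>UNIV. Const (snd M $ i $ j) * Var (Inr j)))"

text \<open>This is \<open>F \<circ> M\<close>, a right action.\<close>

definition lact :: "('a::finite, 'b::finite) mats \<Rightarrow> ('a + 'b) mpol \<Rightarrow> ('a + 'b) mpol" where
  "lact M F = mpol_subst (linear_forms M) F"

definition pair_mult :: "('a::finite, 'b::finite) mats \<Rightarrow> ('a, 'b) mats \<Rightarrow> ('a, 'b) mats" where
  "pair_mult M N = (fst M ** fst N, snd M ** snd N)"

lemma act_eq_lact: "act g F = lact (matrix_inv (fst g), matrix_inv (snd g)) F"
  unfolding act_def lact_def
  by (rule arg_cong[where f = "\<lambda>\<sigma>. mpol_subst \<sigma> F"]) (auto simp: linear_forms_def fun_eq_iff split: sum.splits)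

lemma subst_linear_forms: "mpol_subst (linear_forms N) (linear_forms M v) = linear_forms (pair_mult M N) v"
proof (cases v)
  case (Inl i)
  have "mpol_subst (linear_forms N) (linear_forms M v) =
      (\<Sum>j\<in>UNIV. \<Sum>k\<in>UNIV. Const (fst M $ i $ j) * (Const (fst N $ j $ k) * Var (Inl k)))"
    by (simp add: Inl linear_forms_def mpol_subst_simps sum_distrib_left)
  also have "\<dots> = (\<Sum>k\<in>UNIV. \<Sum>j\<in>UNIV. Const (fst M $ i $ j) * (Const (fst N $ j $ k) * Var (Inl k)))"
    by (rule sum.swap)
  also have "\<dots> = linear_forms (pair_mult M N) v"
    by (simp add: Inl linear_forms_def pair_mult_def matrix_matrix_mult_def Const_sum Const_mult sum_distrib_right mult.assoc)
  finally show ?thesis .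
next
  case (Inr i)
  have "mpol_subst (linear_forms N) (linear_forms M v) =
      (\<Sum>j\<in>UNIV. \<Sum>k\<in>UNIV. Const (snd M $ i $ j) * (Const (snd N $ j $ k) * Var (Inr k)))"
    by (simp add: Inr linear_forms_def mpol_subst_simps sum_distrib_left)
  also have "\<dots> = (\<Sum>k\<in>UNIV. \<Sum>j\<in>UNIV. Const (snd M $ i $ j) * (Const (snd N $ j $ k) * Var (Inr k)))"
    by (rule sum.swap)
  also have "\<dots> = linear_forms (pair_mult M N) v"
    by (simp add: Inr linear_forms_def pair_mult_def matrix_matrix_mult_def Const_sum Const_mult sum_distrib_right mult.assoc)
  finally show ?thesis .
qed

lemma lact_lact: "lact N (lact M F) = lact (pair_mult M N) F"
  by (simp add: lact_def mpol_subst_subst subst_linear_forms)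

definition diag_pair :: "('a::finite + 'b::finite \<Rightarrow> complex) \<Rightarrow> ('a, 'b) mats" where
  "diag_pair d = (diag_mat (\<lambda>i. d (Inl i)), diag_mat (\<lambda>j. d (Inr j)))"

lemma sum_Const_delta:
  "(\<Sum>j\<in>UNIV. Const (if i = j then a else 0) * Var (c j)) = Const a * Var (c (i :: 'c::finite))"
proof -
  have "Const (if i = j then a else 0) * Var (c j) = (if j = i then Const a * Var (c j) else 0)" for j
    by simp
  then show ?thesis by simp
qed

lemma linear_forms_diag: "linear_forms (diag_pair d) v = Const (d v) * Var v"
  by (cases v) (simp_all add: linear_forms_def diag_pair_def diag_mat_def sum_Const_delta)

lemma Const_power: "Const (c ^ n) = Const c ^ n"
  by (induction n) (simp_all add: Const_mult)

lemma Const_prod: "Const (prod f S) = (\<Prod>i\<in>S. Const (f i))"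
  by (induction S rule: infinite_finite_induct) (simp_all add: Const_mult)

lemma mono_eval_Const: "mono_eval (\<lambda>v. Const (d v)) I = Const (mono_eval d I)"
  by (simp add: mono_eval_def Const_power Const_prod)

lemma lookup_lact_diag:
  "lookup (lact (diag_pair d) F) I = mono_eval d I * lookup F I"
proof (induction F rule: mpol_induct)
  case (single J c)
  have "lact (diag_pair d) (single J c) = Const c * mono_eval (\<lambda>v. Const (d v) * Var v) J"
    by (simp add: lact_def mpol_subst_simps linear_forms_diag[abs_def])
  also have "\<dots> = Const c * (Const (mono_eval d J) * single J 1)"
    by (simp only: mono_eval_mult mono_eval_Const mono_eval_Var)
  also have "\<dots> = single J (c * mono_eval d J)"
    by (simp add: Const_def mult_single)
  finally show ?case by (auto simp: lookup_single when_def)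
qed (simp add: lact_def mpol_subst_simps lookup_add algebra_simps)

lemma lact_0 [simp]: "lact M 0 = 0"
  and lact_add: "lact M (F + G) = lact M F + lact M G"
  and lact_Const_mult: "lact M (Const c * F) = Const c * lact M F"
  by (simp_all add: lact_def mpol_subst_simps)

lemma diag_mat_1: "diag_mat (\<lambda>_. 1) = mat 1"
  by (simp add: diag_mat_def mat_def)

lemma lact_mat_1 [simp]: "lact (mat 1, mat 1) F = F"
proof (rule poly_mapping_eqI)
  fix I
  show "lookup (lact (mat 1, mat 1) F) I = lookup F I"
    using lookup_lact_diag[of "\<lambda>_. 1" F I] by (simp add: diag_pair_def diag_mat_1)
qed

section \<open>Bidegrees and scaling of the two blocks\<close>

definition bidegree :: "nat \<Rightarrow> nat \<Rightarrow> ('a::finite + 'b::finite) monom \<Rightarrow> bool" where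
  "bidegree k l I \<longleftrightarrow> (\<Sum>i\<in>UNIV. lookup I (Inl i)) = k \<and>
     (\<Sum>j\<in>UNIV. lookup I (Inr j)) = l"

text \<open>The index types are arbitrary and not of the form \<open>option\<close>, since Cayley's
  process knows no distinguished last coordinate.\<close>

definition bihom :: "nat \<Rightarrow> nat \<Rightarrow> ('a::finite + 'b::finite) mpol \<Rightarrow> bool" where
  "bihom k l F \<longleftrightarrow> (\<forall>I\<in>keys F. bidegree k l I)"

lemma bihom_space_eq: "F \<in> bihom_space k l \<longleftrightarrow> bihom k l F"
  by (simp add: bihom_space_def bihom_def bidegree_def)

lemma bihom_0 [simp]: "bihom k l 0"
  by (simp add: bihom_def)

lemma bihom_add: "bihom k l F \<Longrightarrow> bihom k l G \<Longrightarrow> bihom k l (F + G)"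
  unfolding bihom_def using Poly_Mapping.keys_add[of F G] by blast

lemma bihom_sum: "(\<And>i. i \<in> S \<Longrightarrow> bihom k l (f i)) \<Longrightarrow> bihom k l (sum f S)"
  by (induction S rule: infinite_finite_induct) (simp_all add: bihom_add)

lemma bihom_single: "c = 0 \<or> bidegree k l I \<Longrightarrow> bihom k l (single I c)"
  by (auto simp: bihom_def)

lemma bidegree_add: "bidegree k l I \<Longrightarrow> bidegree k' l' J \<Longrightarrow> bidegree (k + k') (l + l') (I + J)"
  by (simp add: bidegree_def lookup_add sum.distrib)

lemma bihom_mult: "bihom k l F \<Longrightarrow> bihom k' l' G \<Longrightarrow> bihom (k + k') (l + l') (F * G)"
  unfolding bihom_def using Poly_Mapping.keys_mult[of F G] bidegree_add by blast

lemma bihom_Const: "bihom 0 0 (Const c)"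
  unfolding Const_def by (rule bihom_single) (simp add: bidegree_def)

lemma bihom_Const_mult: "bihom k l F \<Longrightarrow> bihom k l (Const c * F)"
  using bihom_mult[OF bihom_Const] by fastforce

lemma bihom_1: "bihom 0 0 1"
  using bihom_Const[of 1] by simp

lemma bihom_power: "bihom k l F \<Longrightarrow> bihom (n * k) (n * l) (F ^ n)"
  by (induction n) (simp_all add: bihom_1 bihom_mult)

lemma bihom_prod:
  "(\<And>i. i \<in> S \<Longrightarrow> bihom (k i) (l i) (f i)) \<Longrightarrow> bihom (sum k S) (sum l S) (prod f S)"
  by (induction S rule: infinite_finite_induct) (simp_all add: bihom_1 bihom_mult)

lemma bidegree_Inl: "bidegree 1 0 (single (Inl i) 1)"
  and bidegree_Inr: "bidegree 0 1 (single (Inr j) 1)"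
  by (simp_all add: bidegree_def lookup_single when_def)

lemma bihom_linear_forms: "bihom (case v of Inl _ \<Rightarrow> 1 | Inr _ \<Rightarrow> 0) (case v of Inl _ \<Rightarrow> 0 | Inr _ \<Rightarrow> 1) (linear_forms M v)"
proof (cases v)
  case (Inl i)
  have "bihom 1 0 (\<Sum>j\<in>UNIV. Const (fst M $ i $ j) * Var (Inl j))"
    unfolding Var_def by (intro bihom_sum bihom_Const_mult bihom_single disjI2 bidegree_Inl)
  then show ?thesis by (simp add: linear_forms_def Inl)
next
  case (Inr i)
  have "bihom 0 1 (\<Sum>j\<in>UNIV. Const (snd M $ i $ j) * Var (Inr j))"
    unfolding Var_def by (intro bihom_sum bihom_Const_mult bihom_single disjI2 bidegree_Inr)
  then show ?thesis by (simp add: linear_forms_def Inr)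
qed

lemma bihom_mono_linear_forms:
  assumes "bidegree k l I"
  shows "bihom k l (mono_eval (linear_forms M) I)"
proof -
  have "bihom (\<Sum>v\<in>UNIV. lookup I v * (case v of Inl _ \<Rightarrow> 1 | Inr _ \<Rightarrow> 0))
      (\<Sum>v\<in>UNIV. lookup I v * (case v of Inl _ \<Rightarrow> 0 | Inr _ \<Rightarrow> 1)) (mono_eval (linear_forms M) I)"
    unfolding mono_eval_UNIV by (intro bihom_prod bihom_power bihom_linear_forms)
  then show ?thesis using assms by (simp add: sum_UNIV_sum bidegree_def)
qed

lemma mpol_subst_alt:
  "mpol_subst \<sigma> P = (\<Sum>I\<in>keys P. Const (lookup P I) * mono_eval \<sigma> I)"
  by (simp add: mpol_subst_def mono_eval_def)

lemma bihom_lact: "bihom k l F \<Longrightarrow> bihom k l (lact M F)"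
  unfolding lact_def mpol_subst_alt
  by (intro bihom_sum bihom_Const_mult bihom_mono_linear_forms) (simp add: bihom_def)

lemma mono_eval_bidegree:
  assumes "bidegree k l I"
  shows "mono_eval (\<lambda>v. case v of Inl _ \<Rightarrow> s | Inr _ \<Rightarrow> t) I = s ^ k * t ^ l"
  using assms by (simp add: mono_eval_UNIV prod_UNIV_sum bidegree_def flip: power_sum)

definition scale_pair :: "complex \<Rightarrow> complex \<Rightarrow> ('a::finite, 'b::finite) mats \<Rightarrow> ('a, 'b) mats" where
  "scale_pair s t M = ((\<chi> i j. s * fst M $ i $ j), (\<chi> i j. t * snd M $ i $ j))"

lemma diag_mat_const_mult: "diag_mat (\<lambda>_. s) ** A = (\<chi> i j. s * A $ i $ j)"
proof -
  have "(if i = k then s else 0) * A $ k $ j = (if k = i then s * A $ k $ j else 0)" for i j k by simp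
  then show ?thesis by (simp add: vec_eq_iff matrix_matrix_mult_def diag_mat_def)
qed

text \<open>Pairs of scalar matrices act on a given bidegree by scalars. This links matrices of
  determinant one with arbitrary invertible ones.\<close>

lemma lact_scale_pair:
  assumes "bihom k l F"
  shows "lact (scale_pair s t M) F = Const (s ^ k * t ^ l) * lact M F"
proof -
  let ?d = "\<lambda>v. case v of Inl _ \<Rightarrow> s | Inr _ \<Rightarrow> t"
  have "scale_pair s t M = pair_mult (diag_pair ?d) M"
    by (simp add: scale_pair_def pair_mult_def diag_pair_def diag_mat_const_mult)
  then have "lact (scale_pair s t M) F = lact M (lact (diag_pair ?d) F)" by (simp add: lact_lact)
  also have "lact (diag_pair ?d) F = Const (s ^ k * t ^ l) * F"
  proof (rule poly_mapping_eqI)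
    fix I
    show "lookup (lact (diag_pair ?d) F) I = lookup (Const (s ^ k * t ^ l) * F) I"
    proof (cases "I \<in> keys F")
      case True
      then show ?thesis using assms
        by (simp add: lookup_lact_diag lookup_Const_mult bihom_def mono_eval_bidegree)
    next
      case False
      then show ?thesis by (simp add: lookup_lact_diag lookup_Const_mult in_keys_iff)
    qed
  qed
  finally show ?thesis by (simp add: lact_Const_mult)
qed

lemma finite_bidegree: "finite {I :: ('a::finite + 'b::finite) monom. bidegree k l I}"
proof -
  have "lookup I v \<le> k + l" if "bidegree k l I" for I :: "('a + 'b) monom" and v
  proof -
    have "lookup I v \<le> (\<Sum>v\<in>UNIV. lookup I v)"
      by (rule member_le_sum) auto
    then show ?thesis using that by (simp add: sum_UNIV_sum bidegree_def)
  qed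
  then have "lookup ` {I :: ('a + 'b) monom. bidegree k l I} \<subseteq> PiE UNIV (\<lambda>_. {..k + l})"
    by (auto simp: PiE_def extensional_def)
  moreover have "finite (PiE (UNIV :: ('a + 'b) set) (\<lambda>_. {..k + l}))" by (intro finite_PiE) auto
  ultimately have "finite (lookup ` {I :: ('a + 'b) monom. bidegree k l I})"
    by (rule finite_subset)
  then show ?thesis by (rule finite_imageD) (simp add: inj_on_def lookup_inject)
qed

section \<open>Families of polynomials with coefficients in a function algebra\<close>

context function_algebra
begin

definition B_mpol :: "('x \<Rightarrow> 'v mpol) \<Rightarrow> bool" where
  "B_mpol P \<longleftrightarrow> (\<forall>I. (\<lambda>p. lookup (P p) I) \<in> B)"

lemma B_mpol_const: "B_mpol (\<lambda>_. P)"
  by (simp add: B_mpol_def)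

lemma B_mpol_Const: "b \<in> B \<Longrightarrow> B_mpol (\<lambda>p. Const (b p) :: 'v mpol)"
proof -
  assume b: "b \<in> B"
  have "(\<lambda>p. lookup (Const (b p)) I) \<in> B" for I :: "'v monom"
    by (cases "I = 0") (simp_all add: Const_def lookup_single when_def b)
  then show ?thesis by (simp add: B_mpol_def)
qed

lemma B_mpol_add: "B_mpol P \<Longrightarrow> B_mpol Q \<Longrightarrow> B_mpol (\<lambda>p. P p + Q p)"
  by (simp add: B_mpol_def lookup_add B_add)

lemma B_mpol_mult: "B_mpol P \<Longrightarrow> B_mpol Q \<Longrightarrow> B_mpol (\<lambda>p. P p * Q p)"
  by (simp add: B_mpol_def lookup_mult_mpol case_prod_unfold B_sum B_mult)

lemma B_mpol_sum: "(\<And>i. i \<in> S \<Longrightarrow> B_mpol (f i)) \<Longrightarrow> B_mpol (\<lambda>p. \<Sum>i\<in>S. f i p)"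
  by (induction S rule: infinite_finite_induct) (simp_all add: B_mpol_const B_mpol_add)

lemma B_mpol_prod: "(\<And>i. i \<in> S \<Longrightarrow> B_mpol (f i)) \<Longrightarrow> B_mpol (\<lambda>p. \<Prod>i\<in>S. f i p)"
  by (induction S rule: infinite_finite_induct) (simp_all add: B_mpol_const B_mpol_mult)

lemma B_mpol_power: "B_mpol P \<Longrightarrow> B_mpol (\<lambda>p. P p ^ n)"
  by (induction n) (simp_all add: B_mpol_const B_mpol_mult)

text \<open>The support of \<open>F p\<close> varies with \<open>p\<close>, so the substitution is
  rewritten as a sum over the fixed finite set of all monomials of bidegree (k, l).\<close>

lemma B_mpol_lact:
  fixes M :: "'x \<Rightarrow> ('a::finite, 'b::finite) mats"
  assumes "B_mat (\<lambda>p. fst (M p))" "B_mat (\<lambda>p. snd (M p))" "B_mpol F" "\<And>p. bihom k l (F p)"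
  shows "B_mpol (\<lambda>p. lact (M p) (F p))"
proof -
  have linear_forms: "B_mpol (\<lambda>p. linear_forms (M p) v)" for v
  proof (cases v)
    case (Inl i)
    have "B_mpol (\<lambda>p. \<Sum>j\<in>UNIV. Const (fst (M p) $ i $ j) * Var (Inl j))"
      by (intro B_mpol_sum B_mpol_mult B_mpol_Const B_mpol_const) (use assms(1) in \<open>simp add: B_mat_def\<close>)
    then show ?thesis by (simp add: linear_forms_def Inl)
  next
    case (Inr i)
    have "B_mpol (\<lambda>p. \<Sum>j\<in>UNIV. Const (snd (M p) $ i $ j) * Var (Inr j))"
      by (intro B_mpol_sum B_mpol_mult B_mpol_Const B_mpol_const) (use assms(2) in \<open>simp add: B_mat_def\<close>)
    then show ?thesis by (simp add: linear_forms_def Inr)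
  qed
  have "lact (M p) (F p) =
      (\<Sum>I\<in>{I. bidegree k l I}. Const (lookup (F p) I) * (\<Prod>v\<in>UNIV. linear_forms (M p) v ^ lookup I v))"
    for p
    unfolding lact_def mpol_subst_eq mono_eval_UNIV[symmetric]
    by (rule sb.peval_superset) (use assms(4)[of p] finite_bidegree in \<open>auto simp: bihom_def\<close>)
  moreover have "B_mpol (\<lambda>p. \<Sum>I\<in>{I. bidegree k l I}. Const (lookup (F p) I) *
      (\<Prod>v\<in>UNIV. linear_forms (M p) v ^ lookup I v))"
    by (intro B_mpol_sum B_mpol_mult B_mpol_Const B_mpol_prod B_mpol_power linear_forms)
       (use assms(3) in \<open>simp add: B_mpol_def\<close>)
  ultimately show ?thesis by simp
qed

end

section \<open>Integer weights and the decomposition of a matrix pair\<close>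

text \<open>Simultaneous Diophantine approximation of the weights: the integrality of the constraints turns small errors into zero.\<close>

lemma integer_weights:
  fixes u :: "'a \<Rightarrow> real" and c :: "'j \<Rightarrow> 'a \<Rightarrow> int" and r :: "'j \<Rightarrow> int"
  assumes "finite S" "finite JJ" "\<And>a. a \<in> S \<Longrightarrow> u a \<ge> 0"
    and eq: "\<And>j. j \<in> JJ \<Longrightarrow> (\<Sum>a\<in>S. u a * of_int (c j a)) = of_int (r j)"
  obtains N :: nat and n :: "'a \<Rightarrow> nat"
  where "N > 0" "\<And>j. j \<in> JJ \<Longrightarrow> (\<Sum>a\<in>S. int (n a) * c j a) = int N * r j"
proof -
  obtain h where h: "bij_betw h {..<card S} S"
    using ex_bij_betw_nat_finite[OF assms(1)] atLeast0LessThan by metis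
  \<comment> \<open>Errors below 1/K, weighted by the coefficients of any one constraint, add up to
    less than 1; the summand 1 makes this strict and keeps \<open>K\<close> positive.\<close>
  define K where "K = 1 + (\<Sum>j\<in>JJ. \<Sum>a\<in>S. nat \<bar>c j a\<bar>)"
  have "K > 0" by (simp add: K_def)
  then obtain q p where q: "0 < q" "\<And>i. i < card S \<Longrightarrow> \<bar>of_int q * u (h i) - of_int (p i)\<bar> < 1 / real K"
    using Dirichlet_approx_simult[of K "card S" "\<lambda>i. u (h i)"] by metis
  define m where "m a = p (inv_into {..<card S} h a)" for a
  have m: "\<bar>of_int q * u a - of_int (m a)\<bar> < 1 / real K" if "a \<in> S" for a
    using q(2)[of "inv_into {..<card S} h a"] that h bij_betw_inv_into_right[OF h that]
      bij_betwE[OF bij_betw_inv_into[OF h]] by (auto simp: m_def)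
  \<comment> \<open>\<open>m a\<close> is an integer greater than -1, so it can be read as a natural
    number.\<close>
  have m0: "m a \<ge> 0" if "a \<in> S" for a
  proof -
    have "1 / real K \<le> 1" using \<open>K > 0\<close> by simp
    moreover have "of_int q * u a \<ge> 0" using q(1) assms(3)[OF that] by simp
    ultimately have "real_of_int (m a) > -1" using m[OF that] by linarith
    then show ?thesis by simp
  qed
  have "(\<Sum>a\<in>S. m a * c j a) = q * r j" if j: "j \<in> JJ" for j
  proof -
    have "real_of_int (q * r j) = of_int q * (\<Sum>a\<in>S. u a * of_int (c j a))" by (simp add: eq[OF j])
    then have "real_of_int (q * r j - (\<Sum>a\<in>S. m a * c j a)) =
        (\<Sum>a\<in>S. (of_int q * u a - of_int (m a)) * of_int (c j a))"
      by (simp add: sum_distrib_left sum_subtractf algebra_simps)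
    also have "\<bar>\<dots>\<bar> \<le> (\<Sum>a\<in>S. \<bar>(of_int q * u a - of_int (m a)) * of_int (c j a)\<bar>)" by (rule sum_abs)
    also have "\<dots> \<le> (\<Sum>a\<in>S. 1 / real K * real (nat \<bar>c j a\<bar>))"
    proof (rule sum_mono)
      fix a assume "a \<in> S"
      then have "\<bar>of_int q * u a - of_int (m a)\<bar> \<le> 1 / real K" using m by (simp add: less_imp_le)
      then show "\<bar>(of_int q * u a - of_int (m a)) * of_int (c j a)\<bar> \<le> 1 / real K * real (nat \<bar>c j a\<bar>)"
        unfolding abs_mult by (intro mult_mono) auto
    qed
    also have "\<dots> = real (\<Sum>a\<in>S. nat \<bar>c j a\<bar>) / real K" by (simp add: sum_divide_distrib)
    also have "\<dots> < 1"
    proof -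
      have "(\<Sum>a\<in>S. nat \<bar>c j a\<bar>) \<le> (\<Sum>j\<in>JJ. \<Sum>a\<in>S. nat \<bar>c j a\<bar>)"
        by (rule member_le_sum[OF j _ assms(2), of "\<lambda>j. \<Sum>a\<in>S. nat \<bar>c j a\<bar>"]) simp
      then have "(\<Sum>a\<in>S. nat \<bar>c j a\<bar>) < K" by (simp add: K_def)
      then show ?thesis using \<open>K > 0\<close> by (simp only: of_nat_less_iff divide_less_eq_1_pos of_nat_0_less_iff)
    qed
    finally have "\<bar>q * r j - (\<Sum>a\<in>S. m a * c j a)\<bar> < 1" by linarith
    then show ?thesis by simp
  qed
  then show thesis using that[of "nat q" "\<lambda>a. nat (m a)"] q(1) m0 by simp
qed

section \<open>Barycentric weights of a point of the polytope\<close>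

lemma sum_UNIV_option: "(\<Sum>i\<in>(UNIV :: 'a::finite option set). f i) = f None + (\<Sum>i\<in>UNIV. f (Some i))"
  by (simp add: UNIV_option_conv sum.reindex)

definition full_xi :: "('m::finite option + 'n::finite option \<Rightarrow> real) \<Rightarrow> real^('m + 'n)" where
  "full_xi q = (\<chi> v. case v of Inl i \<Rightarrow> q (Inl (Some i)) | Inr j \<Rightarrow> q (Inr (Some j)))"

text \<open>The polytope sees all but the last coordinate of each block. As the exponents of
  \<open>F\<close> and the target \<open>q\<close> have equal block sums, the two last coordinates
  match automatically; for the same reason \<open>xi\<close> is injective on the support.\<close>

lemma Conv_weights:
  fixes F :: "('m::finite, 'n::finite) var mpol"
  assumes "bihom k l F" "full_xi q \<in> Conv F"
    "(\<Sum>i\<in>UNIV. q (Inl i)) = real k" "(\<Sum>j\<in>UNIV. q (Inr j)) = real l"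
  obtains u where "\<And>I. I \<in> keys F \<Longrightarrow> u I \<ge> 0" "sum u (keys F) = 1"
    "\<And>v. (\<Sum>I\<in>keys F. u I * real (lookup I v)) = q v"
proof -
  let ?S = "keys F"
  have bid: "bidegree k l I" if "I \<in> ?S" for I using assms(1) that by (simp add: bihom_def)
  have inj: "inj_on xi ?S"
  proof (rule inj_onI)
    fix I J assume IJ: "I \<in> ?S" "J \<in> ?S" "xi I = xi J"
    have a: "lookup I (Inl (Some i)) = lookup J (Inl (Some i))" for i
      using arg_cong[OF IJ(3), of "\<lambda>x. x $ Inl i"] by (simp add: xi_def)
    have b: "lookup I (Inr (Some i)) = lookup J (Inr (Some i))" for i
      using arg_cong[OF IJ(3), of "\<lambda>x. x $ Inr i"] by (simp add: xi_def)
    have "lookup I v = lookup J v" for v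
      using bid[OF IJ(1)] bid[OF IJ(2)] a b
      by (cases v; cases "projl v"; cases "projr v") (auto simp: bidegree_def sum_UNIV_option)
    then show "I = J" by (rule poly_mapping_eqI)
  qed
  have "full_xi q \<in> convex hull (xi ` ?S)" using assms(2) by (simp add: Conv_def)
  then obtain w where w: "\<forall>x\<in>xi ` ?S. 0 \<le> w x" "sum w (xi ` ?S) = 1" "(\<Sum>x\<in>xi ` ?S. w x *\<^sub>R x) = full_xi q"
    unfolding convex_hull_finite[OF finite_imageI[OF finite_keys]] by blast
  define u where "u = (\<lambda>I. w (xi I))"
  have u0: "\<And>I. I \<in> ?S \<Longrightarrow> u I \<ge> 0" and u1: "sum u ?S = 1" and us: "(\<Sum>I\<in>?S. u I *\<^sub>R xi I) = full_xi q"
    using w inj by (auto simp: u_def sum.reindex)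
  have A: "(\<Sum>I\<in>?S. u I * real (lookup I (Inl (Some i)))) = q (Inl (Some i))" for i
    using arg_cong[OF us, of "\<lambda>x. x $ Inl i"] by (simp add: xi_def full_xi_def)
  have B: "(\<Sum>I\<in>?S. u I * real (lookup I (Inr (Some i)))) = q (Inr (Some i))" for i
    using arg_cong[OF us, of "\<lambda>x. x $ Inr i"] by (simp add: xi_def full_xi_def)
  have "(\<Sum>i\<in>UNIV. \<Sum>I\<in>?S. u I * real (lookup I (Inl i))) = (\<Sum>I\<in>?S. u I * real k)"
    by (subst sum.swap) (use bid in \<open>auto simp: bidegree_def simp flip: sum_distrib_left of_nat_sum intro!: sum.cong\<close>)
  then have C: "(\<Sum>I\<in>?S. u I * real (lookup I (Inl None))) = q (Inl None)"
    using assms(3) u1 A by (simp add: sum_UNIV_option flip: sum_distrib_right)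
  have "(\<Sum>i\<in>UNIV. \<Sum>I\<in>?S. u I * real (lookup I (Inr i))) = (\<Sum>I\<in>?S. u I * real l)"
    by (subst sum.swap) (use bid in \<open>auto simp: bidegree_def simp flip: sum_distrib_left of_nat_sum intro!: sum.cong\<close>)
  then have D: "(\<Sum>I\<in>?S. u I * real (lookup I (Inr None))) = q (Inr None)"
    using assms(4) u1 B by (simp add: sum_UNIV_option flip: sum_distrib_right)
  have V: "(\<Sum>I\<in>?S. u I * real (lookup I v)) = q v" for v
  proof (cases v)
    case (Inl i) then show ?thesis using A C by (cases i) auto
  next
    case (Inr i) then show ?thesis using B D by (cases i) auto
  qed
  show thesis by (rule that[OF u0 u1 V])
qed

lemma Conv_integer_weights:
  fixes F :: "('m::finite, 'n::finite) var mpol"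
  assumes "bihom k l F" "full_xi q \<in> Conv F"
    "(\<Sum>i\<in>UNIV. q (Inl i)) = real k" "(\<Sum>j\<in>UNIV. q (Inr j)) = real l"
    and T: "T > 0" "\<And>v. real T * q v = of_int (r v)"
  obtains N :: nat and n :: "('m, 'n) var monom \<Rightarrow> nat" where "N > 0" "sum n (keys F) = N"
    "\<And>v. int (\<Sum>I\<in>keys F. T * n I * lookup I v) = int N * r v"
proof -
  let ?S = "keys F"
  obtain u where u: "\<And>I. I \<in> ?S \<Longrightarrow> u I \<ge> 0" "sum u ?S = 1"
    "\<And>v. (\<Sum>I\<in>?S. u I * real (lookup I v)) = q v"
    by (rule Conv_weights[OF assms(1-4)]) (rule that)
  \<comment> \<open>The constraint indexed by \<open>None\<close> says that the weights sum to 1.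
    The others, one per variable, prescribe the coordinates of \<open>q\<close>, with
    \<open>T\<close> as a common denominator.\<close>
  let ?c = "\<lambda>j I. case j of None \<Rightarrow> 1 | Some v \<Rightarrow> int (T * lookup I v)"
  let ?r = "\<lambda>j. case j of None \<Rightarrow> 1 | Some v \<Rightarrow> r v"
  have eq: "(\<Sum>I\<in>?S. u I * of_int (?c j I)) = of_int (?r j)" for j
  proof (cases j)
    case (Some v)
    then have "(\<Sum>I\<in>?S. u I * of_int (?c j I)) = real T * (\<Sum>I\<in>?S. u I * real (lookup I v))"
      by (simp add: sum_distrib_left mult_ac)
    then show ?thesis using Some by (simp add: u T)
  qed (simp add: u)
  obtain N n where n: "N > 0" "\<And>j. (\<Sum>I\<in>?S. int (n I) * ?c j I) = int N * ?r j"
    by (rule integer_weights[of ?S "UNIV :: ('m, 'n) var option set" u ?c ?r, OF finite_keys finite u(1) eq])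
       (assumption, rule that, simp_all)
  have s: "sum n ?S = N" using n(2)[of None] by (simp flip: of_nat_sum)
  have V: "int (\<Sum>I\<in>?S. T * n I * lookup I v) = int N * r v" for v
    using n(2)[of "Some v"] by (simp add: mult_ac)
  show thesis by (rule that[OF n(1) s V])
qed

lemma det_diag_mat: "det (diag_mat d) = (\<Prod>i\<in>UNIV. d i)"
  by (subst det_diagonal) (simp_all add: diag_mat_def)

lemma left_inverse_of_right_inverse: "A ** B = mat 1 \<Longrightarrow> B ** A = mat 1" for A :: "complex^'n^'n"
  by (simp add: matrix_left_right_inverse)

section \<open>Factorisation of a family of matrix pairs\<close>

context place
begin

definition is_unit_fun :: "('x \<Rightarrow> complex) \<Rightarrow> bool" where
  "is_unit_fun x \<longleftrightarrow> integral x \<and> (\<exists>y. integral y \<and> eventually (\<lambda>p. x p * y p = 1) near)"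

lemma is_unit_fun_cong:
  assumes "is_unit_fun x" "eventually (\<lambda>p. x p = x' p) near" shows "is_unit_fun x'"
proof -
  obtain y where y: "integral y" "eventually (\<lambda>p. x p * y p = 1) near"
    using assms(1) by (auto simp: is_unit_fun_def)
  have "eventually (\<lambda>p. x' p * y p = 1) near" using y(2) assms(2) by eventually_elim simp
  then show ?thesis unfolding is_unit_fun_def using integral_cong[OF _ assms(2)] assms(1) y(1)
    by (intro conjI exI[of _ y]) (simp_all add: is_unit_fun_def)
qed

lemma is_unit_fun_mult:
  assumes "is_unit_fun x" "is_unit_fun x'" shows "is_unit_fun (\<lambda>p. x p * x' p)"
proof -
  obtain y y' where y: "integral y" "eventually (\<lambda>p. x p * y p = 1) near"
    "integral y'" "eventually (\<lambda>p. x' p * y' p = 1) near"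
    using assms by (auto simp: is_unit_fun_def)
  have "eventually (\<lambda>p. (x p * x' p) * (y p * y' p) = 1) near" using y(2,4)
  proof eventually_elim
    case (elim p)
    have "(x p * x' p) * (y p * y' p) = (x p * y p) * (x' p * y' p)" by (simp only: mult_ac)
    with elim show ?case by simp
  qed
  moreover have "integral x" "integral x'" using assms by (simp_all add: is_unit_fun_def)
  ultimately show ?thesis unfolding is_unit_fun_def using integral_mult[OF y(1,3)] integral_mult[of x x']
    by (intro conjI exI[of _ "\<lambda>p. y p * y' p"]) simp_all
qed

lemma is_unit_fun_power: "is_unit_fun x \<Longrightarrow> is_unit_fun (\<lambda>p. x p ^ n)"
proof (induction n)
  case 0
  then show ?case unfolding is_unit_fun_def
    by (intro conjI exI[of _ "\<lambda>_. 1"]) (simp_all add: integral_const)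
next
  case (Suc n)
  then show ?case using is_unit_fun_mult[of x "\<lambda>p. x p ^ n"] by simp
qed

lemma B_det: "B_mat M \<Longrightarrow> (\<lambda>p. det (M p)) \<in> B"
  unfolding det_def by (intro B_sum B_mult B_const B_prod) (simp add: B_mat_def)

lemma B_GL_det: "B_GL h \<Longrightarrow> is_unit_fun (\<lambda>p. det (h p))"
proof -
  assume "B_GL h"
  then obtain h' where h: "B_mat h" "B_mat h'" "eventually (\<lambda>p. h p ** h' p = mat 1) near"
    by (auto simp: B_GL_def)
  have "eventually (\<lambda>p. det (h p) * det (h' p) = 1) near"
    using h(3) by eventually_elim (metis det_mul det_I)
  then show ?thesis unfolding is_unit_fun_def
    by (intro conjI exI[of _ "\<lambda>p. det (h' p)"] B_integral B_det h)
qed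

text \<open>The Smith form solved for \<open>g\<close>: \<open>H\<close> and \<open>K\<close> are
  inverses of the Smith factors, and \<open>K'\<close> is a Smith factor itself. As \<open>g\<close>
  has determinant one, the determinant of the diagonal part is the product of the determinants of
  the Smith factors, hence a unit.\<close>

lemma decomposition_one:
  fixes g :: "'x \<Rightarrow> complex^'n^'n"
  assumes "eventually (\<lambda>p. det (g p) = 1) near"
  obtains H K K' :: "'x \<Rightarrow> complex^'n^'n" and d where "B_mat H" "B_mat K" "B_mat K'" "invertible (H z)"
    "eventually (\<lambda>p. g p = H p ** diag_mat (d p) ** K p) near"
    "eventually (\<lambda>p. K p ** K' p = mat 1) near" "is_unit_fun (\<lambda>p. \<Prod>i\<in>UNIV. d p i)"
proof -
  obtain h k d where hk: "B_GL h" "B_GL k" "eventually (\<lambda>p. h p ** g p ** k p = diag_mat (d p)) near"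
    by (rule smith_form)
  obtain h' where h': "B_mat h" "B_mat h'" "eventually (\<lambda>p. h p ** h' p = mat 1) near"
    using hk(1) by (auto simp: B_GL_def)
  obtain k' where k': "B_mat k" "B_mat k'" "eventually (\<lambda>p. k p ** k' p = mat 1) near"
    using hk(2) by (auto simp: B_GL_def)
  have "eventually (\<lambda>p. det (h p) * det (k p) = (\<Prod>i\<in>UNIV. d p i)) near"
    using hk(3) assms
  proof eventually_elim
    case (elim p)
    have "det (h p ** g p ** k p) = det (h p) * det (k p)" using elim(2) by (simp add: det_mul)
    then show ?case using elim(1) by (simp add: det_diag_mat)
  qed
  with is_unit_fun_mult[OF B_GL_det[OF hk(1)] B_GL_det[OF hk(2)]]
  have u: "is_unit_fun (\<lambda>p. \<Prod>i\<in>UNIV. d p i)" by (rule is_unit_fun_cong)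
  have "h z ** h' z = mat 1"
    by (rule B_mat_near_eq[OF B_mat_mult[OF h'(1,2)] B_mat_const h'(3)])
  then have inv: "invertible (h' z)" unfolding invertible_def using left_inverse_of_right_inverse by blast
  have kk: "eventually (\<lambda>p. k' p ** k p = mat 1) near"
    using k'(3) by eventually_elim (rule left_inverse_of_right_inverse)
  have g: "eventually (\<lambda>p. g p = h' p ** diag_mat (d p) ** k' p) near"
    using hk(3) h'(3) k'(3)
  proof eventually_elim
    case (elim p)
    have "h' p ** diag_mat (d p) ** k' p = (h' p ** h p) ** g p ** (k p ** k' p)"
      by (simp add: elim(1)[symmetric] matrix_mul_assoc)
    then show ?case using elim(3) left_inverse_of_right_inverse[OF elim(2)] by simp
  qed
  show thesis by (rule that[OF h'(2) k'(2,1) inv g kk u])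
qed

text \<open>Every coefficient has its own representative in \<open>B\<close>. Only finitely many
  monomials have bidegree (k, l), so all representatives are valid on a common
  neighbourhood.\<close>

lemma integral_mpol:
  fixes G :: "'x \<Rightarrow> ('a::finite + 'b::finite) mpol"
  assumes "\<And>I. integral (\<lambda>p. lookup (G p) I)" "\<And>p. bihom k l (G p)"
  obtains G' where "B_mpol G'" "\<And>p. bihom k l (G' p)" "eventually (\<lambda>p. G p = G' p) near"
    "(\<forall>I. infinitesimal (\<lambda>p. lookup (G p) I)) \<longrightarrow> G' z = 0"
proof -
  have "\<forall>I. \<exists>b. b \<in> B \<and> eventually (\<lambda>p. lookup (G p) I = b p) near"
    using assms(1) by (auto simp: integral_def)
  then have "\<exists>b. \<forall>I. b I \<in> B \<and> eventually (\<lambda>p. lookup (G p) I = b I p) near" by (rule choice)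
  then obtain b where b: "\<forall>I. b I \<in> B \<and> eventually (\<lambda>p. lookup (G p) I = b I p) near" ..
  define G' where "G' = (\<lambda>p. \<Sum>I\<in>{I. bidegree k l I}. single I (b I p))"
  have lk: "lookup (G' p) I = (if bidegree k l I then b I p else 0)" for p I
    using finite_bidegree[of k l, where 'a = 'a and 'b = 'b] by (simp add: G'_def lookup_sum lookup_single when_def sum.delta)
  have "(\<lambda>p. lookup (G' p) I) \<in> B" for I
    by (cases "bidegree k l I") (simp_all add: lk b)
  then have 1: "B_mpol G'" by (simp add: B_mpol_def)
  have 2: "bihom k l (G' p)" for p
    by (auto simp: bihom_def in_keys_iff lk split: if_splits)
  have "eventually (\<lambda>p. \<forall>I\<in>{I. bidegree k l I}. lookup (G p) I = b I p) near"
    by (rule eventually_ball_finite[OF finite_bidegree]) (use b in simp)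
  then have 3: "eventually (\<lambda>p. G p = G' p) near"
  proof eventually_elim
    case (elim p)
    show ?case
    proof (rule poly_mapping_eqI)
      fix I show "lookup (G p) I = lookup (G' p) I"
        using elim assms(2)[of p] by (auto simp: lk bihom_def in_keys_iff)
    qed
  qed
  have 4: "(\<forall>I. infinitesimal (\<lambda>p. lookup (G p) I)) \<longrightarrow> G' z = 0"
  proof (intro impI poly_mapping_eqI)
    fix I assume inf: "\<forall>I. infinitesimal (\<lambda>p. lookup (G p) I)"
    obtain c where c: "c \<in> B" "c z = 0" "eventually (\<lambda>p. lookup (G p) I = c p) near"
      using inf by (auto simp: infinitesimal_def)
    from b have bI: "b I \<in> B" "eventually (\<lambda>p. lookup (G p) I = b I p) near" by auto
    have "eventually (\<lambda>p. b I p = c p) near" using bI(2) c(3) by eventually_elim simp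
    then have "b I z = c z" by (rule B_near_eq[OF bI(1) c(1)])
    then show "lookup (G' z) I = lookup 0 I" using c(2) by (simp add: lk)
  qed
  show thesis by (rule that[OF 1 2 3 4])
qed

text \<open>Composition is a right action, so \<open>H\<close> acts on \<open>F\<close> first, then
  \<open>D\<close>, then \<open>K\<close>. Undoing the integral \<open>K\<close> keeps the
  coefficients integral or infinitesimal; they are those of \<open>lact (H p) F\<close> multiplied
  by characters of \<open>D\<close>. For a monomial in the support of the reduction
  \<open>lact (H z) F\<close> the first factor is a unit, so the character inherits the
  property.\<close>

lemma decomposition:
  fixes g :: "'x \<Rightarrow> ('a::finite, 'b::finite) mats"
  assumes "eventually (\<lambda>p. det (fst (g p)) = 1 \<and> det (snd (g p)) = 1) near" "bihom k l F"
    and "\<And>I. integral (\<lambda>p. lookup (lact (g p) F) I)"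
  obtains H K :: "'x \<Rightarrow> ('a, 'b) mats" and D where "B_mat (\<lambda>p. fst (H p))" "B_mat (\<lambda>p. snd (H p))"
    "B_mat (\<lambda>p. fst (K p))" "B_mat (\<lambda>p. snd (K p))" "invertible (fst (H z))" "invertible (snd (H z))"
    "eventually (\<lambda>p. g p = pair_mult (pair_mult (H p) (diag_pair (D p))) (K p)) near"
    "is_unit_fun (\<lambda>p. \<Prod>i\<in>UNIV. D p (Inl i))" "is_unit_fun (\<lambda>p. \<Prod>i\<in>UNIV. D p (Inr i))"
    "\<And>I. I \<in> keys (lact (H z) F) \<Longrightarrow> integral (\<lambda>p. mono_eval (D p) I)"
    "(\<forall>I. infinitesimal (\<lambda>p. lookup (lact (g p) F) I)) \<longrightarrow>
      (\<forall>I\<in>keys (lact (H z) F). infinitesimal (\<lambda>p. mono_eval (D p) I))"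
proof -
  have "eventually (\<lambda>p. det (fst (g p)) = 1) near" using assms(1) by eventually_elim simp
  then obtain H1 K1 K1' :: "'x \<Rightarrow> complex^'a^'a" and d1 where 1: "B_mat H1" "B_mat K1" "B_mat K1'" "invertible (H1 z)"
    "eventually (\<lambda>p. fst (g p) = H1 p ** diag_mat (d1 p) ** K1 p) near"
    "eventually (\<lambda>p. K1 p ** K1' p = mat 1) near" "is_unit_fun (\<lambda>p. \<Prod>i\<in>UNIV. d1 p i)"
    by (rule decomposition_one)
  have "eventually (\<lambda>p. det (snd (g p)) = 1) near" using assms(1) by eventually_elim simp
  then obtain H2 K2 K2' :: "'x \<Rightarrow> complex^'b^'b" and d2 where 2: "B_mat H2" "B_mat K2" "B_mat K2'" "invertible (H2 z)"
    "eventually (\<lambda>p. snd (g p) = H2 p ** diag_mat (d2 p) ** K2 p) near"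
    "eventually (\<lambda>p. K2 p ** K2' p = mat 1) near" "is_unit_fun (\<lambda>p. \<Prod>i\<in>UNIV. d2 p i)"
    by (rule decomposition_one)
  define H where "H = (\<lambda>p. (H1 p, H2 p))"
  define K where "K = (\<lambda>p. (K1 p, K2 p))"
  define K' where "K' = (\<lambda>p. (K1' p, K2' p))"
  define D where "D = (\<lambda>p v. case v of Inl i \<Rightarrow> d1 p i | Inr i \<Rightarrow> d2 p i)"
  have KK': "eventually (\<lambda>p. pair_mult (K p) (K' p) = (mat 1, mat 1)) near"
    using 1(6) 2(6) by eventually_elim (simp add: K_def K'_def pair_mult_def)
  have g: "eventually (\<lambda>p. g p = pair_mult (pair_mult (H p) (diag_pair (D p))) (K p)) near"
    using 1(5) 2(5) by eventually_elim (simp add: H_def K_def D_def pair_mult_def diag_pair_def prod_eq_iff)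
  obtain G where G: "B_mpol G" "\<And>p. bihom k l (G p)" "eventually (\<lambda>p. lact (g p) F = G p) near"
    "(\<forall>I. infinitesimal (\<lambda>p. lookup (lact (g p) F) I)) \<longrightarrow> G z = 0"
    by (rule integral_mpol[of "\<lambda>p. lact (g p) F" k l, OF assms(3) bihom_lact[OF assms(2)]]) (rule that)
  have KG: "B_mpol (\<lambda>p. lact (K' p) (G p))"
    by (rule B_mpol_lact[of K' G k l]) (simp_all add: K'_def 1 2 G)
  have HF: "B_mpol (\<lambda>p. lact (H p) F)"
    by (rule B_mpol_lact[of H "\<lambda>_. F" k l]) (simp_all add: H_def 1 2 B_mpol_const assms(2))
  have eq: "eventually (\<lambda>p. lact (diag_pair (D p)) (lact (H p) F) = lact (K' p) (G p)) near"
    using G(3) g KK'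
  proof eventually_elim
    case (elim p)
    have "lact (K' p) (G p) = lact (K' p) (lact (K p) (lact (diag_pair (D p)) (lact (H p) F)))"
      by (simp add: elim(1)[symmetric] elim(2) lact_lact)
    also have "\<dots> = lact (pair_mult (K p) (K' p)) (lact (diag_pair (D p)) (lact (H p) F))"
      by (rule lact_lact)
    finally show ?case by (simp add: elim(3))
  qed
  have mono: "\<exists>c. integral c \<and> eventually (\<lambda>p. lookup (lact (K' p) (G p)) I * c p = mono_eval (D p) I) near"
    if I: "I \<in> keys (lact (H z) F)" for I
  proof (intro exI conjI)
    have f: "(\<lambda>p. lookup (lact (H p) F) I) \<in> B" "lookup (lact (H z) F) I \<noteq> 0"
      using HF I by (simp_all add: B_mpol_def in_keys_iff)
    then show "integral (\<lambda>p. inverse (lookup (lact (H p) F) I))" by (rule B_inverse)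
    have "eventually (\<lambda>p. lookup (lact (H p) F) I \<noteq> 0) near" using f by (rule near_nonzero)
    with eq show "eventually (\<lambda>p. lookup (lact (K' p) (G p)) I *
        inverse (lookup (lact (H p) F) I) = mono_eval (D p) I) near"
    proof eventually_elim
      case (elim p)
      then show ?case by (simp add: elim(1)[symmetric] lookup_lact_diag)
    qed
  qed
  have int: "integral (\<lambda>p. mono_eval (D p) I)" if I: "I \<in> keys (lact (H z) F)" for I
  proof -
    obtain c where c: "integral c" "eventually (\<lambda>p. lookup (lact (K' p) (G p)) I * c p = mono_eval (D p) I) near"
      using mono[OF I] by (elim exE conjE)
    have "integral (\<lambda>p. lookup (lact (K' p) (G p)) I)"
      by (rule B_integral) (use KG in \<open>simp add: B_mpol_def\<close>)
    from integral_cong[OF integral_mult[OF this c(1)] c(2)] show ?thesis .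
  qed
  have inf: "infinitesimal (\<lambda>p. mono_eval (D p) I)" if I: "I \<in> keys (lact (H z) F)"
    and all: "\<And>I. infinitesimal (\<lambda>p. lookup (lact (g p) F) I)" for I
  proof -
    obtain c where c: "integral c" "eventually (\<lambda>p. lookup (lact (K' p) (G p)) I * c p = mono_eval (D p) I) near"
      using mono[OF I] by (elim exE conjE)
    have "infinitesimal (\<lambda>p. lookup (lact (K' p) (G p)) I)"
      unfolding infinitesimal_def
      by (rule bexI[of _ "\<lambda>p. lookup (lact (K' p) (G p)) I"])
         (use KG in \<open>simp_all add: B_mpol_def G(4)[rule_format, OF all]\<close>)
    from infinitesimal_cong[OF infinitesimal_mult[OF this c(1)] c(2)] show ?thesis .
  qed
  show thesis
    by (rule that[of H K D]) (use 1 2 g int inf in \<open>auto simp: H_def K_def D_def\<close>)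
qed

end

section \<open>The valuative criterion\<close>

definition full_centroid :: "nat \<Rightarrow> nat \<Rightarrow> 'm::finite option + 'n::finite option \<Rightarrow> real" where
  "full_centroid k l v = (case v of Inl _ \<Rightarrow> real k / real (CARD('m) + 1) | Inr _ \<Rightarrow> real l / real (CARD('n) + 1))"

lemma centroid_eq_full_xi: "centroid k l = full_xi (full_centroid k l)"
  by (auto simp: centroid_def full_xi_def full_centroid_def vec_eq_iff split: sum.splits)

lemma sum_full_centroid:
  "(\<Sum>i\<in>UNIV. full_centroid k l (Inl i :: 'm::finite option + 'n::finite option)) = real k"
  "(\<Sum>j\<in>UNIV. full_centroid k l (Inr j :: 'm::finite option + 'n::finite option)) = real l"
  by (simp_all add: full_centroid_def card_UNIV_option)

text \<open>The product (m+1)(n+1) is a common denominator for both blocks, whence the choice of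
  \<open>T\<close> for the integral weights.\<close>

lemma full_centroid_times:
  "real ((CARD('m) + 1) * (CARD('n) + 1)) * full_centroid k l (v :: 'm::finite option + 'n::finite option) =
    real (case v of Inl _ \<Rightarrow> k * (CARD('n) + 1) | Inr _ \<Rightarrow> l * (CARD('m) + 1))"
proof -
  have h: "real (a * b) * (real c / real a) = real (c * b)" "real (b * a) * (real c / real a) = real (c * b)"
    if "a > 0" for a b c :: nat
    using that by simp_all
  show ?thesis
  proof (cases v)
    case (Inl i)
    show ?thesis unfolding full_centroid_def Inl sum.case by (rule h(1)) simp
  next
    case (Inr j)
    show ?thesis unfolding full_centroid_def Inr sum.case by (rule h(2)) simp
  qed
qed

text \<open>The displacement has entries of absolute value at most 1 before division by
  \<open>t\<close>, so its norm is at most the dimension divided by \<open>t\<close>. One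
  \<open>t\<close> serves all pairs \<open>v\<close>, \<open>w\<close>, including last coordinates,
  which the projection forgets.\<close>

lemma interior_Conv_perturb:
  fixes F :: "('m::finite, 'n::finite) var mpol"
  assumes "centroid k l \<in> interior (Conv F)"
  obtains t :: nat where "t > 0" "\<And>v w. full_xi (\<lambda>u. full_centroid k l u +
    (of_bool (u = v) - of_bool (u = w)) / real t) \<in> Conv F"
proof -
  obtain e where e: "e > 0" "ball (centroid k l) e \<subseteq> Conv F"
    using assms mem_interior by blast
  let ?C = "real CARD('m + 'n)"
  obtain t :: nat where t: "?C / e < real t" using reals_Archimedean2 by blast
  have C: "?C > 0" by (simp only: of_nat_0_less_iff zero_less_card_finite)
  then have "0 < ?C / e" using e(1) by (rule divide_pos_pos)
  then have t0: "real t > 0" using t by linarith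
  have "full_xi (\<lambda>u. full_centroid k l u + (of_bool (u = v) - of_bool (u = w)) / real t) \<in> Conv F" for v w
  proof -
    define \<delta> :: "real^('m + 'n)" where
      "\<delta> = full_xi (\<lambda>u. of_bool (u = v) - of_bool (u = w))"
    have eq: "full_xi (\<lambda>u. full_centroid k l u + (of_bool (u = v) - of_bool (u = w)) / real t) =
        centroid k l + (1 / real t) *\<^sub>R \<delta>"
      by (auto simp: centroid_eq_full_xi full_xi_def \<delta>_def vec_eq_iff split: sum.splits)
    have d: "norm \<delta> \<le> ?C"
    proof -
      have "norm \<delta> \<le> (\<Sum>i\<in>UNIV. \<bar>\<delta> $ i\<bar>)" by (rule norm_le_l1_cart)
      also have "\<dots> \<le> (\<Sum>i\<in>(UNIV :: ('m + 'n) set). 1)"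
        by (rule sum_mono) (auto simp: \<delta>_def full_xi_def split: sum.splits)
      finally show ?thesis by simp
    qed
    have "?C / real t < e"
      using t e(1) t0 by (simp add: field_simps)
    moreover have "norm \<delta> / real t \<le> ?C / real t"
      by (rule divide_right_mono[OF d]) simp
    ultimately have n: "norm \<delta> / real t < e" by linarith
    have "norm ((1 / real t) *\<^sub>R \<delta>) < e" using n t0 by simp
    then have "centroid k l + (1 / real t) *\<^sub>R \<delta> \<in> ball (centroid k l) e"
      by (simp add: dist_norm)
    with e(2) eq show ?thesis by auto
  qed
  with t0 show thesis using that by auto
qed

lemma mono_eval_weights:
  fixes D :: "'v::finite \<Rightarrow> complex"
  assumes "finite S"
  shows "(\<Prod>I\<in>S. mono_eval D I ^ n I) = (\<Prod>v\<in>UNIV. D v ^ (\<Sum>I\<in>S. n I * lookup I v))"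
proof -
  have "(\<Prod>I\<in>S. mono_eval D I ^ n I) = (\<Prod>I\<in>S. \<Prod>v\<in>UNIV. D v ^ (n I * lookup I v))"
    by (simp add: mono_eval_UNIV prod_power_distrib power_mult[symmetric] mult.commute)
  also have "\<dots> = (\<Prod>v\<in>UNIV. \<Prod>I\<in>S. D v ^ (n I * lookup I v))"
    by (rule prod.swap)
  finally show ?thesis by (simp add: power_sum)
qed

context place
begin

lemma infinitesimal_prod:
  assumes "finite S" "I0 \<in> S" "infinitesimal (f I0)" "\<And>I. I \<in> S \<Longrightarrow> integral (f I)"
  shows "infinitesimal (\<lambda>p. \<Prod>I\<in>S. f I p)"
proof -
  have "infinitesimal (\<lambda>p. f I0 p * (\<Prod>I\<in>S - {I0}. f I p))"
    by (rule infinitesimal_mult[OF assms(3)], rule integral_prod) (use assms(4) in blast)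
  then show ?thesis using assms(1,2) by (simp add: prod.remove)
qed

lemma infinitesimal_power: "infinitesimal x \<Longrightarrow> n > 0 \<Longrightarrow> infinitesimal (\<lambda>p. x p ^ n)"
  using infinitesimal_mult[of x "\<lambda>p. x p ^ (n - 1)"] integral_power[OF infinitesimal_integral]
  by (cases n) simp_all

lemma is_unit_fun_not_infinitesimal: "is_unit_fun x \<Longrightarrow> \<not> infinitesimal x"
  unfolding is_unit_fun_def using unit_not_infinitesimal by blast

text \<open>The coordinates of the centroid are equal within each block, so the weighted product of
  the characters of \<open>D\<close> consists of powers of the two determinants of \<open>D\<close>
  and is a unit. A contraction of \<open>F\<close> to 0 would make the same product
  infinitesimal.\<close>

theorem not_infinitesimal_of_centroid:
  fixes g :: "'x \<Rightarrow> ('m::finite, 'n::finite) mat_pair"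
  assumes g: "eventually (\<lambda>p. det (fst (g p)) = 1 \<and> det (snd (g p)) = 1) near" and F: "bihom k l F"
    and cen: "\<And>h. invertible (fst h) \<Longrightarrow> invertible (snd h) \<Longrightarrow> centroid k l \<in> Conv (lact h F)"
  shows "\<exists>I. \<not> infinitesimal (\<lambda>p. lookup (lact (g p) F) I)"
proof (rule ccontr)
  assume "\<nexists>I. \<not> infinitesimal (\<lambda>p. lookup (lact (g p) F) I)"
  then have inf: "\<forall>I. infinitesimal (\<lambda>p. lookup (lact (g p) F) I)" by blast
  then have int: "integral (\<lambda>p. lookup (lact (g p) F) I)" for I
    by (intro infinitesimal_integral) (rule spec)
  obtain H K :: "'x \<Rightarrow> ('m, 'n) mat_pair" and D where HKD:
    "invertible (fst (H z))" "invertible (snd (H z))"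
    "is_unit_fun (\<lambda>p. \<Prod>i\<in>UNIV. D p (Inl i))" "is_unit_fun (\<lambda>p. \<Prod>i\<in>UNIV. D p (Inr i))"
    "(\<forall>I. infinitesimal (\<lambda>p. lookup (lact (g p) F) I)) \<longrightarrow>
      (\<forall>I\<in>keys (lact (H z) F). infinitesimal (\<lambda>p. mono_eval (D p) I))"
    by (rule decomposition[OF g F int]) (rule that)
  let ?S = "keys (lact (H z) F)"
  let ?T = "(CARD('m) + 1) * (CARD('n) + 1)"
  let ?r = "\<lambda>v :: 'm option + 'n option. case v of Inl _ \<Rightarrow> int (k * (CARD('n) + 1)) | Inr _ \<Rightarrow> int (l * (CARD('m) + 1))"
  have c: "full_xi (full_centroid k l) \<in> Conv (lact (H z) F)"
    unfolding centroid_eq_full_xi[symmetric] by (rule cen[OF HKD(1,2)])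
  have r: "real ?T * full_centroid k l v = of_int (?r v)" for v :: "'m option + 'n option"
    by (simp only: full_centroid_times) (simp split: sum.split)
  obtain N n where Nn: "N > 0" "sum n ?S = N"
    "\<And>v. int (\<Sum>I\<in>?S. ?T * n I * lookup I v) = int N * ?r v"
    by (rule Conv_integer_weights[OF bihom_lact[OF F] c sum_full_centroid _ r]) (simp, rule that)
  have ex: "(\<Sum>I\<in>?S. ?T * n I * lookup I (Inl i)) = N * k * (CARD('n) + 1)"
    "(\<Sum>I\<in>?S. ?T * n I * lookup I (Inr j)) = N * l * (CARD('m) + 1)" for i j
    using Nn(3)[of "Inl i"] Nn(3)[of "Inr j"] by (simp_all only: sum.case of_nat_mult[symmetric] of_nat_eq_iff mult.assoc)
  have "(\<Prod>I\<in>?S. mono_eval (D p) I ^ (?T * n I)) =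
      (\<Prod>i\<in>UNIV. D p (Inl i)) ^ (N * k * (CARD('n) + 1)) * (\<Prod>i\<in>UNIV. D p (Inr i)) ^ (N * l * (CARD('m) + 1))" for p
    by (subst mono_eval_weights) (simp_all only: finite_keys prod_UNIV_sum ex prod_power_distrib)
  moreover have "is_unit_fun (\<lambda>p. (\<Prod>i\<in>UNIV. D p (Inl i)) ^ (N * k * (CARD('n) + 1)) *
      (\<Prod>i\<in>UNIV. D p (Inr i)) ^ (N * l * (CARD('m) + 1)))"
    by (intro is_unit_fun_mult is_unit_fun_power HKD)
  ultimately have "is_unit_fun (\<lambda>p. \<Prod>I\<in>?S. mono_eval (D p) I ^ (?T * n I))" by simp
  moreover have "infinitesimal (\<lambda>p. \<Prod>I\<in>?S. mono_eval (D p) I ^ (?T * n I))"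
  proof -
    \<comment> \<open>The weights sum to \<open>N\<close>, which is positive, so at least one
      infinitesimal factor really occurs.\<close>
    obtain I0 where I0: "I0 \<in> ?S" "n I0 > 0"
      using Nn(1,2) by (metis bot_nat_0.not_eq_extremum sum.neutral)
    have D: "infinitesimal (\<lambda>p. mono_eval (D p) I)" if "I \<in> ?S" for I
      using HKD(5) inf that by blast
    have pos: "?T * n I0 > 0" using I0(2) by simp
    show ?thesis
      by (rule infinitesimal_prod[of ?S I0 "\<lambda>I p. mono_eval (D p) I ^ (?T * n I)", OF finite_keys I0(1) infinitesimal_power[OF D[OF I0(1)] pos]])
         (intro integral_power infinitesimal_integral D)
  qed
  ultimately show False using is_unit_fun_not_infinitesimal by blast
qed

lemma integral_quotient:
  assumes "integral x" "is_unit_fun y" "n > 0" "eventually (\<lambda>p. b p \<noteq> 0) near"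
    and "eventually (\<lambda>p. x p * b p ^ n = y p * a p ^ n) near"
  shows "integral (\<lambda>p. a p / b p)"
proof (rule integral_of_power[OF _ assms(3)])
  obtain y' where y': "integral y'" "eventually (\<lambda>p. y p * y' p = 1) near"
    using assms(2) by (auto simp: is_unit_fun_def)
  have "eventually (\<lambda>p. x p * y' p = (a p / b p) ^ n) near"
    using assms(4,5) y'(2)
  proof eventually_elim
    case (elim p)
    have "x p * y' p * b p ^ n = (x p * b p ^ n) * y' p" by (simp only: mult_ac)
    also have "\<dots> = (y p * y' p) * a p ^ n" unfolding elim(2) by (simp only: mult_ac)
    finally have "x p * y' p * b p ^ n = a p ^ n" using elim(3) by simp
    then show ?case using elim(1) by (simp add: power_divide field_simps)
  qed
  then show "integral (\<lambda>p. (a p / b p) ^ n)"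
    by (rule integral_cong[OF integral_mult[OF assms(1) y'(1)]])
qed

lemma is_unit_fun_nonzero: "is_unit_fun x \<Longrightarrow> eventually (\<lambda>p. x p \<noteq> 0) near"
  unfolding is_unit_fun_def by (elim conjE exE) (erule eventually_mono, auto)

text \<open>The power of \<open>d p i\<close> whose exponent is the block size equals the product of
  all quotients of \<open>d p i\<close> by entries of the block, times the product of the
  block.\<close>

lemma integral_of_quotients:
  fixes d :: "'x \<Rightarrow> 'i::finite \<Rightarrow> complex"
  assumes "is_unit_fun (\<lambda>p. \<Prod>i\<in>UNIV. d p i)" "\<And>i j. i \<noteq> j \<Longrightarrow> integral (\<lambda>p. d p i / d p j)"
  shows "integral (\<lambda>p. d p i)"
proof (rule integral_of_power[of _ "CARD('i)"])
  have nz: "eventually (\<lambda>p. (\<Prod>i\<in>UNIV. d p i) \<noteq> 0) near" by (rule is_unit_fun_nonzero[OF assms(1)])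
  have q: "integral (\<lambda>p. d p i / d p j)" for j
  proof (cases "i = j")
    case True
    have "eventually (\<lambda>p. 1 = d p i / d p j) near" using nz by eventually_elim (simp add: True)
    then show ?thesis by (rule integral_cong[OF integral_const])
  qed (rule assms(2))
  have "integral (\<lambda>p. (\<Prod>j\<in>UNIV. d p i / d p j) * (\<Prod>j\<in>UNIV. d p j))"
    by (rule integral_mult[OF integral_prod]) (use q assms(1) in \<open>simp_all add: is_unit_fun_def\<close>)
  moreover have "eventually (\<lambda>p. (\<Prod>j\<in>UNIV. d p i / d p j) * (\<Prod>j\<in>UNIV. d p j) = d p i ^ CARD('i)) near"
    using nz by eventually_elim (simp add: prod_dividef)
  ultimately show "integral (\<lambda>p. d p i ^ CARD('i))" by (rule integral_cong)
qed simp

text \<open>The centroid displaced by 1/t from \<open>w\<close> towards \<open>v\<close> is still in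
  the polytope. Its multiplicative relation differs from that of the centroid by a power of the
  quotient of the entries of \<open>D\<close> at \<open>v\<close> and \<open>w\<close>, so this
  quotient is integral. Integral quotients within a block and a unit determinant make
  \<open>D\<close> integral, and then \<open>g\<close>.\<close>

theorem integral_of_centroid_interior:
  fixes g :: "'x \<Rightarrow> ('m::finite, 'n::finite) mat_pair"
  assumes g: "eventually (\<lambda>p. det (fst (g p)) = 1 \<and> det (snd (g p)) = 1) near" and F: "bihom k l F"
    and cen: "\<And>h. invertible (fst h) \<Longrightarrow> invertible (snd h) \<Longrightarrow> centroid k l \<in> interior (Conv (lact h F))"
    and int: "\<And>I. integral (\<lambda>p. lookup (lact (g p) F) I)"
  shows "integral (\<lambda>p. fst (g p) $ i $ i')" "integral (\<lambda>p. snd (g p) $ j $ j')"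
proof -
  obtain H K :: "'x \<Rightarrow> ('m, 'n) mat_pair" and D where HK: "B_mat (\<lambda>p. fst (H p))" "B_mat (\<lambda>p. snd (H p))"
    "B_mat (\<lambda>p. fst (K p))" "B_mat (\<lambda>p. snd (K p))" "invertible (fst (H z))" "invertible (snd (H z))"
    and dec: "eventually (\<lambda>p. g p = pair_mult (pair_mult (H p) (diag_pair (D p))) (K p)) near"
    and u: "is_unit_fun (\<lambda>p. \<Prod>i\<in>UNIV. D p (Inl i))" "is_unit_fun (\<lambda>p. \<Prod>i\<in>UNIV. D p (Inr i))"
    and mono: "\<And>I. I \<in> keys (lact (H z) F) \<Longrightarrow> integral (\<lambda>p. mono_eval (D p) I)"
    by (rule decomposition[OF g F int]) (rule that)
  let ?S = "keys (lact (H z) F)"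
  obtain t :: nat where t: "t > 0" "\<And>v w. full_xi (\<lambda>u. full_centroid k l u +
    (of_bool (u = v) - of_bool (u = w)) / real t) \<in> Conv (lact (H z) F)"
    by (rule interior_Conv_perturb[OF cen[OF HK(5,6)]]) (rule that)
  let ?T = "t * ((CARD('m) + 1) * (CARD('n) + 1))"
  let ?M = "(CARD('m) + 1) * (CARD('n) + 1)"
  let ?c = "\<lambda>v :: 'm option + 'n option. case v of Inl _ \<Rightarrow> t * k * (CARD('n) + 1) | Inr _ \<Rightarrow> t * l * (CARD('m) + 1)"
  have nz: "eventually (\<lambda>p. D p v \<noteq> 0) near" for v
    using is_unit_fun_nonzero[OF u(1)] is_unit_fun_nonzero[OF u(2)]
    by eventually_elim (cases v, auto)
  have quot: "integral (\<lambda>p. D p v / D p w)" if vw: "v \<noteq> w" "isl v = isl w" for v w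
  proof -
    let ?q = "\<lambda>u. full_centroid k l u + (of_bool (u = v) - of_bool (u = w)) / real t"
    let ?r = "\<lambda>u. int (?c u) + int ?M * (of_bool (u = v) - of_bool (u = w))"
    \<comment> \<open>\<open>v\<close> and \<open>w\<close> belong to the same block, so the block
      sums are still \<open>k\<close> and \<open>l\<close>.\<close>
    have s: "(\<Sum>i\<in>UNIV. ?q (Inl i)) = real k" "(\<Sum>i\<in>UNIV. ?q (Inr i)) = real l"
      using vw sum_full_centroid[of k l, where 'm = 'm and 'n = 'n]
      by (cases v; cases w; simp add: sum.distrib sum_divide_distrib[symmetric] sum_subtractf of_bool_def)+
    have r: "real ?T * ?q u = of_int (?r u)" for u
    proof -
      let ?d = "of_bool (u = v) - of_bool (u = w) :: real"
      have h: "(t' * M) * (f + d / t') = t' * (M * f) + M * d" if "t' \<noteq> 0" for t' M f d :: real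
        using that by (simp add: field_simps)
      have "real ?T * ?q u = real t * (real ?M * full_centroid k l u) + real ?M * ?d"
        unfolding of_nat_mult[of t] by (rule h) (use t(1) in simp)
      also have "\<dots> = real (?c u) + real ?M * ?d"
        unfolding full_centroid_times by (cases u) (simp_all only: sum.case of_nat_mult mult.assoc)
      finally show ?thesis by (simp only: of_int_add of_int_mult of_int_diff of_int_of_nat_eq of_int_of_bool)
    qed
    obtain N n where Nn: "N > 0" "sum n ?S = N"
      "\<And>u. int (\<Sum>I\<in>?S. ?T * n I * lookup I u) = int N * ?r u"
      by (rule Conv_integer_weights[OF bihom_lact[OF F] t(2) s _ r]) (use t(1) in simp, rule that)
    let ?e = "\<lambda>u. \<Sum>I\<in>?S. ?T * n I * lookup I u"
    \<comment> \<open>Exponents are natural numbers, so the negative contribution at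
      \<open>w\<close> is carried to the other side.\<close>
    have ew: "?e u + (if u = w then N * ?M else 0) = N * ?c u + (if u = v then N * ?M else 0)" for u
      using Nn(3)[of u] vw(1) by (simp only: of_nat_eq_iff[where 'a = int, symmetric])
        (auto simp: algebra_simps)
    have "(\<Prod>u\<in>UNIV. D p u ^ ?e u) * D p w ^ (N * ?M) = (\<Prod>u\<in>UNIV. D p u ^ (N * ?c u)) * D p v ^ (N * ?M)" for p
    proof -
      have "(\<Prod>u\<in>UNIV. D p u ^ ?e u) * D p w ^ (N * ?M) =
          (\<Prod>u\<in>UNIV. D p u ^ ?e u) * (\<Prod>u\<in>UNIV. D p u ^ (if u = w then N * ?M else 0))"
        by (simp add: if_distrib[of "\<lambda>n. D p _ ^ n"] prod.delta cong: if_cong)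
      also have "\<dots> = (\<Prod>u\<in>UNIV. D p u ^ (N * ?c u + (if u = v then N * ?M else 0)))"
        by (simp only: prod.distrib[symmetric] power_add[symmetric] ew)
      also have "\<dots> = (\<Prod>u\<in>UNIV. D p u ^ (N * ?c u)) * (\<Prod>u\<in>UNIV. D p u ^ (if u = v then N * ?M else 0))"
        by (simp only: prod.distrib power_add)
      also have "(\<Prod>u\<in>UNIV. D p u ^ (if u = v then N * ?M else 0)) = D p v ^ (N * ?M)"
        by (simp add: if_distrib[of "\<lambda>n. D p _ ^ n"] prod.delta cong: if_cong)
      finally show ?thesis .
    qed
    moreover have "(\<Prod>u\<in>UNIV. D p u ^ ?e u) = (\<Prod>I\<in>?S. mono_eval (D p) I ^ (?T * n I))" for p
      by (subst mono_eval_weights) simp_all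
    moreover have "(\<Prod>u\<in>UNIV. D p u ^ (N * ?c u)) = (\<Prod>i\<in>UNIV. D p (Inl i)) ^ (N * (t * k * (CARD('n) + 1))) *
        (\<Prod>i\<in>UNIV. D p (Inr i)) ^ (N * (t * l * (CARD('m) + 1)))" for p
      by (simp only: prod_UNIV_sum sum.case prod_power_distrib)
    ultimately have eq: "(\<Prod>I\<in>?S. mono_eval (D p) I ^ (?T * n I)) * D p w ^ (N * ?M) =
        ((\<Prod>i\<in>UNIV. D p (Inl i)) ^ (N * (t * k * (CARD('n) + 1))) *
        (\<Prod>i\<in>UNIV. D p (Inr i)) ^ (N * (t * l * (CARD('m) + 1)))) * D p v ^ (N * ?M)" for p
      by simp
    show ?thesis
    proof (rule integral_quotient[OF _ _ _ nz always_eventually[OF allI[OF eq]]])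
      show "integral (\<lambda>p. \<Prod>I\<in>?S. mono_eval (D p) I ^ (?T * n I))"
        by (intro integral_prod integral_power mono)
      show "is_unit_fun (\<lambda>p. (\<Prod>i\<in>UNIV. D p (Inl i)) ^ (N * (t * k * (CARD('n) + 1))) *
        (\<Prod>i\<in>UNIV. D p (Inr i)) ^ (N * (t * l * (CARD('m) + 1))))"
        by (intro is_unit_fun_mult is_unit_fun_power u)
      show "N * ?M > 0" using Nn(1) by simp
    qed
  qed
  have D1: "integral (\<lambda>p. D p (Inl i))" for i
    by (rule integral_of_quotients[of "\<lambda>p i. D p (Inl i)", OF u(1)]) (rule quot, auto)
  have D2: "integral (\<lambda>p. D p (Inr i))" for i
    by (rule integral_of_quotients[of "\<lambda>p i. D p (Inr i)", OF u(2)]) (rule quot, auto)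
  have diag: "integral (\<lambda>p. diag_mat (\<lambda>i. d p i) $ a $ b)" if "\<And>i. integral (\<lambda>p. d p i)"
    for a b and d :: "'x \<Rightarrow> 'c::finite \<Rightarrow> complex"
    using that[of a] integral_const[of 0] by (cases "a = b") (simp_all add: diag_mat_def)
  have Bm: "integral (\<lambda>p. M p $ a $ b)" if "B_mat M" for a b and M :: "'x \<Rightarrow> complex^'c^'c"
    by (rule B_integral) (use that in \<open>simp add: B_mat_def\<close>)
  have mm: "integral (\<lambda>p. (L p ** M p) $ a $ b)"
    if "\<And>a b. integral (\<lambda>p. L p $ a $ b)" "\<And>a b. integral (\<lambda>p. M p $ a $ b)"
    for a b and L M :: "'x \<Rightarrow> complex^'c^'c"
    unfolding matrix_matrix_mult_def vec_lambda_beta by (intro integral_sum integral_mult that)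
  show "integral (\<lambda>p. fst (g p) $ i $ i')"
  proof (rule integral_cong)
    show "integral (\<lambda>p. (fst (H p) ** diag_mat (\<lambda>i. D p (Inl i)) ** fst (K p)) $ i $ i')"
      by (intro mm diag D1 Bm HK)
    show "eventually (\<lambda>p. (fst (H p) ** diag_mat (\<lambda>i. D p (Inl i)) ** fst (K p)) $ i $ i' = fst (g p) $ i $ i') near"
      using dec by eventually_elim (simp add: pair_mult_def diag_pair_def)
  qed
  show "integral (\<lambda>p. snd (g p) $ j $ j')"
  proof (rule integral_cong)
    show "integral (\<lambda>p. (snd (H p) ** diag_mat (\<lambda>i. D p (Inr i)) ** snd (K p)) $ j $ j')"
      by (intro mm diag D2 Bm HK)
    show "eventually (\<lambda>p. (snd (H p) ** diag_mat (\<lambda>i. D p (Inr i)) ** snd (K p)) $ j $ j' = snd (g p) $ j $ j') near"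
      using dec by eventually_elim (simp add: pair_mult_def diag_pair_def)
  qed
qed

end

section \<open>The Fischer product\<close>

lemma monom_induct [case_names zero single]:
  fixes I :: "'v monom"
  assumes "R 0" "\<And>v I. R I \<Longrightarrow> R (single v 1 + I)"
  shows "R I"
proof -
  have "R J \<longrightarrow> R (I + J)" for J
  proof (induction I arbitrary: J rule: mpol_induct)
    case (single v n)
    show ?case
    proof (induction n)
      case (Suc n)
      have "single v (Suc n) + J = single v 1 + (single v n + J)"
        by (simp add: single_add[symmetric] add.assoc[symmetric])
      then show ?case using Suc assms(2) by metis
    qed simp
  next
    case (add I I')
    then show ?case by (metis add.assoc)
  qed
  from this[of 0] assms(1) show ?thesis by simp
qed

text \<open>Peels off one variable at a time, as the adjunction between multiplication by a variable
  and differentiation requires.\<close>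

lemma mpol_var_induct [case_names const var add]:
  fixes P :: "'v mpol"
  assumes c: "\<And>c. R (Const c)" and v: "\<And>v P. R P \<Longrightarrow> R (Var v * P)" and a: "\<And>P Q. R P \<Longrightarrow> R Q \<Longrightarrow> R (P + Q)"
  shows "R P"
proof (induction P rule: mpol_induct)
  case (single I c)
  show ?case
  proof (induction I rule: monom_induct)
    case zero
    then show ?case using c by (simp add: Const_def)
  next
    case (single w I)
    have "single (single w 1 + I) c = Var w * single I c"
      by (simp add: Var_def mult_single)
    with v[OF single] show ?case by simp
  qed
qed (rule a)

definition monom_fact :: "('v::finite) monom \<Rightarrow> complex" where
  "monom_fact I = (\<Prod>v\<in>UNIV. fact (lookup I v))"

text \<open>The Fischer (or Bombieri) inner product: multiplication by a variable is adjoint to differentiation.\<close>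

definition fischer :: "('v::finite) mpol \<Rightarrow> 'v mpol \<Rightarrow> complex" where
  "fischer h q = (\<Sum>I\<in>keys q. monom_fact I * lookup h I * cnj (lookup q I))"

lemma fischer_superset:
  assumes "finite S" "keys q \<subseteq> S"
  shows "fischer h q = (\<Sum>I\<in>S. monom_fact I * lookup h I * cnj (lookup q I))"
  unfolding fischer_def
  by (rule sum.mono_neutral_left) (use assms in \<open>auto simp: in_keys_iff\<close>)

lemma fischer_add_left: "fischer (h + h') q = fischer h q + fischer h' q"
  by (simp add: fischer_def lookup_add algebra_simps sum.distrib)

lemma fischer_add_right: "fischer h (q + q') = fischer h q + fischer h q'"
proof -
  let ?S = "keys q \<union> keys q'"
  have "fischer h (q + q') = (\<Sum>I\<in>?S. monom_fact I * lookup h I * cnj (lookup (q + q') I))"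
    by (rule fischer_superset) (auto dest: subsetD[OF Poly_Mapping.keys_add])
  also have "\<dots> = (\<Sum>I\<in>?S. monom_fact I * lookup h I * cnj (lookup q I)) +
      (\<Sum>I\<in>?S. monom_fact I * lookup h I * cnj (lookup q' I))"
    by (simp add: lookup_add algebra_simps sum.distrib)
  also have "\<dots> = fischer h q + fischer h q'"
    by (simp add: fischer_superset[of ?S])
  finally show ?thesis .
qed

lemma fischer_0_left [simp]: "fischer 0 q = 0"
  and fischer_0_right [simp]: "fischer h 0 = 0"
  by (simp_all add: fischer_def)

lemma fischer_Const_left: "fischer (Const c * h) q = c * fischer h q"
  by (simp add: fischer_def lookup_Const_mult sum_distrib_left) (simp add: mult_ac)

lemma fischer_Const_right: "fischer h (Const c * q) = cnj c * fischer h q"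
proof (cases "c = 0")
  case False
  then show ?thesis
    by (simp add: fischer_def keys_Const_mult lookup_Const_mult sum_distrib_left) (simp add: mult_ac)
qed simp

lemma fischer_sum_left: "fischer (sum f S) q = (\<Sum>i\<in>S. fischer (f i) q)"
  by (induction S rule: infinite_finite_induct) (simp_all add: fischer_add_left)

lemma fischer_sum_right: "fischer h (sum f S) = (\<Sum>i\<in>S. fischer h (f i))"
  by (induction S rule: infinite_finite_induct) (simp_all add: fischer_add_right)

lemma fischer_single:
  "fischer (single I a) (single J b) = (if I = J then monom_fact I * a * cnj b else 0)"
  by (cases "b = 0") (simp_all add: fischer_def lookup_single when_def)

lemma fischer_self_nonzero:
  assumes "q \<noteq> 0"
  shows "fischer q q \<noteq> 0"
proof -
  let ?f = "\<lambda>I. (\<Prod>v\<in>UNIV. fact (lookup I v)) * (cmod (lookup q I))\<^sup>2"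
  have "fischer q q = complex_of_real (\<Sum>I\<in>keys q. ?f I)"
    by (simp add: fischer_def monom_fact_def complex_norm_square[symmetric] mult.assoc)
  moreover have "(\<Sum>I\<in>keys q. ?f I) > 0"
  proof (rule sum_pos)
    show "keys q \<noteq> {}" using assms by simp
    show "?f I > 0" if "I \<in> keys q" for I
      using that by (intro mult_pos_pos prod_pos) (auto simp: in_keys_iff)
  qed simp
  ultimately show ?thesis by (simp only: of_real_eq_0_iff)
qed

text \<open>Subtraction of exponents is truncated. Where \<open>v\<close> does not occur the
  coefficient is 0, so no spurious monomial arises.\<close>

definition partial_deriv :: "'v \<Rightarrow> 'v mpol \<Rightarrow> 'v mpol" where
  "partial_deriv v q = (\<Sum>I\<in>keys q. single (I - single v 1)
     (of_nat (lookup I v) * lookup q I))"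

lemma partial_deriv_superset:
  assumes "finite S" "keys q \<subseteq> S"
  shows "partial_deriv v q = (\<Sum>I\<in>S. single (I - single v 1)
     (of_nat (lookup I v) * lookup q I))"
  unfolding partial_deriv_def
  by (rule sum.mono_neutral_left) (use assms in \<open>auto simp: in_keys_iff\<close>)

lemma partial_deriv_add: "partial_deriv v (q + q') = partial_deriv v q + partial_deriv v q'"
proof -
  let ?S = "keys q \<union> keys q'"
  let ?s = "\<lambda>q. \<Sum>I\<in>?S. single (I - single v 1)
     (of_nat (lookup I v) * lookup q I)"
  have "partial_deriv v (q + q') = ?s (q + q')"
    by (rule partial_deriv_superset) (auto dest: subsetD[OF Poly_Mapping.keys_add])
  also have "\<dots> = ?s q + ?s q'"
    by (simp add: lookup_add ring_distribs single_add sum.distrib)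
  also have "\<dots> = partial_deriv v q + partial_deriv v q'"
    by (simp add: partial_deriv_superset[of ?S])
  finally show ?thesis .
qed

lemma partial_deriv_single: "partial_deriv v (single I c) =
    single (I - single v 1) (of_nat (lookup I v) * c)"
  by (cases "c = 0") (simp_all add: partial_deriv_def)

lemma partial_deriv_0 [simp]: "partial_deriv v 0 = 0"
  by (simp add: partial_deriv_def)

lemma partial_deriv_sum: "partial_deriv v (sum f S) = (\<Sum>i\<in>S. partial_deriv v (f i))"
  by (induction S rule: infinite_finite_induct) (simp_all add: partial_deriv_add)

lemma partial_deriv_Const: "partial_deriv v (Const c) = 0"
  by (simp add: Const_def partial_deriv_single)

lemma partial_deriv_Const_mult: "partial_deriv v (Const c * q) = Const c * partial_deriv v q"
  by (induction q rule: mpol_induct)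
     (simp_all add: Const_def mult_single partial_deriv_single partial_deriv_add ring_distribs mult.left_commute)

lemma partial_deriv_Var_mult: "partial_deriv v (Var w * q) = (if v = w then q else 0) + Var w * partial_deriv v q"
proof (induction q rule: mpol_induct)
  case (single I c)
  have shift: "single w 1 + I - single v 1 =
      (if v = w then I else single w 1 + (I - single v 1))"
    by (rule poly_mapping_eqI) (auto simp: lookup_add lookup_minus lookup_single when_def)
  have "single w 1 + (I - single w 1) = I" if "lookup I w > 0"
    by (rule poly_mapping_eqI) (use that in \<open>auto simp: lookup_add lookup_minus lookup_single when_def\<close>)
  then have s: "single (single w 1 + (I - single w 1))
        (of_nat (lookup I w) * c) = single I (of_nat (lookup I w) * c)"
    by (cases "lookup I w = 0") simp_all
  show ?case
  proof (cases "v = w")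
    case True
    have "partial_deriv v (Var w * single I c) =
        single I (c + of_nat (lookup I w) * c)"
      using shift by (simp add: Var_def mult_single partial_deriv_single True lookup_add ring_distribs)
    then show ?thesis using s by (simp add: Var_def mult_single partial_deriv_single True single_add)
  next
    case False
    then show ?thesis using shift
      by (simp add: Var_def mult_single partial_deriv_single lookup_add lookup_single when_def)
  qed
qed (simp add: partial_deriv_add ring_distribs)

lemma partial_deriv_mult: "partial_deriv v (p * q) = partial_deriv v p * q + p * partial_deriv v q"
proof (induction p arbitrary: q rule: mpol_var_induct)
  case (const c)
  then show ?case by (simp add: partial_deriv_Const partial_deriv_Const_mult)
next
  case (var w p)
  have "partial_deriv v (Var w * p * q) = (if v = w then p * q else 0) + Var w * (partial_deriv v p * q + p * partial_deriv v q)"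
    by (simp only: mult.assoc partial_deriv_Var_mult var)
  then show ?case by (simp add: partial_deriv_Var_mult ring_distribs mult.assoc)
next
  case (add p p')
  then show ?case by (simp add: partial_deriv_add ring_distribs)
qed

lemma monom_fact_add_single: "monom_fact (single v 1 + I) = of_nat (Suc (lookup I v)) * monom_fact I"
proof -
  have "fact (lookup (single v 1 + I) u) =
      (if u = v then of_nat (Suc (lookup I v)) else 1) * (fact (lookup I u) :: complex)" for u
    by (simp add: lookup_add lookup_single when_def)
  then show ?thesis by (simp add: monom_fact_def prod.distrib prod.delta)
qed

lemma fischer_Var: "fischer (Var v * h) q = fischer h (partial_deriv v q)"
proof (induction h rule: mpol_induct)
  case (single I a)
  show ?case
  proof (induction q rule: mpol_induct)
    case (single J b)
    show ?case
    proof (cases "lookup J v = 0")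
      case True
      then have "single v 1 + I \<noteq> J"
        by (metis add_is_0 lookup_add lookup_single_eq zero_neq_one)
      with True show ?thesis by (simp add: Var_def mult_single partial_deriv_single fischer_single)
    next
      case False
      then have J: "single v 1 + (J - single v 1) = J"
        by (intro poly_mapping_eqI) (auto simp: lookup_add lookup_minus lookup_single when_def)
      have J': "single v 1 + I = J \<longleftrightarrow> I = J - single v 1"
        using J by auto
      have "monom_fact J = of_nat (lookup J v) * monom_fact (J - single v 1)"
        using monom_fact_add_single[of v "J - single v 1", unfolded J] False
        by (simp add: lookup_minus)
      then show ?thesis
        by (simp add: Var_def mult_single partial_deriv_single fischer_single J' J del: One_nat_def)
    qed
  qed (simp add: fischer_add_right partial_deriv_add)
qed (simp add: fischer_add_left ring_distribs)

definition linear_subst :: "('v::finite \<Rightarrow> 'v \<Rightarrow> complex) \<Rightarrow> 'v mpol \<Rightarrow> 'v mpol" where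
  "linear_subst A = mpol_subst (\<lambda>v. \<Sum>w\<in>UNIV. Const (A v w) * Var w)"

text \<open>The chain rule, by induction with the product rule.\<close>

lemma partial_deriv_linear_subst:
  "partial_deriv v (linear_subst A q) = (\<Sum>w\<in>UNIV. Const (A w v) * linear_subst A (partial_deriv w q))"
proof (induction q rule: mpol_var_induct)
  case (const c)
  then show ?case by (simp add: linear_subst_def mpol_subst_simps partial_deriv_Const)
next
  case (var u q)
  have pdl: "partial_deriv v (\<Sum>w\<in>UNIV. Const (A u w) * Var w) = Const (A u v)"
  proof -
    have "partial_deriv v (Var w) = (if w = v then 1 else 0)" for w
      using partial_deriv_Var_mult[of v w 1] partial_deriv_Const[of v 1] by auto
    then have "partial_deriv v (\<Sum>w\<in>UNIV. Const (A u w) * Var w) = (\<Sum>w\<in>UNIV. if w = v then Const (A u w) else 0)"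
      by (simp add: partial_deriv_sum partial_deriv_Const_mult if_distrib[of "(*) _"] cong: if_cong)
    then show ?thesis by simp
  qed
  have "linear_subst A (partial_deriv w (Var u * q)) = (if w = u then linear_subst A q else 0) +
      (\<Sum>w\<in>UNIV. Const (A u w) * Var w) * linear_subst A (partial_deriv w q)" for w
    by (simp add: partial_deriv_Var_mult linear_subst_def mpol_subst_simps)
  then have "(\<Sum>w\<in>UNIV. Const (A w v) * linear_subst A (partial_deriv w (Var u * q))) =
      (\<Sum>w\<in>UNIV. if w = u then Const (A w v) * linear_subst A q else 0) +
      (\<Sum>w\<in>UNIV. Const (A w v) * ((\<Sum>w\<in>UNIV. Const (A u w) * Var w) * linear_subst A (partial_deriv w q)))"
    by (simp add: distrib_left sum.distrib if_distrib[of "(*) _"] cong: if_cong)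
  also have "\<dots> = Const (A u v) * linear_subst A q +
      (\<Sum>w\<in>UNIV. Const (A u w) * Var w) * (\<Sum>w\<in>UNIV. Const (A w v) * linear_subst A (partial_deriv w q))"
    by (simp add: sum_distrib_left mult.left_commute)
  also have "\<dots> = partial_deriv v (linear_subst A (Var u * q))"
    using var pdl by (simp add: linear_subst_def mpol_subst_simps partial_deriv_mult)
  finally show ?case by simp
next
  case (add p q)
  then show ?case
    by (simp add: linear_subst_def mpol_subst_simps partial_deriv_add distrib_left sum.distrib)
qed

lemma lookup_0_eval: "lookup P 0 = mpol_eval (\<lambda>_. 0) P"
proof (induction P rule: mpol_var_induct)
  case (const c)
  then show ?case by (simp add: mpol_eval_simps) (simp add: Const_def)
next
  case (var v P)
  have "(\<Sum>(A, B)\<in>{(A, B). A + B = 0}. lookup (Var v) A * lookup P B) = 0"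
  proof (rule sum.neutral, safe)
    fix A B :: "'a monom" assume AB: "A + B = 0"
    have "A \<noteq> single v 1"
    proof
      assume "A = single v 1"
      then have "lookup (A + B) v > 0" by (simp add: lookup_add)
      with AB show False by simp
    qed
    then show "lookup (Var v) A * lookup P B = 0"
      by (simp add: Var_def lookup_single when_def)
  qed
  then show ?case by (simp add: mpol_eval_simps lookup_mult_mpol)
qed (simp add: lookup_add mpol_eval_simps)

text \<open>A variable split off on the left becomes a derivative on the right, where the chain rule
  for the conjugate transpose collects the derivatives. In the base case only the constant term
  counts, and linear substitutions fix it.\<close>

theorem fischer_linear_subst:
  "fischer (linear_subst A h) q = fischer h (linear_subst (\<lambda>v w. cnj (A w v)) q)"
proof (induction h arbitrary: q rule: mpol_var_induct)
  case (const c)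
  have "fischer (Const c) q = c * cnj (lookup q 0)" for q :: "'a mpol"
  proof -
    have "fischer (Const c) q = (\<Sum>I\<in>keys q. if I = 0 then c * cnj (lookup q I) else 0)"
      unfolding fischer_def
      by (rule sum.cong) (auto simp: Const_def lookup_single when_def monom_fact_def)
    then show ?thesis by (auto simp: sum.delta in_keys_iff)
  qed
  then show ?case
    by (simp add: linear_subst_def mpol_subst_simps lookup_0_eval mpol_eval_subst mpol_eval_simps)
next
  case (var u h)
  let ?A' = "\<lambda>v w. cnj (A w v)"
  have "fischer (linear_subst A (Var u * h)) q =
      fischer (\<Sum>w\<in>UNIV. Const (A u w) * (Var w * linear_subst A h)) q"
    by (simp add: linear_subst_def mpol_subst_simps sum_distrib_right mult.assoc)
  also have "\<dots> = (\<Sum>w\<in>UNIV. A u w * fischer h (linear_subst ?A' (partial_deriv w q)))"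
    by (simp add: fischer_sum_left fischer_Const_left fischer_Var var)
  also have "\<dots> = fischer h (partial_deriv u (linear_subst ?A' q))"
    by (simp add: partial_deriv_linear_subst fischer_sum_right fischer_Const_right)
  also have "\<dots> = fischer (Var u * h) (linear_subst ?A' q)" by (simp add: fischer_Var)
  finally show ?case .
next
  case (add p h)
  have "linear_subst A (p + h) = linear_subst A p + linear_subst A h"
    by (simp add: linear_subst_def mpol_subst_simps)
  with add show ?case by (simp add: fischer_add_left)
qed

section \<open>Cayley's process\<close>

lemma sum_UNIV_prod: "(\<Sum>p\<in>(UNIV :: ('a::finite \<times> 'b::finite) set). f p) = (\<Sum>i\<in>UNIV. \<Sum>j\<in>UNIV. f (i, j))"
  by (simp add: sum.cartesian_product)

type_synonym ('a, 'b) entry = "('a \<times> 'a) + ('b \<times> 'b)"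

definition entries :: "('a::finite, 'b::finite) mats \<Rightarrow> ('a, 'b) entry \<Rightarrow> complex" where
  "entries M v = (case v of Inl (i, j) \<Rightarrow> fst M $ i $ j | Inr (i, j) \<Rightarrow> snd M $ i $ j)"

lemma entries_surj: "\<exists>M. entries M = a"
proof -
  have "entries ((\<chi> i j. a (Inl (i, j))), (\<chi> i j. a (Inr (i, j)))) = a"
    by (auto simp: entries_def fun_eq_iff split: sum.splits)
  then show ?thesis ..
qed

lemma mpol_eqI_entries:
  fixes p q :: "('a::finite, 'b::finite) entry mpol"
  assumes "\<And>M. mpol_eval (entries M) p = mpol_eval (entries M) q"
  shows "p = q"
proof (rule mpol_eqI)
  fix a :: "('a, 'b) entry \<Rightarrow> complex"
  obtain M where "entries M = a" using entries_surj by blast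
  with assms[of M] show "mpol_eval a p = mpol_eval a q" by simp
qed

text \<open>The matrix of M \<mapsto> gM on the space of matrix pairs, in the coordinates
  \<open>entries\<close>.\<close>

definition left_mult :: "('a::finite, 'b::finite) mats \<Rightarrow> ('a, 'b) entry \<Rightarrow> ('a, 'b) entry \<Rightarrow> complex" where
  "left_mult g v w = (case v of
      Inl (i, j) \<Rightarrow> (case w of Inl (i', j') \<Rightarrow> if j' = j then fst g $ i $ i' else 0 | Inr _ \<Rightarrow> 0)
    | Inr (i, j) \<Rightarrow> (case w of Inl _ \<Rightarrow> 0 | Inr (i', j') \<Rightarrow> if j' = j then snd g $ i $ i' else 0))"

lemma eval_left_mult:
  "mpol_eval (entries M) (linear_subst (left_mult g) h) = mpol_eval (entries (pair_mult g M)) h"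
proof -
  have "(\<Sum>w\<in>UNIV. left_mult g v w * entries M w) = entries (pair_mult g M) v" for v
  proof (cases v)
    case (Inl x)
    obtain i j where "x = (i, j)" by force
    then show ?thesis using Inl
      by (simp add: left_mult_def entries_def pair_mult_def sum_UNIV_sum sum_UNIV_prod matrix_matrix_mult_def
          if_distrib[of "\<lambda>x. x * _"] cong: if_cong)
  next
    case (Inr x)
    obtain i j where "x = (i, j)" by force
    then show ?thesis using Inr
      by (simp add: left_mult_def entries_def pair_mult_def sum_UNIV_sum sum_UNIV_prod matrix_matrix_mult_def
          if_distrib[of "\<lambda>x. x * _"] cong: if_cong)
  qed
  then show ?thesis
    by (simp add: linear_subst_def mpol_eval_subst mpol_eval_simps)
qed

definition adjoint_mat :: "complex^'n^'n \<Rightarrow> complex^'n^'n" where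
  "adjoint_mat A = (\<chi> i j. cnj (A $ j $ i))"

lemma det_adjoint_mat: "det (adjoint_mat A) = cnj (det A)"
proof -
  have "det (adjoint_mat A) = det (Finite_Cartesian_Product.transpose (adjoint_mat A))"
    by (simp add: det_transpose)
  also have "Finite_Cartesian_Product.transpose (adjoint_mat A) = (\<chi> i j. cnj (A $ i $ j))"
    by (simp add: adjoint_mat_def Finite_Cartesian_Product.transpose_def vec_eq_iff)
  also have "det \<dots> = cnj (det A)" by (simp add: det_def)
  finally show ?thesis .
qed

lemma left_mult_adjoint:
  "(\<lambda>v w. cnj (left_mult g w v)) = left_mult (adjoint_mat (fst g), adjoint_mat (snd g))"
  by (intro ext) (auto simp: left_mult_def adjoint_mat_def split: sum.splits)

section \<open>Generic determinants and polynomial dependence on coefficients\<close>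

definition det1 :: "('a::finite, 'b::finite) entry mpol" where
  "det1 = (\<Sum>\<sigma>\<in>{\<sigma>. \<sigma> permutes UNIV}. Const (of_int (sign \<sigma>)) * (\<Prod>i\<in>UNIV. Var (Inl (i, \<sigma> i))))"

definition det2 :: "('a::finite, 'b::finite) entry mpol" where
  "det2 = (\<Sum>\<sigma>\<in>{\<sigma>. \<sigma> permutes UNIV}. Const (of_int (sign \<sigma>)) * (\<Prod>i\<in>UNIV. Var (Inr (i, \<sigma> i))))"

lemma eval_det1: "mpol_eval (entries M) det1 = det (fst M)"
  and eval_det2: "mpol_eval (entries M) det2 = det (snd M)"
  by (simp_all add: det1_def det2_def mpol_eval_simps det_def entries_def)

text \<open>The adjoint of left multiplication by \<open>g\<close> is left multiplication by the
  conjugate transpose. Its determinants are again 1, so it fixes all powers of the generic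
  determinants.\<close>

lemma fischer_left_mult:
  assumes "det (fst g) = 1" "det (snd g) = 1"
  shows "fischer (linear_subst (left_mult g) h) (det1 ^ R * det2 ^ R') = fischer h (det1 ^ R * det2 ^ R')"
proof -
  let ?g = "(adjoint_mat (fst g), adjoint_mat (snd g))"
  have "linear_subst (left_mult ?g) (det1 ^ R * det2 ^ R') = det1 ^ R * det2 ^ R'"
    by (rule mpol_eqI_entries)
       (simp add: eval_left_mult mpol_eval_simps eval_det1 eval_det2 pair_mult_def det_mul det_adjoint_mat assms)
  then show ?thesis by (simp add: fischer_linear_subst left_mult_adjoint)
qed

lemma total_degree_superset: "finite S \<Longrightarrow> keys I \<subseteq> S \<Longrightarrow> total_degree I = (\<Sum>v\<in>S. lookup I v)"
  unfolding total_degree_def by (rule sum.mono_neutral_left) (auto simp: in_keys_iff)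

lemma total_degree_add: "total_degree (I + J) = total_degree I + total_degree J"
proof -
  let ?S = "keys I \<union> keys J"
  have "total_degree (I + J) = (\<Sum>v\<in>?S. lookup (I + J) v)"
    by (rule total_degree_superset) (auto dest: subsetD[OF Poly_Mapping.keys_add])
  then show ?thesis by (simp add: lookup_add sum.distrib total_degree_superset[of ?S])
qed

lemma homogeneous_total_degree: "homogeneous d P \<longleftrightarrow> (\<forall>I\<in>keys P. total_degree I = d)"
  by (simp add: homogeneous_def total_degree_def)

lemma homogeneous_add: "homogeneous d P \<Longrightarrow> homogeneous d Q \<Longrightarrow> homogeneous d (P + Q)"
  unfolding homogeneous_total_degree using Poly_Mapping.keys_add[of P Q] by blast

lemma homogeneous_mult: "homogeneous d P \<Longrightarrow> homogeneous e Q \<Longrightarrow> homogeneous (d + e) (P * Q)"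
  unfolding homogeneous_total_degree using Poly_Mapping.keys_mult[of P Q] by (fastforce simp: total_degree_add)

lemma homogeneous_Const: "homogeneous 0 (Const c)"
  by (simp add: homogeneous_total_degree Const_def total_degree_def)

lemma homogeneous_Var: "homogeneous 1 (Var v)"
  by (simp add: homogeneous_total_degree Var_def total_degree_def)

lemma homogeneous_0: "homogeneous d 0"
  by (simp add: homogeneous_total_degree)

text \<open>Forms of degree \<open>d\<close> in the coefficients, as functions, so that degrees can
  be tracked through sums, products and pairings without naming the form.\<close>

definition polyfun :: "nat \<Rightarrow> ('v mpol \<Rightarrow> complex) \<Rightarrow> bool" where
  "polyfun d \<phi> \<longleftrightarrow> (\<exists>P. homogeneous d P \<and> (\<forall>v. \<phi> v = coeff_eval P v))"

lemma polyfun_0: "polyfun d (\<lambda>_. 0)"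
  unfolding polyfun_def by (intro exI[of _ 0]) (simp add: homogeneous_0 coeff_eval_def mpol_eval_simps)

lemma polyfun_const: "polyfun 0 (\<lambda>_. c)"
  unfolding polyfun_def by (intro exI[of _ "Const c"]) (simp add: homogeneous_Const coeff_eval_def mpol_eval_simps)

lemma polyfun_lookup: "polyfun 1 (\<lambda>v. lookup v I)"
  unfolding polyfun_def using homogeneous_Var[of I] by (intro exI[of _ "Var I"]) (simp add: coeff_eval_def mpol_eval_simps)

lemma polyfun_add:
  assumes "polyfun d \<phi>" "polyfun d \<psi>" shows "polyfun d (\<lambda>v. \<phi> v + \<psi> v)"
proof -
  obtain P Q where "homogeneous d P" "\<forall>v. \<phi> v = coeff_eval P v" "homogeneous d Q" "\<forall>v. \<psi> v = coeff_eval Q v"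
    using assms unfolding polyfun_def by (elim exE conjE)
  then show ?thesis unfolding polyfun_def
    by (intro exI[of _ "P + Q"]) (simp add: homogeneous_add coeff_eval_def mpol_eval_simps)
qed

lemma polyfun_mult:
  assumes "polyfun d \<phi>" "polyfun e \<psi>" shows "polyfun (d + e) (\<lambda>v. \<phi> v * \<psi> v)"
proof -
  obtain P Q where "homogeneous d P" "\<forall>v. \<phi> v = coeff_eval P v" "homogeneous e Q" "\<forall>v. \<psi> v = coeff_eval Q v"
    using assms unfolding polyfun_def by (elim exE conjE)
  then show ?thesis unfolding polyfun_def
    by (intro exI[of _ "P * Q"]) (simp add: homogeneous_mult coeff_eval_def mpol_eval_simps)
qed

lemma polyfun_sum: "(\<And>i. i \<in> S \<Longrightarrow> polyfun d (f i)) \<Longrightarrow> polyfun d (\<lambda>v. \<Sum>i\<in>S. f i v)"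
  by (induction S rule: infinite_finite_induct) (simp_all add: polyfun_0 polyfun_add)

definition polyfam :: "nat \<Rightarrow> ('v mpol \<Rightarrow> 'w mpol) \<Rightarrow> bool" where
  "polyfam d X \<longleftrightarrow> (\<forall>\<alpha>. polyfun d (\<lambda>v. lookup (X v) \<alpha>))"

lemma polyfam_const: "polyfam 0 (\<lambda>_. p)"
  by (simp add: polyfam_def polyfun_const)

lemma polyfam_sum: "(\<And>i. i \<in> S \<Longrightarrow> polyfam d (f i)) \<Longrightarrow> polyfam d (\<lambda>v. \<Sum>i\<in>S. f i v)"
  by (simp add: polyfam_def lookup_sum polyfun_sum)

lemma polyfam_mult: "polyfam d X \<Longrightarrow> polyfam e Y \<Longrightarrow> polyfam (d + e) (\<lambda>v. X v * Y v)"
  by (simp add: polyfam_def lookup_mult_mpol case_prod_unfold polyfun_sum polyfun_mult)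

lemma polyfam_Const:
  assumes "polyfun d \<phi>" shows "polyfam d (\<lambda>v. Const (\<phi> v))"
  unfolding polyfam_def
proof
  fix \<alpha> :: "'b monom"
  show "polyfun d (\<lambda>v. lookup (Const (\<phi> v)) \<alpha>)"
    by (cases "\<alpha> = 0") (simp_all add: Const_def lookup_single when_def assms polyfun_0)
qed

lemma polyfam_power: "polyfam d X \<Longrightarrow> polyfam (n * d) (\<lambda>v. X v ^ n)"
  by (induction n) (simp_all add: polyfam_const polyfam_mult)

lemma polyfam_prod: "(\<And>i. i \<in> S \<Longrightarrow> polyfam (d i) (f i)) \<Longrightarrow> polyfam (\<Sum>i\<in>S. d i) (\<lambda>v. \<Prod>i\<in>S. f i v)"
  by (induction S rule: infinite_finite_induct) (simp_all add: polyfam_const polyfam_mult)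

lemma polyfam_subst:
  assumes "\<And>I. polyfam 1 (\<lambda>v. \<sigma> v I)" "homogeneous d Q"
  shows "polyfam d (\<lambda>v. mpol_subst (\<sigma> v) Q)"
  unfolding mpol_subst_def
proof (rule polyfam_sum)
  fix K assume K: "K \<in> keys Q"
  have "polyfam (0 + (\<Sum>I\<in>keys K. lookup K I * 1))
      (\<lambda>v. Const (lookup Q K) * (\<Prod>I\<in>keys K. \<sigma> v I ^ lookup K I))"
    by (intro polyfam_mult polyfam_const polyfam_prod polyfam_power assms(1))
  moreover have "(\<Sum>I\<in>keys K. lookup K I) = d"
    using assms(2) K by (simp add: homogeneous_def)
  ultimately show "polyfam d
      (\<lambda>v. Const (lookup Q K) * (\<Prod>I\<in>keys K. \<sigma> v I ^ lookup K I))"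
    by simp
qed

lemma polyfun_fischer:
  assumes "polyfam d X" shows "polyfun d (\<lambda>v. fischer (X v) q)"
  unfolding fischer_def
proof (rule polyfun_sum)
  fix I
  have "polyfun (0 + d) (\<lambda>v. (monom_fact I * cnj (lookup q I)) * lookup (X v) I)"
    by (rule polyfun_mult[OF polyfun_const]) (use assms in \<open>simp add: polyfam_def\<close>)
  then show "polyfun d (\<lambda>v. monom_fact I * lookup (X v) I * cnj (lookup q I))"
    by (simp add: mult_ac)
qed

text \<open>Polynomial functions of the matrix entries form a function algebra, so the result on
  substitution in families applies to the tautological family.\<close>

lemma lact_coeff_polynomial:
  assumes "bidegree k l (J :: ('a::finite + 'b::finite) monom)"
  shows "\<exists>t. \<forall>M. lookup (lact M (single J 1)) I = mpol_eval (entries M) t"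
proof -
  define A :: "(('a, 'b) mats \<Rightarrow> complex) set" where "A = {\<lambda>M. mpol_eval (entries M) t |t. True}"
  have "function_algebra A"
  proof
    show "(\<lambda>_. c) \<in> A" for c
      unfolding A_def mem_Collect_eq by (intro exI[of _ "Const c"]) (simp add: mpol_eval_simps)
  next
    fix a b assume "a \<in> A" "b \<in> A"
    then obtain s t where st: "a = (\<lambda>M. mpol_eval (entries M) s)" "b = (\<lambda>M. mpol_eval (entries M) t)"
      unfolding A_def by blast
    show "(\<lambda>p. a p + b p) \<in> A"
      unfolding A_def mem_Collect_eq by (intro exI[of _ "s + t"]) (simp add: mpol_eval_simps st)
    show "(\<lambda>p. a p * b p) \<in> A"
      unfolding A_def mem_Collect_eq by (intro exI[of _ "s * t"]) (simp add: mpol_eval_simps st)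
  qed
  then interpret function_algebra A .
  have A: "f \<in> A" if "\<And>M. f M = mpol_eval (entries M) t" for f t
    using that unfolding A_def by (auto simp: fun_eq_iff)
  have 1: "B_mat (\<lambda>M. fst M)" unfolding B_mat_def
  proof (intro allI)
    fix i j show "(\<lambda>M. fst M $ i $ j) \<in> A"
      by (rule A[of _ "Var (Inl (i, j))"]) (simp add: mpol_eval_simps entries_def)
  qed
  have 2: "B_mat (\<lambda>M. snd M)" unfolding B_mat_def
  proof (intro allI)
    fix i j show "(\<lambda>M. snd M $ i $ j) \<in> A"
      by (rule A[of _ "Var (Inr (i, j))"]) (simp add: mpol_eval_simps entries_def)
  qed
  have "bihom k l (single J 1)" by (rule bihom_single) (simp add: assms)
  then have "B_mpol (\<lambda>M. lact M (single J 1))"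
    using B_mpol_lact[of "\<lambda>M. M" "\<lambda>_. single J 1", OF 1 2 B_mpol_const] by blast
  then have "(\<lambda>M. lookup (lact M (single J 1)) I) \<in> A"
    by (simp add: B_mpol_def)
  then obtain t where "(\<lambda>M. lookup (lact M (single J 1)) I) = (\<lambda>M. mpol_eval (entries M) t)"
    unfolding A_def by blast
  then show ?thesis by (metis (mono_tags))
qed

lemma lact_sum: "lact M (sum f S) = (\<Sum>i\<in>S. lact M (f i))"
  by (induction S rule: infinite_finite_induct) (simp_all add: lact_add)

lemma lookup_lact_linear:
  assumes "bihom k l v"
  shows "lookup (lact M v) I =
    (\<Sum>J\<in>{J. bidegree k l J}. lookup v J * lookup (lact M (single J 1)) I)"
proof -
  have "v = (\<Sum>J\<in>{J. bidegree k l J}. single J (lookup v J))"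
    by (rule mpol_sum_single[OF finite_bidegree]) (use assms in \<open>auto simp: bihom_def\<close>)
  also have "\<dots> = (\<Sum>J\<in>{J. bidegree k l J}. Const (lookup v J) * single J 1)"
    by (simp add: Const_def mult_single)
  finally have "lact M v = lact M (\<Sum>J\<in>{J. bidegree k l J}. Const (lookup v J) * single J 1)"
    by (rule arg_cong)
  also have "\<dots> = (\<Sum>J\<in>{J. bidegree k l J}. Const (lookup v J) * lact M (single J 1))"
    by (simp only: lact_sum lact_Const_mult)
  finally have "lact M v = (\<Sum>J\<in>{J. bidegree k l J}. Const (lookup v J) * lact M (single J 1))" .
  then show ?thesis by (simp add: lookup_sum lookup_Const_mult)
qed

text \<open>Orthogonality of the characters of a cyclic group.\<close>

lemma root_of_unity_power_sum:
  assumes "n > 0"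
  defines "\<zeta> \<equiv> exp (2 * of_real pi * \<i> / of_nat n)"
  shows "\<zeta> ^ n = 1" "(\<Sum>x<n. (\<zeta> ^ x) ^ m) = (if n dvd m then of_nat n else 0)"
proof -
  have e: "\<zeta> ^ j = exp (2 * of_real pi * \<i> * of_nat j / of_nat n)" for j
    unfolding \<zeta>_def by (simp add: exp_of_nat_mult[symmetric] mult_ac)
  have one: "\<zeta> ^ j = 1 \<longleftrightarrow> n dvd j" for j
    unfolding e by (rule complex_root_unity_eq_1) (use assms(1) in simp)
  show z: "\<zeta> ^ n = 1" by (simp add: one)
  have "(\<Sum>x<n. (\<zeta> ^ x) ^ m) = (\<Sum>x<n. (\<zeta> ^ m) ^ x)"
    by (simp add: power_mult[symmetric] mult.commute)
  also have "\<dots> = (if n dvd m then of_nat n else 0)"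
  proof (cases "n dvd m")
    case True
    then have "\<zeta> ^ m = 1" by (simp add: one)
    with True show ?thesis by simp
  next
    case False
    then have "\<zeta> ^ m \<noteq> 1" by (simp add: one)
    moreover have "(\<zeta> ^ m) ^ n = 1" using z by (metis power_mult mult.commute power_one)
    ultimately show ?thesis using False by (simp add: geometric_sum)
  qed
  finally show "(\<Sum>x<n. (\<zeta> ^ x) ^ m) = (if n dvd m then of_nat n else 0)" .
qed

lemma det_scale: "det (\<chi> i j. s * (A :: complex^'n^'n) $ i $ j) = s ^ CARD('n) * det A"
  by (simp add: diag_mat_const_mult[symmetric] det_mul det_diag_mat)

lemma det_scale_pair:
  "det (fst (scale_pair s t M)) = s ^ CARD('a) * det (fst M)"
  "det (snd (scale_pair s t M)) = t ^ CARD('b) * det (snd M)" for M :: "('a::finite, 'b::finite) mats"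
  by (simp_all add: scale_pair_def det_scale)

text \<open>Cayley's \<open>\<Omega>\<close>-process: pairing with a power of the determinant projects onto invariants.\<close>

theorem invariant_of_vanishing:
  fixes F :: "('a::finite + 'b::finite) mpol"
  assumes F: "bihom k l F"
    and van: "\<And>N. det (fst N) = 1 \<Longrightarrow> det (snd N) = 1 \<Longrightarrow> coeff_eval Q (lact N F) = 0"
    and Q0: "coeff_eval Q 0 \<noteq> 0"
  obtains d P where "d > 0" "homogeneous d P" "coeff_eval P F \<noteq> 0"
    "\<And>g v. det (fst g) = 1 \<Longrightarrow> det (snd g) = 1 \<Longrightarrow> bihom k l v \<Longrightarrow> coeff_eval P (lact g v) = coeff_eval P v"
proof -
  let ?B = "{J :: ('a + 'b) monom. bidegree k l J}"
  define t :: "('a + 'b) monom \<Rightarrow> ('a + 'b) monom \<Rightarrow> ('a, 'b) entry mpol" where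
    "t I J = (SOME t. \<forall>M. lookup (lact M (single J 1)) I = mpol_eval (entries M) t)" for I J
  have t: "lookup (lact M (single J 1)) I = mpol_eval (entries M) (t I J)"
    if "bidegree k l J" for I J M
    using someI_ex[OF lact_coeff_polynomial[OF that, of I]] unfolding t_def by blast
  \<comment> \<open>The coefficients of \<open>v\<close> composed with a generic matrix pair, as
    polynomials in the entries of that pair. Below, \<open>h d v\<close> is the degree
    \<open>d\<close> part of \<open>Q\<close> at these coefficients.\<close>
  define C where "C = (\<lambda>v I. \<Sum>J\<in>?B. Const (lookup v J) * t I J)"
  define h where "h = (\<lambda>d v. mpol_subst (C v) (homogeneous_part d Q))"
  have ev_C: "mpol_eval (entries M) (C v I) = lookup (lact M v) I" if "bihom k l v" for M v I
    using lookup_lact_linear[OF that, of M I] t by (simp add: C_def mpol_eval_simps)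
  have ev_h: "mpol_eval (entries M) (h d v) = coeff_eval (homogeneous_part d Q) (lact M v)" if "bihom k l v" for M d v
    using ev_C[OF that] by (simp add: h_def mpol_eval_subst coeff_eval_def)
  have h_inv: "h d (lact g v) = linear_subst (left_mult g) (h d v)" if "bihom k l v" for d g v
    by (rule mpol_eqI_entries)
       (simp add: eval_left_mult ev_h[OF that] ev_h[OF bihom_lact[OF that]] lact_lact)
  have h_fam: "polyfam d (h d)" for d
    unfolding h_def
  proof (rule polyfam_subst[OF _ homogeneous_homogeneous_part])
    fix I
    have "polyfam (1 + 0) (\<lambda>v. \<Sum>J\<in>?B. Const (lookup v J) * t I J)"
      by (intro polyfam_sum polyfam_mult polyfam_Const polyfam_const polyfun_lookup)
    then show "polyfam 1 (\<lambda>v. C v I)" by (simp add: C_def)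
  qed
  define D where "D = total_degree ` keys Q"
  \<comment> \<open>So large that all the exponents of determinants in \<open>p\<close> are
    positive, even for the top degree of \<open>Q\<close>.\<close>
  define R where "R = Suc (k * \<Sum>D)"
  define R' where "R' = Suc (l * \<Sum>D)"
  define q where "q = (det1 ^ R * det2 ^ R' :: ('a, 'b) entry mpol)"
  \<comment> \<open>The degrees that survive averaging over scalar matrices of determinant one. For
    them the divisions in \<open>p\<close> are exact.\<close>
  define E where "E = {d \<in> D. CARD('a) dvd k * d \<and> CARD('b) dvd l * d}"
  \<comment> \<open>The determinant powers bring the parts of all degrees in \<open>E\<close> to one
    bidegree in the matrix entries. An identity on pairs of determinant one then extends by scaling
    to all invertible pairs.\<close>
  define p where "p = (\<lambda>d v. det1 ^ (R - k * d div CARD('a)) * det2 ^ (R' - l * d div CARD('b)) * h d v)"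
  have finD: "finite D" by (simp add: D_def)
  have dD: "k * d div CARD('a) < R \<and> l * d div CARD('b) < R'" if "d \<in> D" for d
  proof -
    have d: "d \<le> \<Sum>D" using member_le_sum[of d D "\<lambda>x. x"] that finD by simp
    have "k * d div CARD('a) \<le> k * d" "l * d div CARD('b) \<le> l * d" by simp_all
    moreover have "k * d \<le> k * \<Sum>D" "l * d \<le> l * \<Sum>D" using d by simp_all
    ultimately show ?thesis unfolding R_def R'_def by linarith
  qed
  define x where "x = (\<lambda>d M. coeff_eval (homogeneous_part d Q) (lact M F))"
  have x_scale: "x d (scale_pair s u M) = s ^ (k * d) * u ^ (l * d) * x d M" for d s u M
    by (simp add: x_def lact_scale_pair[OF F] coeff_eval_scale[OF homogeneous_homogeneous_part] power_mult_distrib power_mult)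
  have SL: "(\<Sum>d\<in>E. x d N) = 0" if N: "det (fst N) = 1" "det (snd N) = 1" for N
  proof -
    let ?a = "CARD('a)" and ?b = "CARD('b)"
    let ?y = "exp (2 * of_real pi * \<i> / of_nat ?a) :: complex" and ?z = "exp (2 * of_real pi * \<i> / of_nat ?b) :: complex"
    have y: "?y ^ ?a = 1" "\<And>m. (\<Sum>i<?a. (?y ^ i) ^ m) = (if ?a dvd m then of_nat ?a else 0)"
      and z: "?z ^ ?b = 1" "\<And>m. (\<Sum>i<?b. (?z ^ i) ^ m) = (if ?b dvd m then of_nat ?b else 0)"
      using root_of_unity_power_sum by simp_all
    have "(\<Sum>d\<in>D. (?y ^ i) ^ (k * d) * (?z ^ j) ^ (l * d) * x d N) = 0" for i j
    proof -
      have "(?y ^ i) ^ ?a = 1" "(?z ^ j) ^ ?b = 1"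
        using y(1) z(1) by (metis power_mult mult.commute power_one)+
      then have "coeff_eval Q (lact (scale_pair (?y ^ i) (?z ^ j) N) F) = 0"
        by (intro van) (simp_all add: det_scale_pair N)
      then have "(\<Sum>d\<in>D. x d (scale_pair (?y ^ i) (?z ^ j) N)) = 0"
        unfolding x_def D_def coeff_eval_def by (subst (asm) mpol_eval_homogeneous_part_sum)
      then show ?thesis by (simp only: x_scale)
    qed
    then have "(\<Sum>i<?a. \<Sum>j<?b. \<Sum>d\<in>D. (?y ^ i) ^ (k * d) * (?z ^ j) ^ (l * d) * x d N) = 0" by simp
    also have "(\<Sum>i<?a. \<Sum>j<?b. \<Sum>d\<in>D. (?y ^ i) ^ (k * d) * (?z ^ j) ^ (l * d) * x d N) =
        (\<Sum>i<?a. \<Sum>d\<in>D. \<Sum>j<?b. (?y ^ i) ^ (k * d) * (?z ^ j) ^ (l * d) * x d N)"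
      by (rule sum.cong[OF refl]) (rule sum.swap)
    also have "\<dots> = (\<Sum>d\<in>D. \<Sum>i<?a. \<Sum>j<?b. (?y ^ i) ^ (k * d) * (?z ^ j) ^ (l * d) * x d N)"
      by (rule sum.swap)
    also have "\<dots> = (\<Sum>d\<in>D. ((\<Sum>i<?a. (?y ^ i) ^ (k * d)) * (\<Sum>j<?b. (?z ^ j) ^ (l * d))) * x d N)"
      by (rule sum.cong[OF refl]) (subst sum_product, simp only: sum_distrib_right)
    also have "\<dots> = (\<Sum>d\<in>D. if ?a dvd k * d \<and> ?b dvd l * d then of_nat ?a * of_nat ?b * x d N else 0)"
      unfolding y(2) z(2) by (intro sum.cong refl) auto
    also have "\<dots> = (\<Sum>d\<in>E. of_nat ?a * of_nat ?b * x d N)"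
      unfolding E_def using finD by (simp add: sum.inter_filter)
    finally show ?thesis by (simp add: sum_distrib_left[symmetric])
  qed
  have sum0: "(\<Sum>d\<in>E. p d F) = 0"
  proof (rule mpol_eqI_entries)
    fix M :: "('a, 'b) mats"
    have ev: "mpol_eval (entries M) (p d F) =
        det (fst M) ^ (R - k * d div CARD('a)) * det (snd M) ^ (R' - l * d div CARD('b)) * x d M" for d
      by (simp add: p_def mpol_eval_simps eval_det1 eval_det2 ev_h[OF F] x_def)
    have "(\<Sum>d\<in>E. det (fst M) ^ (R - k * d div CARD('a)) * det (snd M) ^ (R' - l * d div CARD('b)) * x d M) = 0"
    proof (cases "det (fst M) = 0 \<or> det (snd M) = 0")
      \<comment> \<open>For a singular pair each summand contains a positive power of the vanishing
        determinant.\<close>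
      case True
      then show ?thesis
        by (intro sum.neutral) (use dD in \<open>auto simp: E_def\<close>)
    next
      case False
      obtain s where s: "s \<noteq> 0" "det (fst M) = s ^ CARD('a)"
        using exists_complex_root_nonzero[of "det (fst M)" "CARD('a)"] False by auto
      obtain u where u: "u \<noteq> 0" "det (snd M) = u ^ CARD('b)"
        using exists_complex_root_nonzero[of "det (snd M)" "CARD('b)"] False by auto
      define N where "N = scale_pair (inverse s) (inverse u) M"
      have "det (fst N) = 1" "det (snd N) = 1"
        using s u by (simp_all add: N_def det_scale_pair flip: power_mult_distrib)
      then have N: "(\<Sum>d\<in>E. x d N) = 0" by (rule SL)
      have c: "(s ^ a) ^ (r - m div a) = s ^ (a * r) * inverse s ^ m"
        if "s \<noteq> 0" "a dvd m" "m div a < r" "a > 0" for s :: complex and a m r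
      proof -
        have "a * (r - m div a) + m = a * r"
          using that by (simp add: diff_mult_distrib2) (metis add.commute div_le_mono le_add_diff_inverse less_imp_le mult_le_mono2 dvd_mult_div_cancel)
        then have "s ^ (a * r) = s ^ (a * (r - m div a)) * s ^ m" by (metis power_add)
        then show ?thesis using that(1) by (simp add: power_mult[symmetric] power_inverse field_simps)
      qed
      have "det (fst M) ^ (R - k * d div CARD('a)) * det (snd M) ^ (R' - l * d div CARD('b)) * x d M =
          s ^ (CARD('a) * R) * u ^ (CARD('b) * R') * x d N" if "d \<in> E" for d
      proof -
        have "d \<in> D" "CARD('a) dvd k * d" "CARD('b) dvd l * d" using that by (auto simp: E_def)
        then show ?thesis
          using dD[of d] s u by (simp add: c N_def x_scale)
      qed
      then have "(\<Sum>d\<in>E. det (fst M) ^ (R - k * d div CARD('a)) * det (snd M) ^ (R' - l * d div CARD('b)) * x d M) =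
          s ^ (CARD('a) * R) * u ^ (CARD('b) * R') * (\<Sum>d\<in>E. x d N)"
        by (simp add: sum_distrib_left)
      then show ?thesis using N by simp
    qed
    then show "mpol_eval (entries M) (\<Sum>d\<in>E. p d F) = mpol_eval (entries M) 0"
      by (simp add: mpol_eval_simps ev)
  qed
  have const: "mpol_eval a (homogeneous_part 0 Q) = lookup Q 0" for a
  proof -
    have "mpol_eval (\<lambda>v. 0 * a v) (homogeneous_part 0 Q) = 0 ^ 0 * mpol_eval a (homogeneous_part 0 Q)"
      by (rule mpol_eval_homogeneous[OF homogeneous_homogeneous_part])
    then have "mpol_eval a (homogeneous_part 0 Q) = lookup (homogeneous_part 0 Q) 0" by (simp add: lookup_0_eval)
    then show ?thesis by (simp add: homogeneous_part_def lookup_restrict_keys total_degree_def)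
  qed
  have c0: "lookup Q 0 \<noteq> 0"
  proof -
    have "lookup (0 :: ('a + 'b) mpol) = (\<lambda>_. 0)" by (rule ext) simp
    then show ?thesis using Q0 by (simp add: coeff_eval_def lookup_0_eval)
  qed
  then have "0 \<in> keys Q" by (simp add: in_keys_iff)
  then have "0 \<in> D" unfolding D_def by (rule image_eqI[rotated]) (simp add: total_degree_def)
  then have "0 \<in> E" by (simp add: E_def)
  have p0: "p 0 F = Const (lookup Q 0) * q"
    by (rule mpol_eqI_entries)
       (simp add: p_def q_def mpol_eval_simps ev_h[OF F] coeff_eval_def const)
  have "q \<noteq> 0"
  proof
    assume "q = 0"
    then have "mpol_eval (entries (mat 1, mat 1)) q = 0" by (simp add: mpol_eval_simps)
    then show False by (simp add: q_def mpol_eval_simps eval_det1 eval_det2)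
  qed
  have sum: "(\<Sum>d\<in>E. fischer (p d F) q) = 0"
    using sum0 by (simp flip: fischer_sum_left)
  have p0': "fischer (p 0 F) q \<noteq> 0"
    using fischer_self_nonzero[OF \<open>q \<noteq> 0\<close>] c0 by (simp add: p0 fischer_Const_left)
  \<comment> \<open>The part of degree 0 is a nonzero multiple of \<open>q\<close> and pairs
    nontrivially with \<open>q\<close>, while the sum over all degrees is 0. So some part of
    positive degree pairs nontrivially, and that pairing is the invariant.\<close>
  have "\<exists>d. d \<in> E \<and> d \<noteq> 0 \<and> fischer (p d F) q \<noteq> 0"
  proof (rule ccontr)
    assume "\<nexists>d. d \<in> E \<and> d \<noteq> 0 \<and> fischer (p d F) q \<noteq> 0"
    then have "(\<Sum>d\<in>E - {0}. fischer (p d F) q) = 0" by (intro sum.neutral) blast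
    moreover have "finite E" using finD by (simp add: E_def)
    ultimately show False using sum p0' \<open>0 \<in> E\<close> by (simp add: sum.remove)
  qed
  then obtain d where d: "d \<in> E" "d \<noteq> 0" "fischer (p d F) q \<noteq> 0" by blast
  have "polyfam (0 + d) (p d)" unfolding p_def by (intro polyfam_mult polyfam_const h_fam)
  then have "polyfun d (\<lambda>v. fischer (p d v) q)" by (intro polyfun_fischer) simp
  then obtain P where P: "homogeneous d P" "\<And>v. fischer (p d v) q = coeff_eval P v"
    unfolding polyfun_def by blast
  have inv: "coeff_eval P (lact g v) = coeff_eval P v"
    if "det (fst g) = 1" "det (snd g) = 1" "bihom k l v" for g v
  proof -
    have "p d (lact g v) = linear_subst (left_mult g) (p d v)"
      by (rule mpol_eqI_entries)
         (simp add: p_def eval_left_mult mpol_eval_simps h_inv[OF that(3)] eval_det1 eval_det2 pair_mult_def det_mul that)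
    then show ?thesis
      using fischer_left_mult[OF that(1,2), of "p d v" R R'] by (simp add: P(2)[symmetric] q_def)
  qed
  have "d > 0" "coeff_eval P F \<noteq> 0" using d by (simp_all add: P(2)[symmetric])
  then show thesis using that[of d P] P(1) inv by blast
qed

section \<open>Semistability\<close>

lemma matrix_inv_mult:
  fixes A :: "complex^'n^'n"
  assumes "det A \<noteq> 0"
  shows "matrix_inv A ** A = mat 1" "A ** matrix_inv A = mat 1"
proof -
  have "\<exists>B. A ** B = mat 1 \<and> B ** A = mat 1"
    using assms invertible_det_nz[of A] by (simp add: invertible_def)
  then have "A ** matrix_inv A = mat 1 \<and> matrix_inv A ** A = mat 1"
    unfolding matrix_inv_def by (rule someI_ex)
  then show "matrix_inv A ** A = mat 1" "A ** matrix_inv A = mat 1" by simp_all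
qed

lemma matrix_inv_eqI:
  fixes A :: "complex^'n^'n"
  assumes "A ** B = mat 1"
  shows "matrix_inv A = B"
proof -
  have "det A * det B = 1" using assms by (metis det_I det_mul)
  then have "det A \<noteq> 0" by auto
  then have "matrix_inv A ** (A ** B) = B" by (simp add: matrix_mul_assoc matrix_inv_mult)
  then show ?thesis using assms by simp
qed

lemma det_matrix_inv:
  fixes A :: "complex^'n^'n"
  assumes "det A = 1"
  shows "det (matrix_inv A) = 1"
proof -
  have "det (matrix_inv A) * det A = 1"
    using matrix_inv_mult(1)[of A] assms by (metis det_I det_mul zero_neq_one)
  with assms show ?thesis by simp
qed

definition pair_inverse :: "('m::finite, 'n::finite) mat_pair \<Rightarrow> ('m, 'n) mat_pair" where
  "pair_inverse g = (matrix_inv (fst g), matrix_inv (snd g))"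

lemma SL_SL_iff: "g \<in> SL_SL \<longleftrightarrow> det (fst g) = 1 \<and> det (snd g) = 1"
  by (cases g) (simp add: SL_SL_def)

lemma pair_inverse_SL: "g \<in> SL_SL \<Longrightarrow> pair_inverse g \<in> SL_SL"
  by (simp add: SL_SL_iff pair_inverse_def det_matrix_inv)

lemma pair_mult_SL: "g \<in> SL_SL \<Longrightarrow> h \<in> SL_SL \<Longrightarrow> pair_mult g h \<in> SL_SL"
  by (simp add: SL_SL_iff pair_mult_def det_mul)

lemma pair_inverse_pair_inverse: "g \<in> SL_SL \<Longrightarrow> pair_inverse (pair_inverse g) = g"
  by (simp add: SL_SL_iff pair_inverse_def prod_eq_iff matrix_inv_eqI matrix_inv_mult)

lemma pair_mult_pair_inverse: "g \<in> SL_SL \<Longrightarrow> pair_mult g (pair_inverse g) = (mat 1, mat 1)" "g \<in> SL_SL \<Longrightarrow> pair_mult (pair_inverse g) g = (mat 1, mat 1)"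
  by (simp_all add: SL_SL_iff pair_inverse_def pair_mult_def matrix_inv_mult)

lemma pair_mult_assoc: "pair_mult (pair_mult f g) h = pair_mult f (pair_mult g h)"
  by (simp add: pair_mult_def matrix_mul_assoc)

lemma act_pair_inverse: "act g F = lact (pair_inverse g) F"
  by (simp add: act_eq_lact pair_inverse_def)

lemma lact_act: "N \<in> SL_SL \<Longrightarrow> lact N F = act (pair_inverse N) F"
  by (simp add: act_pair_inverse pair_inverse_pair_inverse)

text \<open>\<open>act\<close> goes through inverses and \<open>lact\<close> does not; inversion
  permutes the group, so statements about all translates agree.\<close>

lemma ball_act_iff: "(\<forall>g\<in>SL_SL. R (act g F)) \<longleftrightarrow> (\<forall>N\<in>SL_SL. R (lact N F))"
  by (metis act_pair_inverse lact_act pair_inverse_SL)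

text \<open>Each matrix is divided by a root of its determinant, of order the size of the
  matrix.\<close>

lemma lact_invertible:
  assumes "bihom k l F" "invertible (fst h)" "invertible (snd h)"
  obtains N c where "N \<in> SL_SL" "c \<noteq> 0" "lact h F = Const c * lact N F"
proof -
  have nz: "det (fst h) \<noteq> 0" "det (snd h) \<noteq> 0" using assms(2,3) invertible_det_nz by blast+
  obtain s where s: "s \<noteq> 0" "det (fst h) = s ^ CARD('a option)"
    using exists_complex_root_nonzero[OF nz(1), of "CARD('a option)"] zero_less_card_finite by (metis less_irrefl)
  obtain u where u: "u \<noteq> 0" "det (snd h) = u ^ CARD('b option)"
    using exists_complex_root_nonzero[OF nz(2), of "CARD('b option)"] zero_less_card_finite by (metis less_irrefl)
  let ?N = "scale_pair (inverse s) (inverse u) h"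
  have "det (fst ?N) = 1" "det (snd ?N) = 1"
    unfolding det_scale_pair s u using s(1) u(1) by (simp_all only: power_mult_distrib[symmetric]) simp_all
  then have "?N \<in> SL_SL" by (simp add: SL_SL_iff)
  moreover have "scale_pair s u ?N = h"
    using s(1) u(1) by (simp add: scale_pair_def prod_eq_iff vec_eq_iff)
  then have "lact h F = Const (s ^ k * u ^ l) * lact ?N F" using lact_scale_pair[OF assms(1), of s u ?N] by simp
  moreover have "s ^ k * u ^ l \<noteq> 0" using s(1) u(1) by simp
  ultimately show thesis using that by blast
qed

lemma Conv_Const_mult: "c \<noteq> 0 \<Longrightarrow> Conv (Const c * F) = Conv F"
  by (simp add: Conv_def keys_Const_mult)

text \<open>Carries a property \<open>R\<close> of polytopes from the group to the reductions at a
  place, of which only invertibility is known.\<close>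

lemma Conv_invertible:
  assumes "bihom k l F" "\<And>N. N \<in> SL_SL \<Longrightarrow> R (Conv (lact N F))" "invertible (fst h)" "invertible (snd h)"
  shows "R (Conv (lact h F))"
proof -
  obtain N c where "N \<in> SL_SL" "c \<noteq> 0" "lact h F = Const c * lact N F"
    by (rule lact_invertible[OF assms(1,3,4)])
  with assms(2)[of N] show ?thesis by (simp add: Conv_Const_mult)
qed

text \<open>A point of the Zariski closure of a family of points is a specialisation of the family.\<close>

lemma place_of_closure:
  fixes \<Phi> :: "'x \<Rightarrow> 'v mpol"
  assumes "z \<notin> J" "\<And>Q. (\<And>p. p \<in> J \<Longrightarrow> coeff_eval Q (\<Phi> p) = 0) \<Longrightarrow> coeff_eval Q (\<Phi> z) = 0"
  obtains B where "place J z B" "\<And>Q. (\<lambda>p. coeff_eval Q (\<Phi> p)) \<in> B"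
proof -
  define B0 where "B0 = {\<lambda>p. coeff_eval Q (\<Phi> p) |Q. True}"
  have mem: "f \<in> B0" if "\<And>p. f p = coeff_eval Q (\<Phi> p)" for f Q
    using that unfolding B0_def by (auto simp: fun_eq_iff)
  have "partial_place J z B0"
    unfolding partial_place_def
  proof (intro conjI allI ballI impI)
    fix c show "(\<lambda>_. c) \<in> B0" by (rule mem[of _ "Const c"]) (simp add: coeff_eval_def mpol_eval_simps)
  next
    fix a b assume "a \<in> B0" "b \<in> B0"
    then obtain P Q where PQ: "a = (\<lambda>p. coeff_eval P (\<Phi> p))" "b = (\<lambda>p. coeff_eval Q (\<Phi> p))"
      unfolding B0_def by blast
    show "(\<lambda>p. a p + b p) \<in> B0" by (rule mem[of _ "P + Q"]) (simp add: PQ coeff_eval_def mpol_eval_simps)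
    show "(\<lambda>p. a p * b p) \<in> B0" by (rule mem[of _ "P * Q"]) (simp add: PQ coeff_eval_def mpol_eval_simps)
  next
    fix b assume "b \<in> B0" "\<forall>p\<in>J. b p = 0"
    then obtain Q where "b = (\<lambda>p. coeff_eval Q (\<Phi> p))" unfolding B0_def by blast
    with \<open>\<forall>p\<in>J. b p = 0\<close> assms(2)[of Q] show "b z = 0" by simp
  qed
  then obtain B where B: "B0 \<subseteq> B" "partial_place J z B"
    "\<And>B'. partial_place J z B' \<Longrightarrow> B \<subseteq> B' \<Longrightarrow> B' = B"
    by (rule partial_place_extend) (rule that)
  have "place J z B" by (rule place.intro[OF B(2,3) assms(1)])
  moreover have "(\<lambda>p. coeff_eval Q (\<Phi> p)) \<in> B" for Q
    using B(1) mem[of "\<lambda>p. coeff_eval Q (\<Phi> p)" Q] by blast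
  ultimately show thesis by (rule that)
qed

lemma coeff_eval_Var: "coeff_eval (Var I) F = lookup F I"
  by (simp add: coeff_eval_def mpol_eval_simps)

theorem semistable_of_centroid:
  fixes F :: "('m::finite, 'n::finite) var mpol"
  assumes F: "bihom k l F" "F \<noteq> 0" and cen: "\<And>N. N \<in> SL_SL \<Longrightarrow> centroid k l \<in> Conv (lact N F)"
  shows "git_semistable k l F"
proof -
  have "\<exists>Q. (\<forall>N\<in>SL_SL. coeff_eval Q (lact N F) = 0) \<and> coeff_eval Q 0 \<noteq> 0"
  proof (rule ccontr)
    assume no: "\<nexists>Q. (\<forall>N\<in>SL_SL. coeff_eval Q (lact N F) = 0) \<and> coeff_eval Q 0 \<noteq> 0"
    \<comment> \<open>\<open>Some N\<close> labels the points of the orbit; \<open>None\<close> is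
      the extra point of the place and carries the limit 0.\<close>
    define \<Phi> where "\<Phi> = (\<lambda>p. case p of None \<Rightarrow> 0 | Some N \<Rightarrow> lact N F)"
    \<comment> \<open>The value at \<open>None\<close> is a placeholder: germs see only the points
      of \<open>J\<close>.\<close>
    define g where "g = (\<lambda>p :: ('m, 'n) mat_pair option. case p of None \<Rightarrow> (mat 1, mat 1) | Some N \<Rightarrow> N)"
    have cl: "coeff_eval Q (\<Phi> None) = 0" if "\<And>p. p \<in> Some ` SL_SL \<Longrightarrow> coeff_eval Q (\<Phi> p) = 0" for Q
    proof -
      have "\<forall>N\<in>SL_SL. coeff_eval Q (lact N F) = 0"
      proof
        fix N :: "('m, 'n) mat_pair" assume "N \<in> SL_SL"
        then show "coeff_eval Q (lact N F) = 0" using that[of "Some N"] by (simp add: \<Phi>_def)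
      qed
      with no show ?thesis by (auto simp: \<Phi>_def)
    qed
    have none: "None \<notin> Some ` (SL_SL :: ('m, 'n) mat_pair set)" by auto
    obtain B where B: "place (Some ` SL_SL) None B" "\<And>Q. (\<lambda>p. coeff_eval Q (\<Phi> p)) \<in> B"
      by (rule place_of_closure[of None "Some ` SL_SL" \<Phi>, OF none cl]) (assumption, rule that)
    interpret place "Some ` SL_SL" None B by (rule B(1))
    have det: "eventually (\<lambda>p. det (fst (g p)) = 1 \<and> det (snd (g p)) = 1) near"
      by (rule near_J) (auto simp: g_def SL_SL_iff)
    have "infinitesimal (\<lambda>p. lookup (lact (g p) F) I)" for I
    proof (rule infinitesimal_cong)
      show "infinitesimal (\<lambda>p. lookup (\<Phi> p) I)" unfolding infinitesimal_def
        by (rule bexI[of _ "\<lambda>p. lookup (\<Phi> p) I"])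
           (use B(2)[of "Var I"] in \<open>simp_all add: coeff_eval_Var \<Phi>_def\<close>)
      show "eventually (\<lambda>p. lookup (\<Phi> p) I = lookup (lact (g p) F) I) near"
        by (rule near_J) (auto simp: g_def \<Phi>_def)
    qed
    moreover have "\<exists>I. \<not> infinitesimal (\<lambda>p. lookup (lact (g p) F) I)"
      by (rule not_infinitesimal_of_centroid[OF det F(1)])
         (rule Conv_invertible[OF F(1), where R = "\<lambda>C. centroid k l \<in> C"], rule cen)
    ultimately show False by blast
  qed
  then obtain Q where Q: "\<forall>N\<in>SL_SL. coeff_eval Q (lact N F) = 0" "coeff_eval Q 0 \<noteq> 0" by blast
  have van: "coeff_eval Q (lact N F) = 0" if "det (fst N) = 1" "det (snd N) = 1" for N
    using Q(1) that by (simp add: SL_SL_iff)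
  obtain d P where P: "d > 0" "homogeneous d P" "coeff_eval P F \<noteq> 0"
    "\<And>g v. det (fst g) = 1 \<Longrightarrow> det (snd g) = 1 \<Longrightarrow> bihom k l v \<Longrightarrow> coeff_eval P (lact g v) = coeff_eval P v"
    by (rule invariant_of_vanishing[OF F(1) van Q(2)]) (assumption, assumption, rule that)
  have "invariant_form k l d P" unfolding invariant_form_def
  proof (intro conjI ballI P(2))
    fix g :: "('m, 'n) mat_pair" and v :: "('m, 'n) var mpol"
    assume "g \<in> SL_SL" "v \<in> bihom_space k l"
    then show "coeff_eval P (act g v) = coeff_eval P v"
      using P(4)[of "pair_inverse g" v] pair_inverse_SL[of g] by (simp add: act_pair_inverse SL_SL_iff bihom_space_eq)
  qed
  then show ?thesis unfolding git_semistable_def using F P(1,3) by (auto simp: bihom_space_eq)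
qed

lemma invariant_form_lact:
  "invariant_form k l d P \<Longrightarrow> N \<in> SL_SL \<Longrightarrow> bihom k l v \<Longrightarrow> coeff_eval P (lact N v) = coeff_eval P v"
  by (simp add: invariant_form_def lact_act pair_inverse_SL bihom_space_eq)

lemma coeff_eval_0_homogeneous:
  assumes "homogeneous d P" "d > 0"
  shows "coeff_eval P 0 = 0"
  using coeff_eval_scale[OF assms(1), of 0 0] assms(2) by (simp add: power_0_left split: if_splits)

lemma git_semistable_lact:
  assumes "git_semistable k l F" "N \<in> SL_SL"
  shows "git_semistable k l (lact N F)"
proof -
  obtain d P where P: "d > 0" "invariant_form k l d P" "coeff_eval P F \<noteq> 0"
    using assms(1) by (auto simp: git_semistable_def)
  have F: "bihom k l F" using assms(1) by (simp add: git_semistable_def bihom_space_eq)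
  have *: "coeff_eval P (lact N F) \<noteq> 0" using P invariant_form_lact[OF P(2) assms(2) F] by simp
  moreover have "lact N F \<noteq> 0"
    using * coeff_eval_0_homogeneous[of d P] P(1,2) by (auto simp: invariant_form_def)
  ultimately show ?thesis unfolding git_semistable_def
    using P(1,2) bihom_lact[OF F] by (auto simp: bihom_space_eq)
qed

text \<open>The direction \<open>a\<close>, extended by 0 to the last coordinates and shifted by its
  mean in each block. The shift gives determinant one and makes the pairing with an exponent vector
  relative to the centroid.\<close>

definition torus_weight :: "real^('m::finite + 'n::finite) \<Rightarrow> 'm option + 'n option \<Rightarrow> real" where
  "torus_weight a v = (case v of
      Inl i \<Rightarrow> (case i of None \<Rightarrow> 0 | Some i \<Rightarrow> a $ Inl i) - (\<Sum>i\<in>UNIV. a $ Inl i) / real (CARD('m) + 1)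
    | Inr j \<Rightarrow> (case j of None \<Rightarrow> 0 | Some j \<Rightarrow> a $ Inr j) - (\<Sum>j\<in>UNIV. a $ Inr j) / real (CARD('n) + 1))"

text \<open>Real exponents are allowed, so a separating direction need not be made rational: the
  arguments rest on limits and injectivity.\<close>

definition torus :: "real^('m::finite + 'n::finite) \<Rightarrow> real \<Rightarrow> ('m, 'n) mat_pair" where
  "torus a s = diag_pair (\<lambda>v. exp (of_real (s * torus_weight a v)))"

lemma sum_option_weight:
  "(\<Sum>i\<in>UNIV. ((case i of None \<Rightarrow> 0 | Some i \<Rightarrow> f i) - c) * L i) =
    (\<Sum>i\<in>UNIV. f i * L (Some i)) - c * (\<Sum>i\<in>UNIV. (L :: 'a::finite option \<Rightarrow> real) i)"
  by (simp add: left_diff_distrib sum_subtractf sum_UNIV_option sum_distrib_left distrib_left)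

lemma sum_torus_weight:
  "(\<Sum>i\<in>UNIV. torus_weight (a :: real^('m::finite + 'n::finite)) (Inl i)) = 0"
  "(\<Sum>j\<in>UNIV. torus_weight (a :: real^('m::finite + 'n::finite)) (Inr j)) = 0"
  using sum_option_weight[of "\<lambda>i. a $ Inl i" "(\<Sum>i\<in>UNIV. a $ Inl i) / real (CARD('m) + 1)" "\<lambda>_. 1"]
    sum_option_weight[of "\<lambda>i. a $ Inr i" "(\<Sum>i\<in>UNIV. a $ Inr i) / real (CARD('n) + 1)" "\<lambda>_. 1"]
  by (simp_all add: torus_weight_def card_UNIV_option add.commute)

lemma torus_SL: "torus a s \<in> SL_SL"
proof -
  have "(\<Prod>i\<in>UNIV. exp (complex_of_real (s * torus_weight a (Inl i)))) = 1"
    "(\<Prod>j\<in>UNIV. exp (complex_of_real (s * torus_weight a (Inr j)))) = 1"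
    by (simp_all only: exp_sum[OF finite, symmetric] of_real_sum[symmetric] sum_distrib_left[symmetric] sum_torus_weight) simp_all
  then show ?thesis by (simp add: SL_SL_iff torus_def diag_pair_def det_diag_mat)
qed

lemma sum_torus_weight_monom:
  fixes a :: "real^('m::finite + 'n::finite)"
  assumes "bidegree k l I"
  shows "(\<Sum>v\<in>UNIV. torus_weight a v * real (lookup I v)) = inner a (xi I) - inner a (centroid k l)"
proof -
  have k: "real k = (\<Sum>i\<in>UNIV. real (lookup I (Inl i)))"
    and l: "real l = (\<Sum>j\<in>UNIV. real (lookup I (Inr j)))"
    using assms by (auto simp: bidegree_def)
  have 1: "(\<Sum>i\<in>UNIV. torus_weight a (Inl i) * real (lookup I (Inl i))) =
      (\<Sum>i\<in>UNIV. a $ Inl i * real (lookup I (Inl (Some i)))) -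
      (\<Sum>i\<in>UNIV. a $ Inl i) * (real k / real (CARD('m) + 1))"
    by (simp add: torus_weight_def sum_option_weight k)
  have 2: "(\<Sum>i\<in>UNIV. torus_weight a (Inr i) * real (lookup I (Inr i))) =
      (\<Sum>i\<in>UNIV. a $ Inr i * real (lookup I (Inr (Some i)))) -
      (\<Sum>i\<in>UNIV. a $ Inr i) * (real l / real (CARD('n) + 1))"
    by (simp add: torus_weight_def sum_option_weight l)
  show ?thesis
    unfolding sum_UNIV_sum 1 2
    by (simp add: inner_vec_def sum_UNIV_sum xi_def centroid_def sum_distrib_right sum_divide_distrib)
qed

lemma lookup_lact_torus:
  assumes "bihom k l F"
  shows "lookup (lact (torus a s) F) I =
    exp (of_real (s * (inner a (xi I) - inner a (centroid k l)))) * lookup F I"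
proof (cases "I \<in> keys F")
  case True
  then have I: "bidegree k l I" using assms by (simp add: bihom_def)
  have "mono_eval (\<lambda>v. exp (complex_of_real (s * torus_weight a v))) I =
      exp (\<Sum>v\<in>UNIV. of_nat (lookup I v) * complex_of_real (s * torus_weight a v))"
    by (simp only: mono_eval_UNIV exp_sum[OF finite] exp_of_nat_mult)
  also have "(\<Sum>v\<in>UNIV. of_nat (lookup I v) * complex_of_real (s * torus_weight a v)) =
      of_real (s * (\<Sum>v\<in>UNIV. torus_weight a v * real (lookup I v)))"
    by (simp add: sum_distrib_left mult_ac)
  finally show ?thesis
    by (simp only: torus_def lookup_lact_diag sum_torus_weight_monom[OF I])
next
  case False
  then show ?thesis by (simp add: torus_def lookup_lact_diag in_keys_iff)
qed

lemma tendsto_coeff_eval: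
  assumes "\<And>I. ((\<lambda>s. lookup (f s) I) \<longlongrightarrow> lookup G I) A"
  shows "((\<lambda>s. coeff_eval P (f s)) \<longlongrightarrow> coeff_eval P G) A"
  unfolding coeff_eval_def mpol_eval_def by (intro tendsto_intros assms)

text \<open>Monomials on the supporting hyperplane are fixed; all others decay
  exponentially.\<close>

lemma torus_limit:
  assumes F: "bihom k l F" and a: "\<And>I. I \<in> keys F \<Longrightarrow> inner a (centroid k l) \<le> inner a (xi I)"
  shows "((\<lambda>s. lookup (lact (torus a (- s)) F) I) \<longlongrightarrow>
    lookup (restrict_keys (\<lambda>I. inner a (xi I) = inner a (centroid k l)) F) I) at_top"
proof -
  let ?w = "inner a (xi I) - inner a (centroid k l)"
  have eq: "lookup (lact (torus a (- s)) F) I = of_real (exp (- s * ?w)) * lookup F I" for s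
    by (simp only: lookup_lact_torus[OF F] exp_of_real)
  consider "lookup F I = 0" | "?w = 0" | "?w > 0" using a[of I] by (fastforce simp: in_keys_iff)
  then show ?thesis
  proof cases
    case 1
    then show ?thesis unfolding eq lookup_restrict_keys by simp
  next
    case 2
    then show ?thesis unfolding eq lookup_restrict_keys by simp
  next
    case 3
    then have "((\<lambda>s. exp (- s * ?w)) \<longlongrightarrow> 0) at_top" by real_asymp
    then have "((\<lambda>s. of_real (exp (- s * ?w)) * lookup F I) \<longlongrightarrow> of_real 0 * lookup F I) at_top"
      by (intro tendsto_mult tendsto_of_real tendsto_const)
    then show ?thesis unfolding eq lookup_restrict_keys using 3 by simp
  qed
qed

theorem centroid_of_semistable:
  fixes F :: "('m::finite, 'n::finite) var mpol"
  assumes "git_semistable k l F"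
  shows "centroid k l \<in> Conv F"
proof (rule ccontr)
  assume not: "centroid k l \<notin> Conv F"
  obtain d P where P: "d > 0" "invariant_form k l d P" "coeff_eval P F \<noteq> 0"
    using assms by (auto simp: git_semistable_def)
  have F: "bihom k l F" using assms by (simp add: git_semistable_def bihom_space_eq)
  have "convex (Conv F)" "closed (Conv F)"
    by (simp_all add: Conv_def finite_imp_compact_convex_hull compact_imp_closed)
  from separating_hyperplane_closed_point[OF this not] obtain a b
    where ab: "inner a (centroid k l) < b" "\<And>x. x \<in> Conv F \<Longrightarrow> inner a x > b" by blast
  have w: "inner a (centroid k l) < inner a (xi I)" if "I \<in> keys F" for I
    using ab(1) ab(2)[of "xi I"] that hull_inc[of "xi I" "xi ` keys F" convex] by (auto simp: Conv_def)
  \<comment> \<open>The separation is strict, so no monomial survives in the limit.\<close>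
  have "restrict_keys (\<lambda>I. inner a (xi I) = inner a (centroid k l)) F = 0"
    by (rule poly_mapping_eqI) (use w in \<open>force simp: lookup_restrict_keys in_keys_iff\<close>)
  then have "((\<lambda>s. coeff_eval P (lact (torus a (- s)) F)) \<longlongrightarrow> coeff_eval P 0) at_top"
    using torus_limit[OF F less_imp_le[OF w]] by (intro tendsto_coeff_eval) simp
  moreover have "coeff_eval P (lact (torus a (- s)) F) = coeff_eval P F" for s
    by (rule invariant_form_lact[OF P(2) torus_SL F])
  moreover have "coeff_eval P 0 = 0"
    using P(1,2) by (intro coeff_eval_0_homogeneous) (auto simp: invariant_form_def)
  ultimately show False using P(3) by (simp add: tendsto_const_iff)
qed

section \<open>Stability\<close>

lemma proj_pt_eq_iff: "proj_pt F = proj_pt G \<longleftrightarrow> (\<exists>c. c \<noteq> 0 \<and> F = Const c * G)"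
proof
  assume "proj_pt F = proj_pt G"
  moreover have "F \<in> proj_pt F" unfolding proj_pt_def mem_Collect_eq by (rule exI[of _ 1]) simp
  ultimately have "F \<in> proj_pt G" by simp
  then show "\<exists>c. c \<noteq> 0 \<and> F = Const c * G" unfolding proj_pt_def by blast
next
  assume "\<exists>c. c \<noteq> 0 \<and> F = Const c * G"
  then obtain c where c: "c \<noteq> 0" "F = Const c * G" by blast
  have G: "G = Const (inverse c) * F"
    using c(1) by (simp add: c(2) mult.assoc[symmetric] flip: Const_mult)
  show "proj_pt F = proj_pt G"
  proof (intro subset_antisym subsetI)
    fix H assume "H \<in> proj_pt F"
    then obtain d where "d \<noteq> 0" "H = Const d * F" unfolding proj_pt_def by blast
    then have "H = Const (d * c) * G" "d * c \<noteq> 0" using c by (simp_all add: Const_mult mult.assoc)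
    then show "H \<in> proj_pt G" unfolding proj_pt_def by blast
  next
    fix H assume "H \<in> proj_pt G"
    then obtain d where d: "d \<noteq> 0" "H = Const d * G" unfolding proj_pt_def by blast
    have "H = Const d * (Const (inverse c) * F)" by (simp only: d(2) G[symmetric])
    then have "H = Const (d * inverse c) * F" by (simp only: Const_mult mult.assoc)
    moreover have "d * inverse c \<noteq> 0" using c(1) d(1) by simp
    ultimately have "H = Const (d * inverse c) * F" "d * inverse c \<noteq> 0" by blast+
    then show "H \<in> proj_pt F" unfolding proj_pt_def by blast
  qed
qed

text \<open>A convex set with empty interior lies in a hyperplane, whose normal is constant on it.
  This covers degenerate polytopes; otherwise there is a genuine supporting hyperplane.\<close>

lemma supporting_direction:
  fixes S :: "'a::euclidean_space set"
  assumes "convex S" "x \<in> S" "x \<notin> interior S"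
  obtains a where "a \<noteq> 0" "\<And>y. y \<in> S \<Longrightarrow> inner a x \<le> inner a y"
proof (cases "interior S = {}")
  case True
  then obtain a b where "a \<noteq> 0" "S \<subseteq> {y. inner a y = b}"
    using empty_interior_subset_hyperplane[OF assms(1)] by metis
  then have "inner a y = b" if "y \<in> S" for y using that by blast
  with \<open>a \<noteq> 0\<close> assms(2) show thesis by (intro that[of a]) simp_all
next
  case False
  then have "x \<notin> rel_interior S" using assms(3) interior_rel_interior_gen by (simp add: rel_interior_nonempty_interior)
  moreover have "x \<in> closure S" using assms(2) closure_subset by blast
  ultimately obtain a where "a \<noteq> 0" "\<And>y. y \<in> closure S \<Longrightarrow> inner a x \<le> inner a y"
    using supporting_hyperplane_relative_frontier[OF assms(1), of x] by metis
  with closure_subset[of S] show thesis by (intro that[of a]) auto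
qed

text \<open>The weight at a last coordinate is minus the mean of its block, so if all weights vanish
  then \<open>a\<close> is 0. One nonzero weight suffices, the real exponential being
  injective.\<close>

lemma inj_torus:
  assumes "a \<noteq> 0"
  shows "inj (torus a)"
proof (rule injI)
  fix s t :: real assume st: "torus a s = torus a t"
  obtain v where v: "torus_weight a v \<noteq> 0"
  proof (rule ccontr)
    assume "\<not> thesis"
    with that have z: "torus_weight a v = 0" for v by blast
    have "a $ v = 0" for v
    proof (cases v)
      case (Inl i)
      then show ?thesis using z[of "Inl None"] z[of "Inl (Some i)"] by (simp add: torus_weight_def)
    next
      case (Inr i)
      then show ?thesis using z[of "Inr None"] z[of "Inr (Some i)"] by (simp add: torus_weight_def)
    qed
    then have "a = 0" by (simp add: vec_eq_iff)
    with assms show False by simp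
  qed
  have "exp (complex_of_real (s * torus_weight a v)) = exp (complex_of_real (t * torus_weight a v))"
  proof (cases v)
    case (Inl i)
    from arg_cong[OF st, of "\<lambda>M. fst M $ i $ i"] show ?thesis
      by (simp add: Inl torus_def diag_pair_def diag_mat_def)
  next
    case (Inr i)
    from arg_cong[OF st, of "\<lambda>M. snd M $ i $ i"] show ?thesis
      by (simp add: Inr torus_def diag_pair_def diag_mat_def)
  qed
  then have "exp (s * torus_weight a v) = exp (t * torus_weight a v)"
    by (simp only: exp_of_real of_real_eq_iff)
  with v show "s = t" by simp
qed

theorem centroid_interior_of_stable:
  fixes F :: "('m::finite, 'n::finite) var mpol"
  assumes st: "git_stable k l F" and N: "N \<in> SL_SL"
  shows "centroid k l \<in> interior (Conv (lact N F))"
proof (rule ccontr)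
  let ?F = "lact N F"
  assume not: "centroid k l \<notin> interior (Conv ?F)"
  have ss: "git_semistable k l F" and fin: "finite (stabilizer F)"
    and cl: "zariski_closed_in (semistable_locus k l) (orbit F)"
    using st by (simp_all add: git_stable_def)
  have F: "bihom k l F" using ss by (simp add: git_semistable_def bihom_space_eq)
  have ss': "git_semistable k l ?F" by (rule git_semistable_lact[OF ss N])
  have F': "bihom k l ?F" by (rule bihom_lact[OF F])
  obtain a where a: "a \<noteq> 0" "\<And>y. y \<in> Conv ?F \<Longrightarrow> inner a (centroid k l) \<le> inner a y"
    using supporting_direction[OF _ centroid_of_semistable[OF ss'] not] by (auto simp: Conv_def)
  have w: "inner a (centroid k l) \<le> inner a (xi I)" if "I \<in> keys ?F" for I
    using a(2)[of "xi I"] that hull_inc[of "xi I" "xi ` keys ?F" convex] by (auto simp: Conv_def)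
  define G where "G = restrict_keys (\<lambda>I. inner a (xi I) = inner a (centroid k l)) ?F"
  have lim: "((\<lambda>s. lookup (lact (torus a (- s)) ?F) I) \<longlongrightarrow> lookup G I) at_top" for I
    unfolding G_def by (rule torus_limit[OF F' w])
  have G: "bihom k l G" using F' by (auto simp: bihom_def G_def keys_restrict_keys)
  obtain d P where P: "d > 0" "invariant_form k l d P" "coeff_eval P ?F \<noteq> 0"
    using ss' by (auto simp: git_semistable_def)
  have "((\<lambda>s. coeff_eval P (lact (torus a (- s)) ?F)) \<longlongrightarrow> coeff_eval P G) at_top"
    by (rule tendsto_coeff_eval) (rule lim)
  moreover have "coeff_eval P (lact (torus a (- s)) ?F) = coeff_eval P ?F" for s
    by (rule invariant_form_lact[OF P(2) torus_SL F'])
  \<comment> \<open>The invariant is constant along the path and so nonzero at the limit. Hence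
    \<open>G\<close> is semistable, and closedness of the orbit in the semistable locus applies to
    it.\<close>
  ultimately have PG: "coeff_eval P G \<noteq> 0" using P(3) by (simp add: tendsto_const_iff)
  then have "G \<noteq> 0" using coeff_eval_0_homogeneous[of d P] P(1,2) by (auto simp: invariant_form_def)
  then have ssG: "git_semistable k l G"
    unfolding git_semistable_def using P(1,2) PG G by (auto simp: bihom_space_eq)
  obtain S where S: "\<forall>Q\<in>S. \<exists>d. homogeneous d Q"
    "orbit F = {p \<in> semistable_locus k l. \<forall>F\<in>p. \<forall>Q\<in>S. coeff_eval Q F = 0}"
    using cl by (auto simp: zariski_closed_in_def)
  have van: "coeff_eval Q (Const c * G) = 0" if Q: "Q \<in> S" and c: "c \<noteq> 0" for Q c
  proof -
    have "((\<lambda>s. coeff_eval Q (Const c * lact (torus a (- s)) ?F)) \<longlongrightarrow> coeff_eval Q (Const c * G)) at_top"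
      by (rule tendsto_coeff_eval) (simp only: lookup_Const_mult, intro tendsto_mult tendsto_const lim)
    moreover have "coeff_eval Q (Const c * lact (torus a (- s)) ?F) = 0" for s
    proof -
      let ?T = "pair_mult N (torus a (- s))"
      have T: "?T \<in> SL_SL" by (rule pair_mult_SL[OF N torus_SL])
      have "proj_pt (act (pair_inverse ?T) F) \<in> orbit F" unfolding orbit_def using pair_inverse_SL[OF T] by blast
      moreover have "Const c * lact (torus a (- s)) ?F \<in> proj_pt (act (pair_inverse ?T) F)"
        unfolding proj_pt_def lact_lact lact_act[OF T] using c by blast
      ultimately show ?thesis using S(2) Q by blast
    qed
    ultimately show ?thesis by (simp add: tendsto_const_iff)
  qed
  have "proj_pt G \<in> semistable_locus k l" unfolding semistable_locus_def using ssG by blast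
  moreover have "\<forall>H\<in>proj_pt G. \<forall>Q\<in>S. coeff_eval Q H = 0" using van unfolding proj_pt_def by blast
  ultimately have "proj_pt G \<in> orbit F" using S(2) by blast
  then obtain g where g: "g \<in> SL_SL" "proj_pt G = proj_pt (act g F)" unfolding orbit_def by blast
  then obtain c where c: "c \<noteq> 0" "G = Const c * lact (pair_inverse g) F"
    unfolding proj_pt_eq_iff act_pair_inverse by blast
  let ?h = "pair_inverse g"
  have h: "?h \<in> SL_SL" by (rule pair_inverse_SL[OF g(1)])
  have fix_G: "lact (torus a s) G = G" for s
    by (rule poly_mapping_eqI) (simp add: lookup_lact_torus[OF G], simp add: G_def lookup_restrict_keys)
  have fix_F: "lact (pair_mult (pair_mult ?h (torus a s)) g) F = F" for s
  proof -
    have "Const c * lact (torus a s) (lact ?h F) = Const c * lact ?h F"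
      using fix_G[of s] unfolding c(2) lact_Const_mult .
    then have "Const (inverse c) * (Const c * lact (torus a s) (lact ?h F)) = Const (inverse c) * (Const c * lact ?h F)"
      by simp
    then have e: "lact (torus a s) (lact ?h F) = lact ?h F"
      using c(1) by (simp add: mult.assoc[symmetric] flip: Const_mult)
    have "lact (pair_mult (pair_mult ?h (torus a s)) g) F = lact g (lact (torus a s) (lact ?h F))"
      by (simp add: lact_lact)
    also have "\<dots> = lact g (lact ?h F)" by (simp only: e)
    also have "\<dots> = F" by (simp add: lact_lact pair_mult_pair_inverse[OF g(1)])
    finally show ?thesis .
  qed
  \<comment> \<open>The torus fixing \<open>G\<close> is conjugated back to \<open>F\<close>; the
    outer inverse is there because \<open>act\<close> goes through inverses.\<close>
  let ?f = "\<lambda>s. pair_inverse (pair_mult (pair_mult ?h (torus a s)) g)"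
  have inSL: "pair_mult (pair_mult ?h (torus a s)) g \<in> SL_SL" for s by (intro pair_mult_SL h g(1) torus_SL)
  have "inj ?f"
  proof (rule injI)
    fix s t assume "?f s = ?f t"
    then have "pair_inverse (?f s) = pair_inverse (?f t)" by simp
    then have "pair_mult (pair_mult ?h (torus a s)) g = pair_mult (pair_mult ?h (torus a t)) g"
      using pair_inverse_pair_inverse[OF inSL[of s]] pair_inverse_pair_inverse[OF inSL[of t]] by simp
    then have "pair_mult (pair_mult g (pair_mult (pair_mult ?h (torus a s)) g)) ?h = pair_mult (pair_mult g (pair_mult (pair_mult ?h (torus a t)) g)) ?h" by simp
    moreover have "pair_mult (pair_mult g (pair_mult (pair_mult ?h (torus a r)) g)) ?h = torus a r" for r
    proof -
      have "pair_mult (pair_mult g (pair_mult (pair_mult ?h (torus a r)) g)) ?h = pair_mult (pair_mult (pair_mult g ?h) (torus a r)) (pair_mult g ?h)"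
        by (simp only: pair_mult_assoc)
      also have "\<dots> = torus a r" by (simp add: pair_mult_pair_inverse[OF g(1)]) (simp add: pair_mult_def)
      finally show ?thesis .
    qed
    ultimately have "torus a s = torus a t" by simp
    then show "s = t" using inj_torus[OF a(1)] by (simp add: inj_eq)
  qed
  moreover have "range ?f \<subseteq> stabilizer F"
  proof (rule image_subsetI)
    fix s
    have "act (?f s) F = F" using fix_F[of s] by (simp only: act_pair_inverse pair_inverse_pair_inverse[OF inSL])
    then show "?f s \<in> stabilizer F" unfolding stabilizer_def using pair_inverse_SL[OF inSL] by simp
  qed
  ultimately have "finite (UNIV :: real set)" using fin finite_subset finite_imageD by blast
  then show False using infinite_UNIV_char_0 by blast
qed

context place
begin

lemma infinitesimal_inverse_contradiction:
  assumes "integral x" "y \<in> B" "y z = 0" "eventually (\<lambda>p. y p * x p = 1) near"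
  shows False
proof -
  have "infinitesimal y" unfolding infinitesimal_def by (rule bexI[OF _ assms(2)]) (simp add: assms(3))
  with unit_not_infinitesimal[OF assms(1,4)] show False by blast
qed

end

text \<open>In an infinite stabilizer some matrix entry takes infinitely many values, and a place
  can be centred where this entry becomes infinite. But the stabilizer multiplies \<open>F\<close>
  by scalars that a nonvanishing invariant of degree \<open>d\<close> forces to be d-th roots of
  unity, so the group element is integral.\<close>

theorem finite_stabilizer:
  fixes F :: "('m::finite, 'n::finite) var mpol"
  assumes ss: "git_semistable k l F"
    and cen: "\<And>N. N \<in> SL_SL \<Longrightarrow> centroid k l \<in> interior (Conv (lact N F))"
  shows "finite (stabilizer F)"
proof (rule ccontr)
  assume inf: "infinite (stabilizer F)"
  have F: "bihom k l F" and F0: "F \<noteq> 0" using ss by (simp_all add: git_semistable_def bihom_space_eq)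
  obtain d P where P: "d > 0" "invariant_form k l d P" "coeff_eval P F \<noteq> 0"
    using ss by (auto simp: git_semistable_def)
  define S where "S = pair_inverse ` stabilizer F"
  have "inj_on pair_inverse (stabilizer F)"
    by (rule inj_on_inverseI[of _ pair_inverse]) (simp add: stabilizer_def pair_inverse_pair_inverse)
  then have infS: "infinite S" using inf by (simp add: S_def finite_image_iff)
  obtain I0 where I0: "lookup F I0 \<noteq> 0" using F0 by (metis poly_mapping_eqI lookup_zero)
  define c where "c = (\<lambda>N. lookup (lact N F) I0 / lookup F I0)"
  have S: "N \<in> SL_SL" "lact N F = Const (c N) * F" "c N ^ d = 1" if "N \<in> S" for N
  proof -
    from that obtain g where g: "g \<in> SL_SL" "proj_pt (act g F) = proj_pt F" "N = pair_inverse g"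
      unfolding S_def stabilizer_def by blast
    then show SL: "N \<in> SL_SL" by (simp add: pair_inverse_SL)
    obtain b where b: "lact N F = Const b * F" using g(2,3) unfolding proj_pt_eq_iff act_pair_inverse by blast
    have "c N = b" using I0 by (simp add: c_def b lookup_Const_mult)
    with b show e: "lact N F = Const (c N) * F" by simp
    have "c N ^ d * coeff_eval P F = coeff_eval P (Const (c N) * F)"
      using P(2) by (intro coeff_eval_scale[symmetric]) (simp add: invariant_form_def)
    also have "\<dots> = coeff_eval P F" using invariant_form_lact[OF P(2) SL F] e by simp
    finally show "c N ^ d = 1" using P(3) by simp
  qed
  have "\<exists>v. infinite ((\<lambda>N. entries N v) ` S)"
  proof (rule ccontr)
    assume "\<nexists>v. infinite ((\<lambda>N. entries N v) ` S)"
    then have "finite (PiE UNIV (\<lambda>v. (\<lambda>N. entries N v) ` S))" by (intro finite_PiE) auto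
    moreover have "entries ` S \<subseteq> PiE UNIV (\<lambda>v. (\<lambda>N. entries N v) ` S)" by auto
    ultimately have "finite (entries ` S)" by (rule finite_subset[rotated])
    moreover have "inj (entries :: ('m, 'n) mat_pair \<Rightarrow> _)"
    proof (rule injI)
      fix M N :: "('m, 'n) mat_pair" assume e: "entries M = entries N"
      have "fst M $ i $ j = fst N $ i $ j" for i j using fun_cong[OF e, of "Inl (i, j)"] by (simp add: entries_def)
      moreover have "snd M $ i $ j = snd N $ i $ j" for i j using fun_cong[OF e, of "Inr (i, j)"] by (simp add: entries_def)
      ultimately show "M = N" by (simp add: prod_eq_iff vec_eq_iff)
    qed
    ultimately show False using infS finite_imageD[of entries S] inj_on_subset[of entries UNIV S] by simp
  qed
  then obtain v where v: "infinite ((\<lambda>N. entries N v) ` S)" by blast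
  define g where "g = (\<lambda>p :: ('m, 'n) mat_pair option. case p of None \<Rightarrow> (mat 1, mat 1) | Some N \<Rightarrow> N)"
  define y where "y = (\<lambda>p. case p of None \<Rightarrow> 0 | Some N \<Rightarrow> inverse (entries N v))"
  define J where "J = Some ` {N \<in> S. entries N v \<noteq> 0}"
  \<comment> \<open>Polynomials in the inverse of the entry, with that inverse sent to 0. This is
    well defined, since a polynomial vanishing at infinitely many values is zero.\<close>
  define B0 where "B0 = {\<lambda>p. poly q (y p) |q. True}"
  have mem: "f \<in> B0" if "\<And>p. f p = poly q (y p)" for f q
    using that unfolding B0_def by (auto simp: fun_eq_iff)
  have inf_y: "infinite (y ` J)"
  proof -
    have "y ` J = inverse ` ((\<lambda>N. entries N v) ` S - {0})"
      unfolding J_def image_image y_def by (auto simp: image_iff)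
    moreover have "infinite ((\<lambda>N. entries N v) ` S - {0})" using v by simp
    ultimately show ?thesis by (simp add: finite_image_iff inj_on_def)
  qed
  have "partial_place J None B0"
    unfolding partial_place_def
  proof (intro conjI allI ballI impI)
    fix b show "(\<lambda>_. b) \<in> B0" by (rule mem[of _ "[:b:]"]) simp
  next
    fix a b assume "a \<in> B0" "b \<in> B0"
    then obtain q r where qr: "a = (\<lambda>p. poly q (y p))" "b = (\<lambda>p. poly r (y p))" unfolding B0_def by blast
    show "(\<lambda>p. a p + b p) \<in> B0" by (rule mem[of _ "q + r"]) (simp add: qr)
    show "(\<lambda>p. a p * b p) \<in> B0" by (rule mem[of _ "q * r"]) (simp add: qr)
  next
    fix b assume "b \<in> B0" and z: "\<forall>p\<in>J. b p = 0"
    then obtain q where q: "b = (\<lambda>p. poly q (y p))" unfolding B0_def by blast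
    have "y ` J \<subseteq> {x. poly q x = 0}" using z q by auto
    then have "q = 0" using poly_roots_finite inf_y finite_subset by blast
    then show "b None = 0" by (simp add: q)
  qed
  then obtain B where B: "B0 \<subseteq> B" "partial_place J None B"
    "\<And>B'. partial_place J None B' \<Longrightarrow> B \<subseteq> B' \<Longrightarrow> B' = B"
    by (rule partial_place_extend) (rule that)
  have "None \<notin> J" by (auto simp: J_def)
  interpret place J None B by (rule place.intro[OF B(2,3) \<open>None \<notin> J\<close>])
  have det: "eventually (\<lambda>p. det (fst (g p)) = 1 \<and> det (snd (g p)) = 1) near"
    by (rule near_J) (use S(1) in \<open>auto simp: g_def J_def SL_SL_iff\<close>)
  have c: "integral (\<lambda>p. c (g p))"
  proof (rule integral_of_power[OF integral_cong[OF integral_const[of 1]] P(1)])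
    show "eventually (\<lambda>p. 1 = c (g p) ^ d) near" by (rule near_J) (auto simp: J_def g_def S(3))
  qed
  have int: "integral (\<lambda>p. lookup (lact (g p) F) I)" for I
  proof (rule integral_cong)
    show "integral (\<lambda>p. c (g p) * lookup F I)" by (intro integral_mult c integral_const)
    show "eventually (\<lambda>p. c (g p) * lookup F I = lookup (lact (g p) F) I) near"
      by (rule near_J) (auto simp: J_def g_def S(2) lookup_Const_mult)
  qed
  have cen': "centroid k l \<in> interior (Conv (lact h F))" if "invertible (fst h)" "invertible (snd h)" for h
    by (rule Conv_invertible[OF F, where R = "\<lambda>C. centroid k l \<in> interior C", OF cen that])
  have "integral (\<lambda>p. entries (g p) v)"
    using integral_of_centroid_interior[OF det F cen' int] by (cases v) (auto simp: entries_def)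
  moreover have "y \<in> B" using B(1) mem[of y "[:0, 1:]"] by auto
  moreover have "y None = 0" by (simp add: y_def)
  moreover have "eventually (\<lambda>p. y p * entries (g p) v = 1) near"
    by (rule near_J) (auto simp: J_def y_def g_def)
  ultimately show False by (rule infinitesimal_inverse_contradiction)
qed

text \<open>The forms vanishing on the orbit cut out its closure. A semistable point
  \<open>G\<close> of the closure is a specialisation of the orbit up to scalars. An invariant
  nonzero at \<open>G\<close> bounds these scalars, so the group element is integral and its
  reduction carries \<open>F\<close> to \<open>G\<close>.\<close>

theorem closed_orbit:
  fixes F :: "('m::finite, 'n::finite) var mpol"
  assumes ss: "git_semistable k l F"
    and cen: "\<And>N. N \<in> SL_SL \<Longrightarrow> centroid k l \<in> interior (Conv (lact N F))"
  shows "zariski_closed_in (semistable_locus k l) (orbit F)"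
proof -
  have F: "bihom k l F" and F0: "F \<noteq> 0" using ss by (simp_all add: git_semistable_def bihom_space_eq)
  define S where "S = {Q. (\<exists>d. homogeneous d Q) \<and> (\<forall>p\<in>orbit F. \<forall>H\<in>p. coeff_eval Q H = 0)}"
  have "p \<in> semistable_locus k l" if "p \<in> orbit F" for p
  proof -
    from that obtain g where "g \<in> SL_SL" "p = proj_pt (lact (pair_inverse g) F)" unfolding orbit_def act_pair_inverse by blast
    then show ?thesis unfolding semistable_locus_def using git_semistable_lact[OF ss pair_inverse_SL] by blast
  qed
  moreover have "p \<in> orbit F" if p: "p \<in> semistable_locus k l" "\<forall>H\<in>p. \<forall>Q\<in>S. coeff_eval Q H = 0" for p
  proof -
    obtain G where G: "p = proj_pt G" "git_semistable k l G" using p(1) unfolding semistable_locus_def by blast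
    have "G \<in> p" unfolding G(1) proj_pt_def mem_Collect_eq by (rule exI[of _ 1]) simp
    then have vanG: "coeff_eval Q G = 0" if "Q \<in> S" for Q using p(2) that by blast
    obtain d P where P: "d > 0" "invariant_form k l d P" "coeff_eval P G \<noteq> 0"
      using G(2) by (auto simp: git_semistable_def)
    have hP: "homogeneous d P" using P(2) by (simp add: invariant_form_def)
    \<comment> \<open>Scalars belong to the family because the points are projective: the closure is
      that of the cone over the orbit, and each homogeneous part of a polynomial vanishing on the
      family vanishes on the orbit.\<close>
    define J where "J = Some ` {(c :: complex, N :: ('m, 'n) mat_pair). c \<noteq> 0 \<and> N \<in> SL_SL}"
    define c where "c = (\<lambda>p :: (complex \<times> ('m, 'n) mat_pair) option. case p of None \<Rightarrow> 1 | Some x \<Rightarrow> fst x)"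
    define g where "g = (\<lambda>p :: (complex \<times> ('m, 'n) mat_pair) option. case p of None \<Rightarrow> (mat 1, mat 1) | Some x \<Rightarrow> snd x)"
    define \<Phi> where "\<Phi> = (\<lambda>p. case p of None \<Rightarrow> G | Some x \<Rightarrow> Const (fst x) * lact (snd x) F)"
    have J: "c p \<noteq> 0" "g p \<in> SL_SL" "\<Phi> p = Const (c p) * lact (g p) F" if "p \<in> J" for p
      using that by (auto simp: J_def c_def g_def \<Phi>_def)
    have cl: "coeff_eval Q (\<Phi> None) = 0" if Q: "\<And>p. p \<in> J \<Longrightarrow> coeff_eval Q (\<Phi> p) = 0" for Q
    proof -
      have "homogeneous_part e Q \<in> S" for e
        unfolding S_def mem_Collect_eq
      proof (intro conjI ballI)
        show "\<exists>e'. homogeneous e' (homogeneous_part e Q)" using homogeneous_homogeneous_part by blast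
        fix p' H assume "p' \<in> orbit F" "H \<in> p'"
        then obtain h b where h: "h \<in> SL_SL" "H = Const b * lact (pair_inverse h) F"
          unfolding orbit_def proj_pt_def act_pair_inverse by blast
        have "coeff_eval (homogeneous_part e Q) (lact (pair_inverse h) F) = 0"
        proof (rule coeff_eval_homogeneous_part_eq_0)
          fix a :: complex assume "a \<noteq> 0"
          then show "coeff_eval Q (Const a * lact (pair_inverse h) F) = 0"
            using Q[of "Some (a, pair_inverse h)"] pair_inverse_SL[OF h(1)] by (simp add: J_def \<Phi>_def)
        qed
        then show "coeff_eval (homogeneous_part e Q) H = 0" by (simp add: h(2) coeff_eval_scale[OF homogeneous_homogeneous_part])
      qed
      then have "coeff_eval (homogeneous_part e Q) G = 0" for e by (rule vanG)
      then have "coeff_eval Q G = 0" unfolding coeff_eval_def by (subst mpol_eval_homogeneous_part_sum) simp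
      then show ?thesis by (simp add: \<Phi>_def)
    qed
    have "None \<notin> J" by (auto simp: J_def)
    obtain B where B: "place J None B" "\<And>Q. (\<lambda>p. coeff_eval Q (\<Phi> p)) \<in> B"
      by (rule place_of_closure[of None J \<Phi>, OF \<open>None \<notin> J\<close> cl]) (assumption, rule that)
    interpret place J None B by (rule B(1))
    let ?b = "\<lambda>p. coeff_eval P (\<Phi> p)"
    have b: "?b p = c p ^ d * coeff_eval P F" if "p \<in> J" for p
      by (simp add: J(3)[OF that] coeff_eval_scale[OF hP] invariant_form_lact[OF P(2) J(2)[OF that] F])
    have bz: "?b None \<noteq> 0" using P(3) by (simp add: \<Phi>_def)
    have PF: "coeff_eval P F \<noteq> 0"
    proof
      assume "coeff_eval P F = 0"
      then have "?b None = 0" by (intro B_vanish[OF B(2)]) (simp add: b)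
      with bz show False by simp
    qed
    \<comment> \<open>\<open>P\<close> takes the value c^d P(F) on the family and a nonzero value at
      \<open>G\<close>, so c^d and its inverse are integral; roots preserve this.\<close>
    have c: "integral c"
    proof (rule integral_of_power[OF integral_cong[OF integral_mult[OF B_integral[OF B(2)] integral_const]] P(1)])
      show "eventually (\<lambda>p. ?b p * inverse (coeff_eval P F) = c p ^ d) near"
        by (rule near_J) (use PF in \<open>simp add: b\<close>)
    qed
    have c': "integral (\<lambda>p. inverse (c p))"
    proof (rule integral_of_power[OF integral_cong[OF integral_mult[OF B_inverse[OF B(2) bz] integral_const]] P(1)])
      show "eventually (\<lambda>p. inverse (?b p) * coeff_eval P F = inverse (c p) ^ d) near"
        by (rule near_J) (use PF in \<open>simp add: b power_inverse\<close>)
    qed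
    have lk: "(\<lambda>p. lookup (\<Phi> p) I) \<in> B" for I using B(2)[of "Var I"] by (simp add: coeff_eval_Var)
    have int: "integral (\<lambda>p. lookup (lact (g p) F) I)" for I
    proof (rule integral_cong[OF integral_mult[OF c' B_integral[OF lk]]])
      show "eventually (\<lambda>p. inverse (c p) * lookup (\<Phi> p) I = lookup (lact (g p) F) I) near"
        by (rule near_J) (simp add: J lookup_Const_mult)
    qed
    have det: "eventually (\<lambda>p. det (fst (g p)) = 1 \<and> det (snd (g p)) = 1) near"
      by (rule near_J) (use J(2) in \<open>simp add: SL_SL_iff\<close>)
    have cen': "centroid k l \<in> interior (Conv (lact h F))" if "invertible (fst h)" "invertible (snd h)" for h
      by (rule Conv_invertible[OF F, where R = "\<lambda>C. centroid k l \<in> interior C", OF cen that])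
    have "integral (\<lambda>p. entries (g p) v)" for v
      using integral_of_centroid_interior[OF det F cen' int] by (cases v) (auto simp: entries_def)
    then have "\<forall>v. \<exists>b. b \<in> B \<and> eventually (\<lambda>p. entries (g p) v = b p) near" unfolding integral_def by blast
    then have "\<exists>b. \<forall>v. b v \<in> B \<and> eventually (\<lambda>p. entries (g p) v = b v p) near" by (rule choice)
    then obtain e where e: "\<forall>v. e v \<in> B \<and> eventually (\<lambda>p. entries (g p) v = e v p) near" ..
    \<comment> \<open>Representatives in \<open>B\<close> of the entries of \<open>g\<close>. Unlike
      \<open>g\<close> itself they have a meaningful value at \<open>None\<close>.\<close>
    define h where "h = (\<lambda>p. ((\<chi> i j. e (Inl (i, j)) p), (\<chi> i j. e (Inr (i, j)) p)) :: ('m, 'n) mat_pair)"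
    have h1: "B_mat (\<lambda>p. fst (h p))" and h2: "B_mat (\<lambda>p. snd (h p))"
      using e by (simp_all add: B_mat_def h_def)
    have "eventually (\<lambda>p. \<forall>v. entries (g p) v = e v p) near" using e by (simp add: eventually_all_finite)
    then have gh: "eventually (\<lambda>p. g p = h p) near"
    proof eventually_elim
      case (elim p)
      have "fst (g p) $ i $ j = fst (h p) $ i $ j" for i j
        using elim[rule_format, of "Inl (i, j)"] by (simp add: entries_def h_def)
      moreover have "snd (g p) $ i $ j = snd (h p) $ i $ j" for i j
        using elim[rule_format, of "Inr (i, j)"] by (simp add: entries_def h_def)
      ultimately show ?case by (simp add: prod_eq_iff vec_eq_iff)
    qed
    obtain a where a: "a \<in> B" "eventually (\<lambda>p. c p = a p) near" using c unfolding integral_def by blast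
    have "det (fst (h None)) = 1"
    proof (rule B_near_eq[OF B_det[OF h1] B_const])
      show "eventually (\<lambda>p. det (fst (h p)) = 1) near" using gh det by eventually_elim simp
    qed
    moreover have "det (snd (h None)) = 1"
    proof (rule B_near_eq[OF B_det[OF h2] B_const])
      show "eventually (\<lambda>p. det (snd (h p)) = 1) near" using gh det by eventually_elim simp
    qed
    ultimately have hSL: "h None \<in> SL_SL" by (simp add: SL_SL_iff)
    have hF: "B_mpol (\<lambda>p. lact (h p) F)" by (rule B_mpol_lact[OF h1 h2 B_mpol_const F])
    have G_eq: "G = Const (a None) * lact (h None) F"
    proof (rule poly_mapping_eqI)
      fix I
      have "lookup (\<Phi> None) I = a None * lookup (lact (h None) F) I"
      proof (rule B_near_eq[OF lk B_mult[OF a(1)]])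
        show "(\<lambda>p. lookup (lact (h p) F) I) \<in> B" using hF by (simp add: B_mpol_def)
        have "eventually (\<lambda>p. \<Phi> p = Const (c p) * lact (g p) F) near" by (rule near_J) (rule J(3))
        then show "eventually (\<lambda>p. lookup (\<Phi> p) I = a p * lookup (lact (h p) F) I) near"
          using a(2) gh by eventually_elim (simp add: lookup_Const_mult)
      qed
      then show "lookup G I = lookup (Const (a None) * lact (h None) F) I"
        by (simp add: \<Phi>_def lookup_Const_mult)
    qed
    have "G \<noteq> 0" using G(2) by (simp add: git_semistable_def)
    then have "a None \<noteq> 0" using G_eq by auto
    then have "proj_pt G = proj_pt (act (pair_inverse (h None)) F)"
      unfolding proj_pt_eq_iff using G_eq lact_act[OF hSL] by metis
    then show "p \<in> orbit F" unfolding G(1) orbit_def using pair_inverse_SL[OF hSL] by blast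
  qed
  ultimately have "orbit F = {p \<in> semistable_locus k l. \<forall>H\<in>p. \<forall>Q\<in>S. coeff_eval Q H = 0}"
    unfolding S_def by blast
  moreover have "\<forall>Q\<in>S. \<exists>d. homogeneous d Q" unfolding S_def by blast
  ultimately show ?thesis unfolding zariski_closed_in_def by blast
qed

theorem theorem1p3:
  fixes k l :: nat and F :: "('m::finite, 'n::finite) var mpol"
  assumes "k > 0" and "l > 0"
    and "F \<in> bihom_space k l" and "F \<noteq> 0"
  shows "(git_semistable k l F \<longleftrightarrow> (\<forall>g\<in>SL_SL. centroid k l \<in> Conv (act g F))) \<and>
         (git_stable k l F \<longleftrightarrow> (\<forall>g\<in>SL_SL. centroid k l \<in> interior (Conv (act g F))))"
proof -
  have F: "bihom k l F" using assms(3) by (simp add: bihom_space_eq)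
  have ss: "git_semistable k l F \<longleftrightarrow> (\<forall>N\<in>SL_SL. centroid k l \<in> Conv (lact N F))"
    using semistable_of_centroid[OF F assms(4)] centroid_of_semistable git_semistable_lact by blast
  have st: "git_stable k l F \<longleftrightarrow> (\<forall>N\<in>SL_SL. centroid k l \<in> interior (Conv (lact N F)))"
  proof
    assume *: "\<forall>N\<in>SL_SL. centroid k l \<in> interior (Conv (lact N F))"
    then have "git_semistable k l F" using ss interior_subset by blast
    then show "git_stable k l F"
      using finite_stabilizer[of k l F] closed_orbit[of k l F] * by (simp add: git_stable_def)
  qed (blast intro: centroid_interior_of_stable)
  show ?thesis
    using ss st ball_act_iff[of "\<lambda>G. centroid k l \<in> Conv G" F]
      ball_act_iff[of "\<lambda>G. centroid k l \<in> interior (Conv G)" F] by simp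
qed

end
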